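(* Let $K$ be a field of characteristic zero. (C.1) Let $\Gamma\subset \mathrm{Aut}_0\,\mathbb{A}^2_K$ be the subgroup generated by the automorphisms $S(x,y)=(y,2x)$ and $T(x,y)=(x,y+x^2)$. Then $\Gamma$ is not linear, even over a ring; that is, there are no integer $n\ge1$, commutative ring $R$ and injective group homomorphism $\Gamma\to\mathrm{GL}(n,R)$. (C.2) Any finitely generated subgroup of $\mathrm{SAut}_0\,\mathbb{A}^2_K$ is linear over $K(t)$; that is, it admits an injective homomorphism into $\mathrm{GL}(n,K(t))$ for some integer $n\ge 1$.
   Context: $\mathrm{Aut}\,\mathbb{A}^2_K$ is the group of polynomial automorphisms of the affine plane over $K$ (pairs of polynomials in $K[x,y]$ invertible under composition). $\mathrm{Aut}_0\,\mathbb{A}^2_K$ is the subgroup of those $\phi$ with $\phi(\mathbf 0)=\mathbf 0$, and $\mathrm{SAut}_0\,\mathbb{A}^2_K$ is the subgroup of those $\phi\in\mathrm{Aut}_0\,\mathbb{A}^2_K$ with jacobian $\mathrm{Jac}(\phi)=\det\mathrm d\phi=1$. $K(t)$ is the field of rational functions in one variable. Rings are associative, commutative and unital. *)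

theory Defs
  imports
    "Jordan_Normal_Form.Matrix"
    "HOL-Algebra.Generated_Groups"
    "HOL-Computational_Algebra.Polynomial"
    "HOL-Computational_Algebra.Fraction_Field"
begin

text \<open>
  \<^typ>\<open>'a poly poly\<close> is $K[x][y]$: the inner variable is \<open>x\<close>, the outer one is \<open>y\<close>.
\<close>

abbreviation var_x :: "'a::comm_ring_1 poly poly" where
  "var_x \<equiv> [:[:0, 1:]:]"

abbreviation var_y :: "'a::comm_ring_1 poly poly" where
  "var_y \<equiv> [:0, 1:]"

text \<open>\<open>subst2 p q r\<close> is $p(q, r)$: the scalar \<open>a\<close> becomes the constant \<open>[:[:a:]:]\<close>.\<close>

definition subst2 :: "'a::comm_ring_1 poly poly \<Rightarrow> 'a poly poly \<Rightarrow> 'a poly poly \<Rightarrow> 'a poly poly" where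
  "subst2 p q r = poly (map_poly (\<lambda>c. poly (map_poly (\<lambda>a. [:[:a:]:]) c) q) p) r"

definition eval2 :: "'a::comm_ring_1 poly poly \<Rightarrow> 'a \<Rightarrow> 'a \<Rightarrow> 'a" where
  "eval2 p a b = poly (poly p [:b:]) a"

definition deriv_x :: "'a::idom poly poly \<Rightarrow> 'a poly poly" where
  "deriv_x p = map_poly pderiv p"

definition deriv_y :: "'a::idom poly poly \<Rightarrow> 'a poly poly" where
  "deriv_y p = pderiv p"

type_synonym 'a plane_map = "'a poly poly \<times> 'a poly poly"

definition plane_id :: "'a::comm_ring_1 plane_map" where
  "plane_id = (var_x, var_y)"

definition plane_comp :: "'a::comm_ring_1 plane_map \<Rightarrow> 'a plane_map \<Rightarrow> 'a plane_map" where
  "plane_comp \<phi> \<psi> =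
     (subst2 (fst \<phi>) (fst \<psi>) (snd \<psi>), subst2 (snd \<phi>) (fst \<psi>) (snd \<psi>))"

definition plane_apply :: "'a::comm_ring_1 plane_map \<Rightarrow> 'a \<times> 'a \<Rightarrow> 'a \<times> 'a" where
  "plane_apply \<phi> = (\<lambda>(a, b). (eval2 (fst \<phi>) a b, eval2 (snd \<phi>) a b))"

definition jacobian :: "'a::idom plane_map \<Rightarrow> 'a poly poly" where
  "jacobian \<phi> = deriv_x (fst \<phi>) * deriv_y (snd \<phi>) - deriv_y (fst \<phi>) * deriv_x (snd \<phi>)"

definition Aut_plane :: "'a::field plane_map monoid" where
  "Aut_plane = units_of \<lparr>carrier = UNIV, mult = plane_comp, one = plane_id\<rparr>"

definition Aut0_plane :: "'a::field plane_map monoid" where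
  "Aut0_plane = Aut_plane
     \<lparr>carrier := {\<phi> \<in> carrier Aut_plane. plane_apply \<phi> (0, 0) = (0, 0)}\<rparr>"

definition SAut0_plane :: "'a::field plane_map monoid" where
  "SAut0_plane = Aut0_plane
     \<lparr>carrier := {\<phi> \<in> carrier Aut0_plane. jacobian \<phi> = 1}\<rparr>"

definition S_map :: "'a::field plane_map" where
  "S_map = (var_y, 2 * var_x)"

definition T_map :: "'a::field plane_map" where
  "T_map = (var_x, var_y + var_x\<^sup>2)"

text \<open>
  The sort \<open>{comm_ring, comm_monoid_mult}\<close> describes exactly the commutative unital rings;
  the class \<open>comm_ring_1\<close> would in addition exclude the zero ring.
\<close>

definition GL :: "nat \<Rightarrow> 'r::{comm_ring, comm_monoid_mult} mat monoid" where
  "GL n = units_of \<lparr>carrier = carrier_mat n n, mult = (*), one = 1\<^sub>m n\<rparr>"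

definition linear_over ::
    "'r::{comm_ring, comm_monoid_mult} itself \<Rightarrow> ('g, 'b) monoid_scheme \<Rightarrow> bool" where
  "linear_over _ G \<longleftrightarrow> (\<exists>n\<ge>1. mon G (GL n :: 'r mat monoid) \<noteq> {})"

end

theory Submission
  imports Defs "HOL-Algebra.Algebraic_Closure_Type" "Jordan_Normal_Form.Determinant"
    "HOL-Computational_Algebra.Formal_Power_Series"
begin

hide_const (open) Polynomials.degree Polynomials.lead_coeff up_ring.coeff up_ring.monom

text \<open>
  Non-linearity: let \<open>a = T\<close> and \<open>b = S\<inverse>TS\<close>. Conjugation by \<open>S\<^sup>2 = (2x, 2y)\<close> squares both of them. In a
  matrix group over an algebraically closed field this forces fixed powers of \<open>a\<close> and \<open>b\<close> to be
  unipotent; if they are not trivial, they differ from 1 by sums of eigenvectors of the conjugation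
  for eigenvalues \<open>2\<^sup>i\<close>, and long products of those vanish. So iterating a commutator map on the pair of powers reaches the
  identity after a number of steps that depends on the matrix size only. Over a commutative
  ring this applies to all residue fields; the remaining nilpotent entries, finitely many, are killed by
  further steps. On the plane, however, the iterated commutators are non-trivial by ping-pong.

  Linearity: by Jung's theorem \<open>SAut\<^sub>0\<close> is generated by \<open>e(p) = (x, y + p(x))\<close>, the torus
  \<open>d(a) = (ax, y/a)\<close> and \<open>w = (y, -x)\<close>; finitely many elements involve only \<open>p\<close> of bounded degree. Let
  \<open>e(\<Sum> c\<^sub>k x\<^sup>k)\<close> act as the upper triangular matrix with the coefficients of the exponential series
  of \<open>\<Sum> c\<^sub>k t^(k\<^sup>2-1) z^(k+1)\<close> along its diagonals, up to a rescaling of the basis, and let \<open>SL\<^sub>2\<close> act by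
  binary forms of two consecutive degrees. These actions agree where they overlap. A normal form of
  positive length is non-trivial on the plane by its degree, and as a matrix by the degree in \<open>t\<close> of
  its corner entry.
\<close>

section \<open>Iterated commutators\<close>

text \<open>The number of commutator steps may depend on the size of the matrices but not on the
  field: a ring has many residue fields, and one and the same word must become trivial in all of
  them before its entries can be called nilpotent. This is why the exponents are explicit integers
  valid in every characteristic. Within the range needed, the eigenvalues 2^i coincide in finitely
  many characteristics only, and there the exponent already turns unipotent elements into 1. For
  linearity the weights of the torus dictate the shape. Conjugation by d(a) multiplies the
  coefficient of x^k by a^(k+1), so e(x^k) moves a weight vector by k+1 places, whence z^(k+1).
  Binary forms of one degree have weights of one parity; two consecutive degrees supply each weight
  once. The exponent k^2-1 is (k-1)(k+1): per place moved the degree in t grows by k-1, so the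
  leading monomial wins. It attains the bound at offsets divisible by k+1; hence the corner offset
  2m+2 is made a multiple of all these numbers, namely twice a factorial.\<close>

type_synonym 'g quad = "'g \<times> 'g \<times> 'g \<times> 'g"

text \<open>A quadruple \<open>(a, a', b, b')\<close> carries two elements together with their inverses. The conjugations
  by \<open>a\<^sup>2\<close> and \<open>b\<^sup>2\<close> make both commutators begin and end with powers of \<open>a\<close> and \<open>b\<close>, respectively, so
  that they play ping-pong again.\<close>

definition dstep :: "('g \<Rightarrow> 'g \<Rightarrow> 'g) \<Rightarrow> 'g quad \<Rightarrow> 'g quad" where
  "dstep f = (\<lambda>(a, a', b, b').
     let c = f (f a b) (f a' b'); c' = f (f b a) (f b' a')
     in (f (f a a) (f c (f a' a')), f (f a a) (f c' (f a' a')),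
         f (f b b) (f c' (f b' b')), f (f b b) (f c (f b' b'))))"

definition quad_map :: "('g \<Rightarrow> 'h) \<Rightarrow> 'g quad \<Rightarrow> 'h quad" where
  "quad_map \<theta> = (\<lambda>(a, a', b, b'). (\<theta> a, \<theta> a', \<theta> b, \<theta> b'))"

definition quad_all :: "('g \<Rightarrow> bool) \<Rightarrow> 'g quad \<Rightarrow> bool" where
  "quad_all P = (\<lambda>(a, a', b, b'). P a \<and> P a' \<and> P b \<and> P b')"

lemma quad_all_simp [simp]: "quad_all P (a, a', b, b') \<longleftrightarrow> P a \<and> P a' \<and> P b \<and> P b'"
  by (simp add: quad_all_def)

lemma quad_map_simp [simp]: "quad_map \<theta> (a, a', b, b') = (\<theta> a, \<theta> a', \<theta> b, \<theta> b')"
  by (simp add: quad_map_def)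

lemma quad_all_map: "quad_all P (quad_map \<theta> q) \<longleftrightarrow> quad_all (\<lambda>x. P (\<theta> x)) q"
  by (cases q) simp

lemma quad_all_mono: "(\<And>x. P x \<Longrightarrow> Q x) \<Longrightarrow> quad_all P q \<Longrightarrow> quad_all Q q"
  by (cases q) simp

lemma dstep_closed:
  assumes "\<And>x y. x \<in> S \<Longrightarrow> y \<in> S \<Longrightarrow> f x y \<in> S" and "quad_all (\<lambda>x. x \<in> S) q"
  shows "quad_all (\<lambda>x. x \<in> S) ((dstep f ^^ k) q)"
proof (induction k)
  case (Suc k)
  then show ?case
    by (cases "(dstep f ^^ k) q") (simp add: dstep_def Let_def assms(1))
qed (use assms in simp)

lemma dstep_hom:
  assumes "\<And>x y. x \<in> S \<Longrightarrow> y \<in> S \<Longrightarrow> f x y \<in> S"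
    and "\<And>x y. x \<in> S \<Longrightarrow> y \<in> S \<Longrightarrow> \<theta> (f x y) = g (\<theta> x) (\<theta> y)"
    and "quad_all (\<lambda>x. x \<in> S) q"
  shows "quad_map \<theta> ((dstep f ^^ k) q) = (dstep g ^^ k) (quad_map \<theta> q)"
proof (induction k)
  case (Suc k)
  have "quad_all (\<lambda>x. x \<in> S) ((dstep f ^^ k) q)"
    using dstep_closed[OF assms(1,3)] .
  then have "quad_map \<theta> (dstep f ((dstep f ^^ k) q)) = dstep g (quad_map \<theta> ((dstep f ^^ k) q))"
    by (cases "(dstep f ^^ k) q") (simp add: dstep_def Let_def assms(1,2))
  then show ?case
    using Suc by simp
qed simp

text \<open>All positive powers are included because the property has to reproduce itself: the next
  pair is controlled through squares and cubes of the present maps.\<close>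

definition pingpong :: "'p set \<Rightarrow> 'p set \<Rightarrow> ('p \<Rightarrow> 'p) quad \<Rightarrow> bool" where
  "pingpong Z Y = (\<lambda>(a, a', b, b'). a \<circ> a' = id \<and> a' \<circ> a = id \<and> b \<circ> b' = id \<and> b' \<circ> b = id \<and>
     (\<forall>k\<ge>1. (a ^^ k) ` Y \<subseteq> Z \<and> (a' ^^ k) ` Y \<subseteq> Z \<and> (b ^^ k) ` Z \<subseteq> Y \<and> (b' ^^ k) ` Z \<subseteq> Y))"

lemma funpow_conj:
  assumes "g' \<circ> g = id" "g \<circ> g' = id"
  shows "(g \<circ> (c \<circ> g')) ^^ k = g \<circ> (c ^^ k) \<circ> g'"
proof (induction k)
  case (Suc k)
  have "(g \<circ> (c \<circ> g')) ^^ Suc k = (g \<circ> (c \<circ> g')) \<circ> (g \<circ> (c ^^ k) \<circ> g')"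
    unfolding funpow.simps(2) Suc ..
  also have "\<dots> = g \<circ> c \<circ> (g' \<circ> g) \<circ> (c ^^ k) \<circ> g'"
    by (simp add: comp_assoc)
  also have "\<dots> = g \<circ> (c ^^ Suc k) \<circ> g'"
    using assms by (simp add: comp_assoc)
  finally show ?case .
qed (use assms in simp)

text \<open>The conjugation by \<open>a \<circ> a\<close> stays outside the \<open>k\<close>-th
  power. The first commutator keeps \<open>Z\<close> invariant and ends with an application of
  \<open>a\<close> to a point of \<open>Y\<close>, so the outer square produces a cube of
  \<open>a\<close>. The second one begins with \<open>a'\<close>, which joins the inner square to a
  cube of \<open>a'\<close>; its values lie in \<open>Y\<close>, and the outer square brings them
  back to \<open>Z\<close>.\<close>

lemma pingpong_step_aux:
  assumes a: "\<And>k y. k \<ge> 1 \<Longrightarrow> y \<in> Y \<Longrightarrow> (a ^^ k) y \<in> Z" "\<And>k y. k \<ge> 1 \<Longrightarrow> y \<in> Y \<Longrightarrow> (a' ^^ k) y \<in> Z"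
    and b: "\<And>x. x \<in> Z \<Longrightarrow> b x \<in> Y" "\<And>x. x \<in> Z \<Longrightarrow> b' x \<in> Y"
    and inv: "a' \<circ> a = id" "a \<circ> a' = id"
    and k: "k \<ge> (1::nat)" and y: "y \<in> Y"
  shows "(((a \<circ> a) \<circ> (((a \<circ> b) \<circ> (a' \<circ> b')) \<circ> (a' \<circ> a'))) ^^ k) y \<in> Z"
    and "(((a \<circ> a) \<circ> (((b \<circ> a) \<circ> (b' \<circ> a')) \<circ> (a' \<circ> a'))) ^^ k) y \<in> Z"
proof -
  have a1: "a z \<in> Z" "a' z \<in> Z" if "z \<in> Y" for z
    using a(1)[of 1 z] a(2)[of 1 z] that by auto
  have a2: "a (a z) \<in> Z" "a' (a' z) \<in> Z" if "z \<in> Y" for z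
    using a(1)[of 2 z] a(2)[of 2 z] that by (auto simp: numeral_2_eq_2)
  have a3: "a (a (a z)) \<in> Z" "a' (a' (a' z)) \<in> Z" if "z \<in> Y" for z
    using a(1)[of 3 z] a(2)[of 3 z] that by (auto simp: numeral_3_eq_3)
  have inv2: "(a' \<circ> a') \<circ> (a \<circ> a) = id" "(a \<circ> a) \<circ> (a' \<circ> a') = id"
    using inv by (metis comp_assoc comp_id)+
  obtain j where j: "k = Suc j"
    using k by (cases k) auto
  define c where "c = (a \<circ> b) \<circ> (a' \<circ> b')"
  define d where "d = (b \<circ> a) \<circ> (b' \<circ> a')"
  have "\<exists>y1\<in>Y. (c ^^ Suc j) x = a y1" if "x \<in> Z" for x
  proof (induction j)
    case (Suc j)
    then have "(c ^^ Suc j) x \<in> Z"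
      using a1 by auto
    then have "b (a' (b' ((c ^^ Suc j) x))) \<in> Y"
      using a1 b by simp
    moreover have "(c ^^ Suc (Suc j)) x = a (b (a' (b' ((c ^^ Suc j) x))))"
      unfolding funpow.simps(2)[of "Suc j"] by (simp only: c_def comp_def)
    ultimately show ?case
      by blast
  qed (use that a1 b in \<open>auto simp: c_def\<close>)
  from this[OF a2(2)[OF y]] obtain y1 where "y1 \<in> Y" "(c ^^ Suc j) (a' (a' y)) = a y1"
    by blast
  then show "(((a \<circ> a) \<circ> (((a \<circ> b) \<circ> (a' \<circ> b')) \<circ> (a' \<circ> a'))) ^^ k) y \<in> Z"
    unfolding funpow_conj[OF inv2] c_def[symmetric] j using a3 by simp
  have "(d ^^ Suc j) (a' (a' y)) \<in> Y"
  proof (induction j)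
    case (Suc j)
    have "(d ^^ Suc (Suc j)) (a' (a' y)) = b (a (b' (a' ((d ^^ Suc j) (a' (a' y))))))"
      unfolding funpow.simps(2)[of "Suc j"] by (simp only: d_def comp_def)
    then show ?case
      using Suc a1 b by simp
  qed (use a1 a3 b y in \<open>auto simp: d_def\<close>)
  then show "(((a \<circ> a) \<circ> (((b \<circ> a) \<circ> (b' \<circ> a')) \<circ> (a' \<circ> a'))) ^^ k) y \<in> Z"
    unfolding funpow_conj[OF inv2] d_def[symmetric] j using a2 by simp
qed

lemma pingpong_dstep:
  assumes "pingpong Z Y q"
  shows "pingpong Z Y (dstep (\<circ>) q)"
proof -
  obtain a a' b b' where q: "q = (a, a', b, b')"
    by (cases q)
  have inv: "a \<circ> a' = id" "a' \<circ> a = id" "b \<circ> b' = id" "b' \<circ> b = id"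
    and a: "\<And>k y. k \<ge> 1 \<Longrightarrow> y \<in> Y \<Longrightarrow> (a ^^ k) y \<in> Z" "\<And>k y. k \<ge> 1 \<Longrightarrow> y \<in> Y \<Longrightarrow> (a' ^^ k) y \<in> Z"
    and b: "\<And>k y. k \<ge> 1 \<Longrightarrow> y \<in> Z \<Longrightarrow> (b ^^ k) y \<in> Y" "\<And>k y. k \<ge> 1 \<Longrightarrow> y \<in> Z \<Longrightarrow> (b' ^^ k) y \<in> Y"
    using assms unfolding q pingpong_def by (auto simp: image_subset_iff)
  have a1: "\<And>y. y \<in> Y \<Longrightarrow> a y \<in> Z" "\<And>y. y \<in> Y \<Longrightarrow> a' y \<in> Z"
    using a(1)[of 1] a(2)[of 1] by auto
  have b1: "\<And>y. y \<in> Z \<Longrightarrow> b y \<in> Y" "\<And>y. y \<in> Z \<Longrightarrow> b' y \<in> Y"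
    using b(1)[of 1] b(2)[of 1] by auto
  have i: "a (a' x) = x" "a' (a x) = x" "b (b' x) = x" "b' (b x) = x" for x
    using inv by (simp_all add: fun_eq_iff)
  show ?thesis
    unfolding q dstep_def Let_def pingpong_def prod.case image_subset_iff
    using pingpong_step_aux[OF a b1 inv(2,1)] pingpong_step_aux[OF b a1 inv(4,3)]
    by (simp add: fun_eq_iff i)
qed

lemma pingpong_iter:
  "pingpong Z Y q \<Longrightarrow> pingpong Z Y ((dstep (\<circ>) ^^ k) q)"
  by (induction k) (auto intro: pingpong_dstep)

lemma pingpong_not_id:
  assumes "pingpong Z Y q" "Z \<inter> Y = {}" "Y \<noteq> {}"
  shows "fst q \<noteq> id"
proof
  assume "fst q = id"
  moreover have "\<forall>k\<ge>1. (fst q ^^ k) ` Y \<subseteq> Z"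
    using assms(1) unfolding pingpong_def by (simp split: prod.splits)
  then have "(fst q ^^ 1) ` Y \<subseteq> Z"
    by blast
  ultimately show False
    using assms(2,3) by auto
qed

section \<open>Filtrations of rings and the depth of commutators\<close>

definition quad_inv :: "'e::ring_1 quad \<Rightarrow> bool" where
  "quad_inv = (\<lambda>(a, a', b, b'). a * a' = 1 \<and> a' * a = 1 \<and> b * b' = 1 \<and> b' * b = 1)"

lemma quad_inv_dstep:
  assumes "quad_inv q"
  shows "quad_inv (dstep (*) q)"
proof -
  obtain a a' b b' where q: "q = (a, a', b, b')"
    by (cases q)
  have inv: "a * a' = 1" "a' * a = 1" "b * b' = 1" "b' * b = 1"
    using assms by (simp_all add: q quad_inv_def)
  have r: "a * (a' * x) = x" "a' * (a * x) = x" "b * (b' * x) = x" "b' * (b * x) = x" for x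
    by (simp_all add: inv mult.assoc[symmetric])
  show ?thesis
    by (simp add: q quad_inv_def dstep_def Let_def mult.assoc r inv)
qed

lemma quad_inv_iter: "quad_inv q \<Longrightarrow> quad_inv ((dstep (*) ^^ k) q)"
  by (induction k) (auto intro: quad_inv_dstep)

locale ring_filtration =
  fixes A :: "nat \<Rightarrow> 'e::ring_1 set"
  assumes add: "x \<in> A i \<Longrightarrow> y \<in> A i \<Longrightarrow> x + y \<in> A i"
    and uminus: "x \<in> A i \<Longrightarrow> - x \<in> A i"
    and mult: "x \<in> A i \<Longrightarrow> y \<in> A j \<Longrightarrow> x * y \<in> A (i + j)"
    and decr: "A (Suc i) \<subseteq> A i"
begin

lemma diff: "x \<in> A i \<Longrightarrow> y \<in> A i \<Longrightarrow> x - y \<in> A i"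
  using add[of x i "- y"] uminus by simp

lemma antimono: "i \<le> j \<Longrightarrow> A j \<subseteq> A i"
  by (rule lift_Suc_antimono_le[of A]) (use decr in auto)

lemma mult_unit:
  assumes "z \<in> A j" "u - 1 \<in> A i"
  shows "z * u \<in> A j" "u * z \<in> A j"
proof -
  have "z * (u - 1) \<in> A j" "(u - 1) * z \<in> A j"
    using mult[OF assms] mult[OF assms(2,1)] antimono[of j "j + i"] antimono[of j "i + j"] by auto
  then have "z + z * (u - 1) \<in> A j" "z + (u - 1) * z \<in> A j"
    using assms by (auto intro: add)
  then show "z * u \<in> A j" "u * z \<in> A j"
    by (simp_all add: algebra_simps)
qed

text \<open>The group commutator minus 1 is the additive commutator of \<open>a - 1\<close> and
  \<open>b - 1\<close>, multiplied by \<open>a' * b'\<close>. This is what doubles the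
  depth.\<close>

lemma commutator:
  assumes "a - 1 \<in> A i" "a' - 1 \<in> A i" "b - 1 \<in> A i" "b' - 1 \<in> A i"
    and "a * a' = 1" "b * b' = 1"
  shows "(a * b) * (a' * b') - 1 \<in> A (i + i)"
proof -
  have "(a - 1) * (b - 1) - (b - 1) * (a - 1) \<in> A (i + i)"
    using assms by (intro diff[OF mult mult])
  then have "((a - 1) * (b - 1) - (b - 1) * (a - 1)) * a' * b' \<in> A (i + i)"
    using assms by (intro mult_unit(1))
  moreover have "((a - 1) * (b - 1) - (b - 1) * (a - 1)) * a' * b' = a * b * a' * b' - b * (a * a') * b'"
    by (simp add: algebra_simps)
  ultimately show ?thesis
    using assms by (simp add: mult.assoc)
qed

lemma conj_unit:
  assumes "c - 1 \<in> A j" "a - 1 \<in> A i" "a' - 1 \<in> A i" "a * a' = 1"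
  shows "(a * a) * (c * (a' * a')) - 1 \<in> A j"
proof -
  have "a * (a * (c - 1)) * a' * a' \<in> A j"
    using assms by (intro mult_unit)
  moreover have "a * (a * (c - 1)) * a' * a' = (a * a) * (c * (a' * a')) - a * (a * a') * a'"
    by (simp add: algebra_simps)
  ultimately show ?thesis
    using assms by simp
qed

lemma dstep_double:
  assumes "quad_inv q" "quad_all (\<lambda>x. x - 1 \<in> A i) q"
  shows "quad_all (\<lambda>x. x - 1 \<in> A (i + i)) (dstep (*) q)"
proof -
  obtain a a' b b' where q: "q = (a, a', b, b')"
    by (cases q)
  have inv: "a * a' = 1" "a' * a = 1" "b * b' = 1" "b' * b = 1"
    using assms by (simp_all add: q quad_inv_def)
  have A: "a - 1 \<in> A i" "a' - 1 \<in> A i" "b - 1 \<in> A i" "b' - 1 \<in> A i"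
    using assms(2) by (simp_all add: q)
  show ?thesis
    using conj_unit[OF commutator[OF A inv(1,3)] A(1,2) inv(1)]
      conj_unit[OF commutator[OF A(3,4,1,2) inv(3,1)] A(1,2) inv(1)]
      conj_unit[OF commutator[OF A inv(1,3)] A(3,4) inv(3)]
      conj_unit[OF commutator[OF A(3,4,1,2) inv(3,1)] A(3,4) inv(3)]
    by (simp add: q dstep_def Let_def)
qed

lemma dstep_iter:
  assumes "quad_inv q" "quad_all (\<lambda>x. x - 1 \<in> A 1) q"
  shows "quad_all (\<lambda>x. x - 1 \<in> A (2 ^ k)) ((dstep (*) ^^ k) q)"
proof (induction k)
  case (Suc k)
  show ?case
    using dstep_double[OF quad_inv_iter[OF assms(1)] Suc] by (simp add: mult_2)
qed (use assms in simp)

end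

inductive_set add_span :: "'e::ring_1 set \<Rightarrow> 'e set" for S where
  zero: "0 \<in> add_span S"
| plus: "s \<in> S \<Longrightarrow> x \<in> add_span S \<Longrightarrow> s + x \<in> add_span S"
| minus: "s \<in> S \<Longrightarrow> x \<in> add_span S \<Longrightarrow> x - s \<in> add_span S"

lemma add_span_base: "s \<in> S \<Longrightarrow> s \<in> add_span S"
  using add_span.plus[OF _ add_span.zero] by fastforce

lemma add_span_add: "x \<in> add_span S \<Longrightarrow> y \<in> add_span S \<Longrightarrow> x + y \<in> add_span S"
proof (induction x rule: add_span.induct)
  case (plus s x)
  then show ?case by (metis add.assoc add_span.plus)
next
  case (minus s x)
  then show ?case by (metis add_diff_eq add.commute add_span.minus)
qed simp

lemma add_span_uminus: "x \<in> add_span S \<Longrightarrow> - x \<in> add_span S"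
proof (induction x rule: add_span.induct)
  case (plus s x)
  have "- (s + x) = - x - s"
    by simp
  then show ?case using add_span.minus[OF plus(1,3)] by metis
next
  case (minus s x)
  then show ?case using add_span.plus[of s S "- x"] by simp
qed (simp add: add_span.zero)

lemma add_span_mono: "S \<subseteq> T \<Longrightarrow> add_span S \<subseteq> add_span T"
proof
  fix x assume "S \<subseteq> T" "x \<in> add_span S"
  from this(2,1) show "x \<in> add_span T"
    by (induction x rule: add_span.induct) (auto intro: add_span.intros)
qed

lemma add_span_sum: "(\<And>i. i \<in> I \<Longrightarrow> f i \<in> add_span S) \<Longrightarrow> sum f I \<in> add_span S"
  by (induction I rule: infinite_finite_induct) (auto intro: add_span_add add_span.zero)

lemma add_span_mult:
  assumes "\<And>s t. s \<in> S \<Longrightarrow> t \<in> T \<Longrightarrow> s * t \<in> U" "x \<in> add_span S" "y \<in> add_span T"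
  shows "x * y \<in> add_span U"
proof -
  have base: "s * y \<in> add_span U" if s: "s \<in> S" for s
    using assms(3)
  proof (induction y rule: add_span.induct)
    case (plus t y)
    then show ?case
      using add_span.plus[of "s * t" U "s * y"] assms(1) s by (simp add: algebra_simps)
  next
    case (minus t y)
    then show ?case
      using add_span.minus[of "s * t" U "s * y"] assms(1) s by (simp add: algebra_simps)
  qed (simp add: add_span.zero)
  show ?thesis
    using assms(2)
  proof (induction x rule: add_span.induct)
    case (plus s x)
    then show ?case
      using add_span_add[OF base[OF plus(1)] plus(3)] by (simp add: algebra_simps)
  next
    case (minus s x)
    then show ?case
      using add_span_add[OF minus(3) add_span_uminus[OF base[OF minus(1)]]] by (simp add: algebra_simps)
  qed (simp add: add_span.zero)
qed

lemma ring_filtration_add_span: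
  assumes "\<And>i j s t. s \<in> S i \<Longrightarrow> t \<in> S j \<Longrightarrow> s * t \<in> S (i + j)" "\<And>i. S (Suc i) \<subseteq> S i"
  shows "ring_filtration (\<lambda>i. add_span (S i) :: 'e::ring_1 set)"
proof
  show "x * y \<in> add_span (S (i + j))" if "x \<in> add_span (S i)" "y \<in> add_span (S j)" for x y i j
    using that assms(1) by (rule add_span_mult[rotated])
  show "add_span (S (Suc i)) \<subseteq> add_span (S i)" for i
    using add_span_mono[OF assms(2)] .
qed (auto intro: add_span_add add_span_uminus)

section \<open>Elements conjugate to their squares in a finite-dimensional algebra\<close>

text \<open>Roots of unity with \<open>\<lambda>^(2\<^sup>i) = \<lambda>^(2\<^sup>j)\<close> for distinct \<open>i, j \<le> d\<close> have order dividing \<open>root_exp d\<close>. In the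
  characteristics that divide \<open>good_exp d\<close> unipotent elements have order dividing a power of it; in all
  others the eigenvalues \<open>2\<^sup>i\<close> with \<open>i \<le> d\<^sup>2\<close> are distinct.\<close>

definition root_exp :: "nat \<Rightarrow> nat" where
  "root_exp d = 2 ^ d * (\<Prod>j=1..d. 2 ^ j - 1)"

definition good_exp :: "nat \<Rightarrow> nat" where
  "good_exp d = 2 * (\<Prod>j=1..d * d. 2 ^ j - 1)"

definition unipotent_exp :: "nat \<Rightarrow> nat" where
  "unipotent_exp d = good_exp d ^ d * root_exp d"

text \<open>The dimension enters through \<open>dependent\<close> alone: any \<open>d + 1\<close>
  elements of \<open>V\<close> are linearly dependent. \<open>V\<close> is a subalgebra of a ring
  type that does not vary with \<open>d\<close>, so that one type serves matrices of all
  sizes.\<close>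

locale findim_algebra =
  fixes sc :: "'f::alg_closed_field \<Rightarrow> 'e::ring_1" and V :: "'e set" and d :: nat
  assumes sc_0 [simp]: "sc 0 = 0" and sc_1 [simp]: "sc 1 = 1"
    and sc_add: "sc (x + y) = sc x + sc y" and sc_mult: "sc (x * y) = sc x * sc y"
    and sc_comm: "sc x * e = e * sc x"
    and V_1: "1 \<in> V" and V_add: "u \<in> V \<Longrightarrow> v \<in> V \<Longrightarrow> u + v \<in> V"
    and V_mult: "u \<in> V \<Longrightarrow> v \<in> V \<Longrightarrow> u * v \<in> V" and V_sc: "sc x \<in> V"
    and dependent: "(\<And>i. i \<le> d \<Longrightarrow> f i \<in> V) \<Longrightarrow>
      \<exists>\<gamma>. (\<exists>i\<le>d. \<gamma> i \<noteq> 0) \<and> (\<Sum>i\<le>d. sc (\<gamma> i) * f i) = 0"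
begin

lemma sc_uminus: "sc (- x) = - sc x"
  using sc_add[of x "- x"] by (simp add: eq_neg_iff_add_eq_0 add.commute)

lemma sc_diff: "sc (x - y) = sc x - sc y"
  using sc_add[of x "- y"] sc_uminus[of y] by simp

lemma sc_of_nat: "sc (of_nat n) = of_nat n"
  by (induction n) (simp_all add: sc_add)

lemma sc_2: "sc 2 = 2"
  using sc_of_nat[of 2] by simp

lemma sc_cancel: "sc x * e = 0 \<Longrightarrow> x \<noteq> 0 \<Longrightarrow> e = 0"
  using sc_mult[of "inverse x" x] by (metis left_inverse mult.assoc mult_1 mult_zero_right sc_1)

lemma V_uminus: "v \<in> V \<Longrightarrow> - v \<in> V"
  using V_mult[OF V_sc[of "-1"]] by (simp add: sc_uminus)

lemma V_0: "0 \<in> V"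
  using V_sc[of 0] by simp

lemma V_power: "v \<in> V \<Longrightarrow> v ^ n \<in> V"
  by (induction n) (auto intro: V_1 V_mult)

definition ev :: "'e \<Rightarrow> 'f poly \<Rightarrow> 'e" where
  "ev a p = (\<Sum>i\<le>degree p. sc (coeff p i) * a ^ i)"

lemma ev_bound: "degree p \<le> n \<Longrightarrow> ev a p = (\<Sum>i\<le>n. sc (coeff p i) * a ^ i)"
  unfolding ev_def by (rule sum.mono_neutral_left) (auto simp: coeff_eq_0)

lemma ev_0 [simp]: "ev a 0 = 0"
  by (simp add: ev_def)

lemma ev_pCons [simp]: "ev a (pCons c p) = sc c + a * ev a p"
proof -
  have "ev a (pCons c p) = (\<Sum>i\<le>Suc (degree p). sc (coeff (pCons c p) i) * a ^ i)"
    by (rule ev_bound) (simp add: degree_pCons_le)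
  also have "\<dots> = sc c + (\<Sum>i\<le>degree p. sc (coeff p i) * a ^ Suc i)"
    by (subst sum.atMost_Suc_shift) simp
  also have "(\<Sum>i\<le>degree p. sc (coeff p i) * a ^ Suc i) = a * ev a p"
    by (simp add: ev_def sum_distrib_left) (simp add: mult.assoc[symmetric] sc_comm[of _ a])
  finally show ?thesis .
qed

lemma ev_1 [simp]: "ev a 1 = 1"
  using ev_pCons[of a 1 0] by (simp add: one_pCons[symmetric])

lemma ev_add: "ev a (p + q) = ev a p + ev a q"
proof -
  have "degree (p + q) \<le> max (degree p) (degree q)"
    by (rule degree_add_le_max)
  then show ?thesis
    by (simp add: ev_bound[of _ "max (degree p) (degree q)"] sc_add distrib_right sum.distrib)
qed

lemma ev_smult: "ev a (smult c p) = sc c * ev a p"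
  by (induction p) (simp_all add: sc_mult algebra_simps sc_comm[of c a] sc_comm[of _ "sc c"] flip: mult.assoc)

lemma ev_mult: "ev a (p * q) = ev a p * ev a q"
  by (induction p) (simp_all add: ev_add ev_smult algebra_simps)

lemma ev_uminus: "ev a (- p) = - ev a p"
  using ev_smult[of a "-1" p] by (simp add: sc_uminus)

lemma ev_diff: "ev a (p - q) = ev a p - ev a q"
  using ev_add[of a p "- q"] ev_uminus[of a q] by simp

lemma ev_power: "ev a (p ^ n) = ev a p ^ n"
  by (induction n) (simp_all add: ev_mult)

lemma ev_compose_square: "ev a (pcompose p [:0, 0, 1:]) = ev (a * a) p"
  by (induction p) (simp_all add: pcompose_pCons ev_add ev_mult mult.assoc)

lemma ev_intertwine:
  assumes "a * h = h * b"
  shows "ev a p * h = h * ev b p"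
proof (induction p)
  case (pCons c p)
  have "a * (ev a p * h) = h * (b * ev b p)"
    unfolding pCons.IH using assms by (simp add: mult.assoc[symmetric])
  then show ?case
    by (simp add: algebra_simps sc_comm)
qed simp

lemma minimal_polynomial:
  assumes "a \<in> V"
  obtains f where "f \<noteq> 0" "degree f \<le> d" "ev a f = 0" "\<And>g. ev a g = 0 \<Longrightarrow> f dvd g"
proof -
  obtain \<gamma> where \<gamma>: "\<exists>i\<le>d. \<gamma> i \<noteq> 0" "(\<Sum>i\<le>d. sc (\<gamma> i) * a ^ i) = 0"
    using dependent[of "\<lambda>i. a ^ i"] V_power[OF assms] by auto
  define g where "g = (\<Sum>i\<le>d. monom (\<gamma> i) i)"
  have cg: "coeff g i = (if i \<le> d then \<gamma> i else 0)" for i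
    by (simp add: g_def coeff_sum if_distrib cong: if_cong)
  have deg: "degree g \<le> d"
    by (rule degree_le) (simp add: cg)
  have g0: "g \<noteq> 0"
    using \<gamma>(1) cg by (metis coeff_0)
  have evg: "ev a g = 0"
    unfolding ev_bound[OF deg] using \<gamma>(2) by (simp add: cg)
  define f where "f = (ARG_MIN degree p. p \<noteq> 0 \<and> ev a p = 0)"
  have f: "f \<noteq> 0 \<and> ev a f = 0" and min: "\<And>p. p \<noteq> 0 \<and> ev a p = 0 \<Longrightarrow> degree f \<le> degree p"
    unfolding f_def by (rule arg_min_natI[of _ g], use g0 evg in simp, rule arg_min_nat_le, simp)
  show thesis
  proof (rule that[of f])
    show "degree f \<le> d"
      using min[of g] g0 evg deg by simp
    show "f dvd g'" if "ev a g' = 0" for g'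
    proof -
      have "ev a (g' mod f) = ev a g' - ev a (g' div f) * ev a f"
        by (simp add: minus_div_mult_eq_mod[symmetric] ev_diff ev_mult)
      then have "ev a (g' mod f) = 0"
        using that f by simp
      then have "g' mod f = 0"
        using min[of "g' mod f"] degree_mod_less'[of f g'] f by fastforce
      then show ?thesis
        by (simp add: mod_eq_0_iff_dvd)
    qed
  qed (use f in auto)
qed

text \<open>By pigeonhole two of the \<open>d + 1\<close> iterated squares of \<open>x\<close>
  coincide; the difference of their exponents is \<open>2 ^ i * (2 ^ (j - i) - 1)\<close>, a divisor
  of \<open>root_exp d\<close>.\<close>

lemma root_exp_power:
  fixes x :: 'f
  assumes "x \<noteq> 0" "finite S" "card S \<le> d" "\<And>i. x ^ (2 ^ i) \<in> S"
  shows "x ^ root_exp d = 1"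
proof -
  have "\<not> inj_on (\<lambda>i. x ^ (2 ^ i)) {0..d}"
    using card_inj_on_le[of "\<lambda>i. x ^ (2 ^ i)" "{0..d}" S] assms by auto
  then obtain i j where ij: "i < j" "j \<le> d" "x ^ (2 ^ i) = x ^ (2 ^ j)"
    unfolding inj_on_def by (metis atLeastAtMost_iff linorder_neqE_nat)
  have "(2::nat) ^ j = 2 ^ i + 2 ^ i * (2 ^ (j - i) - 1)"
    using ij(1) by (simp add: algebra_simps flip: power_add)
  then have "x ^ (2 ^ j) = x ^ (2 ^ i) * x ^ (2 ^ i * (2 ^ (j - i) - 1))"
    by (simp only: power_add)
  then have 1: "x ^ (2 ^ i * (2 ^ (j - i) - 1)) = 1"
    using ij(3) assms(1) by simp
  have "2 ^ i * (2 ^ (j - i) - 1) dvd root_exp d"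
    unfolding root_exp_def using ij
    by (intro mult_dvd_mono le_imp_power_dvd dvd_prodI) auto
  then show ?thesis
    using 1 by (metis dvdE power_mult power_one)
qed

text \<open>Conjugation by \<open>h\<close> carries \<open>a\<close> to its square, so the roots of the minimal polynomial
  of \<open>a\<close> are closed under squaring and hence, being finitely many, are roots of unity.\<close>

lemma power_root_exp_unipotent:
  assumes a: "a \<in> V" "a' * a = 1" and h: "h' * h = 1" "a * h = h * (a * a)"
  shows "(a ^ root_exp d - 1) ^ d = 0"
proof -
  obtain f where f: "f \<noteq> 0" "degree f \<le> d" "ev a f = 0" and dvd: "\<And>g. ev a g = 0 \<Longrightarrow> f dvd g"
    using minimal_polynomial[OF a(1)] by blast
  have "h' * (h * ev (a * a) f) = 0"
    using ev_intertwine[OF h(2), of f] f(3) by simp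
  then have "ev (a * a) f = 0"
    using h(1) by (simp add: mult.assoc[symmetric])
  then have "f dvd pcompose f [:0, 0, 1:]"
    by (intro dvd) (simp add: ev_compose_square)
  then have sq: "poly f (x * x) = 0" if "poly f x = 0" for x
    using that by (auto elim!: dvdE dest: arg_cong[of _ _ "\<lambda>p. poly p x"] simp: poly_pcompose)
  have sq_iter: "poly f (x ^ (2 ^ i)) = 0" if "poly f x = 0" for x i
  proof (induction i)
    case (Suc i)
    then show ?case using sq[OF Suc] by (simp add: power_mult power2_eq_square mult.commute[of 2] flip: power_add)
  qed (use that in simp)
  \<comment> \<open>A root 0 could be divided out of \<open>f\<close> because \<open>a\<close> is
    invertible, against minimality.\<close>
  have "poly f 0 \<noteq> 0"
  proof
    assume "poly f 0 = 0"
    then obtain f1 where f1: "f = [:0, 1:] * f1"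
      using poly_eq_0_iff_dvd[of f 0] by auto
    then have "a' * (a * ev a f1) = 0"
      using f(3) by simp
    then have "ev a f1 = 0"
      using a(2) by (simp add: mult.assoc[symmetric])
    then have "f dvd f1"
      by (rule dvd)
    moreover have "f1 \<noteq> 0"
      using f1 f(1) by auto
    ultimately have "degree f \<le> degree f1"
      by (rule dvd_imp_degree_le)
    then show False
      using f1 \<open>f1 \<noteq> 0\<close> by (simp add: degree_mult_eq)
  qed
  then have root: "x ^ root_exp d = 1" if "poly f x = 0" for x
    using that sq_iter[OF that] poly_roots_finite[OF f(1)] card_poly_roots_bound[OF f(1)] f(2)
    by (intro root_exp_power[of _ "{x. poly f x = 0}"]) auto
  define u :: "'f poly" where "u = monom 1 (root_exp d) - 1"
  have ev_monom: "ev a (monom 1 n) = a ^ n" for n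
    by (induction n) (simp_all add: monom_Suc monom_0)
  obtain A where A: "size A = degree f" "f = smult (lead_coeff f) (\<Prod>x\<in>#A. [:- x, 1:])"
    using alg_closed_imp_factorization[OF f(1)] by blast
  have "[:- x, 1:] dvd u" if "x \<in># A" for x
  proof -
    have "[:- x, 1:] dvd f"
      using that by (subst A(2)) (auto intro!: dvd_smult dvd_prod_mset)
    then show ?thesis
      using root by (simp add: u_def poly_monom flip: poly_eq_0_iff_dvd)
  qed
  \<comment> \<open>Roots of \<open>f\<close> may be repeated, so each linear factor uses up one
    copy of \<open>u\<close>; there are at most \<open>d\<close> factors.\<close>
  then have "(\<Prod>x\<in>#A. [:- x, 1:]) dvd u ^ size A"
    by (induction A) (auto intro!: mult_dvd_mono simp del: mult_pCons_left)
  then have "f dvd u ^ size A"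
    using f(1) by (subst A(2)) (simp add: smult_dvd_iff)
  also have "\<dots> dvd u ^ d"
    using A(1) f(2) by (intro le_imp_power_dvd) simp
  finally obtain q where "u ^ d = f * q" ..
  then have "ev a (u ^ d) = 0"
    by (simp add: ev_mult f(3))
  then show ?thesis
    by (simp add: ev_power u_def ev_diff ev_monom)
qed

end

text \<open>The second conjunct serves iteration: in a noncommutative ring the remainder
  \<open>w\<close> must still commute with whatever commutes with \<open>y\<close>.\<close>

lemma one_plus_power_expand:
  fixes y :: "'e::ring_1"
  shows "\<exists>w. (1 + y) ^ n = 1 + of_nat n * y + y * y * w \<and> (\<forall>v. v * y = y * v \<longrightarrow> v * w = w * v)"
proof (induction n)
  case (Suc n)
  then obtain w where w: "(1 + y) ^ n = 1 + of_nat n * y + y * y * w" and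
    c: "\<And>v. v * y = y * v \<Longrightarrow> v * w = w * v" by blast
  have "(1 + y) ^ Suc n = (1 + of_nat n * y + y * y * w) * (1 + y)"
    by (simp only: power_Suc2 w)
  also have "\<dots> = 1 + of_nat (Suc n) * y + y * y * (of_nat n + w + w * y)"
    by (simp add: algebra_simps mult_of_nat_commute)
  finally have "(1 + y) ^ Suc n = 1 + of_nat (Suc n) * y + y * y * (of_nat n + w + w * y)" .
  moreover have "v * (of_nat n + w + w * y) = (of_nat n + w + w * y) * v" if "v * y = y * v" for v
  proof -
    have "v * (w * y) = w * y * v"
      using c[OF that] that by (metis mult.assoc)
    then show ?thesis
      using c[OF that] by (simp add: algebra_simps mult_of_nat_commute)
  qed
  ultimately show ?case
    by blast
qed (auto intro!: exI[of _ 0])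

text \<open>Since \<open>q\<close> is zero in the ring, each \<open>q\<close>-th power removes the
  linear term of the expansion and doubles the exponent of \<open>y\<close>. For nilpotent
  \<open>y\<close> the remainder finally disappears.\<close>

lemma one_plus_power_characteristic:
  fixes y :: "'e::ring_1"
  assumes "of_nat q = (0::'e)"
  shows "\<exists>z. (1 + y) ^ (q ^ k) = 1 + y ^ (2 ^ k) * z \<and> z * y = y * z"
proof (induction k)
  case (Suc k)
  then obtain z where z: "(1 + y) ^ (q ^ k) = 1 + y ^ (2 ^ k) * z" and zy: "z * y = y * z"
    by blast
  define Y where "Y = y ^ (2 ^ k) * z"
  obtain w where w: "(1 + Y) ^ q = 1 + Y * Y * w" and c: "\<And>v. v * Y = Y * v \<Longrightarrow> v * w = w * v"
    using one_plus_power_expand[of Y q] assms by auto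
  have yz: "z * y ^ n = y ^ n * z" for n
    using power_commuting_commutes[of y z n] zy by simp
  have "Y * Y = y ^ (2 ^ k) * (z * y ^ (2 ^ k)) * z"
    by (simp add: Y_def mult.assoc)
  also have "\<dots> = y ^ (2 ^ Suc k) * (z * z)"
    by (simp add: yz mult_2 power_add mult.assoc)
  finally have "Y * Y = y ^ (2 ^ Suc k) * (z * z)" .
  moreover have "(1 + y) ^ (q ^ Suc k) = (1 + Y) ^ q"
    by (simp only: power_Suc2 power_mult z Y_def)
  ultimately have "(1 + y) ^ (q ^ Suc k) = 1 + y ^ (2 ^ Suc k) * (z * z * w)"
    by (simp only: w mult.assoc)
  moreover have "(z * z * w) * y = y * (z * z * w)"
  proof -
    have "y * Y = Y * y"
      unfolding Y_def by (metis mult.assoc power_commutes zy)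
    then show ?thesis
      using c[of y] zy by (metis mult.assoc)
  qed
  ultimately show ?case
    by blast
qed (auto intro!: exI[of _ 1])

context findim_algebra
begin

definition eig :: "'e \<Rightarrow> 'e \<Rightarrow> nat \<Rightarrow> 'e set" where
  "eig h' h i = {y \<in> V. h' * y * h = sc (2 ^ i) * y}"

lemma sc_conj: "h' * (sc c * y) * h = sc c * (h' * y * h)"
proof -
  have "h' * (sc c * y) = sc c * (h' * y)"
    by (simp only: mult.assoc[symmetric] sc_comm[of c h'])
  then show ?thesis
    by (simp only: mult.assoc)
qed

lemma sc_swap: "sc c * (sc c' * y) = sc c' * (sc c * y)"
  by (simp only: mult.assoc[symmetric] sc_mult[symmetric] mult.commute)

lemma eig_distinct:
  assumes "finite I" "inj_on \<mu> I" "\<And>i. i \<in> I \<Longrightarrow> h' * w i * h = sc (\<mu> i) * w i"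
    and "(\<Sum>i\<in>I. w i) = 0"
  shows "\<forall>i\<in>I. w i = 0"
  using assms
proof (induction I arbitrary: w rule: finite_induct)
  case (insert j I)
  let ?w = "\<lambda>i. sc (\<mu> i - \<mu> j) * w i"
  have "(\<Sum>i\<in>insert j I. ?w i) = h' * (\<Sum>i\<in>insert j I. w i) * h - sc (\<mu> j) * (\<Sum>i\<in>insert j I. w i)"
    unfolding sum_distrib_left sum_distrib_right sum_subtractf[symmetric]
    by (intro sum.cong) (simp_all add: insert.prems(2) sc_diff left_diff_distrib)
  then have "(\<Sum>i\<in>insert j I. ?w i) = 0"
    using insert.prems(3) by simp
  then have 0: "(\<Sum>i\<in>I. ?w i) = 0"
    using insert.hyps by simp
  have "\<forall>i\<in>I. ?w i = 0"
  proof (rule insert.IH[OF _ _ 0])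
    show "h' * ?w i * h = sc (\<mu> i) * ?w i" if "i \<in> I" for i
    proof -
      have "h' * ?w i * h = sc (\<mu> i - \<mu> j) * (h' * w i * h)"
        by (rule sc_conj)
      also have "\<dots> = sc (\<mu> i) * ?w i"
        unfolding insert.prems(2)[OF insertI2[OF that]] by (rule sc_swap)
      finally show ?thesis .
    qed
  qed (use insert.prems(1) in auto)
  moreover have "\<mu> i - \<mu> j \<noteq> 0" if "i \<in> I" for i
    using insert.prems(1) insert.hyps(2) that by (auto simp: inj_on_def)
  ultimately have "\<forall>i\<in>I. w i = 0"
    using sc_cancel by blast
  then show ?case
    using insert.prems(3) insert.hyps by simp
qed simp

lemma good_expD:
  assumes "of_nat (good_exp d) \<noteq> (0::'f)" "1 \<le> d"
  shows "(2::'f) \<noteq> 0" "\<And>j. 1 \<le> j \<Longrightarrow> j \<le> d * d \<Longrightarrow> (2::'f) ^ j \<noteq> 1"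
proof -
  have nz: "of_nat x \<noteq> (0::'f)" if "x dvd good_exp d" for x
    using that assms(1) by (auto elim!: dvdE)
  show "(2::'f) \<noteq> 0"
    using nz[of 2] by (simp add: good_exp_def)
  show "(2::'f) ^ j \<noteq> 1" if "1 \<le> j" "j \<le> d * d" for j
  proof -
    have "2 ^ j - 1 dvd good_exp d"
      unfolding good_exp_def using that by (intro dvd_mult dvd_prodI) auto
    from nz[OF this] show ?thesis
      by (simp add: of_nat_diff)
  qed
qed

lemma two_power_inj:
  assumes "of_nat (good_exp d) \<noteq> (0::'f)" "i < j" "j - i \<le> d * d"
  shows "(2::'f) ^ i \<noteq> 2 ^ j"
proof
  assume "(2::'f) ^ i = 2 ^ j"
  also have "(2::'f) ^ j = 2 ^ i * 2 ^ (j - i)"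
    using assms(2) by (simp flip: power_add)
  finally have 1: "(2::'f) ^ i = 2 ^ i * 2 ^ (j - i)" .
  have "1 \<le> d" "1 \<le> j - i"
    using assms by (cases d; simp)+
  then show False
    using good_expD[OF assms(1)] assms(3) 1 by auto
qed

text \<open>Conjugation by \<open>h\<close> is triangular on the powers of \<open>x\<close>, because
  \<open>h' * x * h = x * (2 + x)\<close>: on \<open>x ^ j\<close> it is multiplication by 2^j up to
  higher powers. So \<open>T\<close>, the conjugation minus 2^j, sends \<open>y\<close> into the
  span of higher powers, which by downward induction consists of sums of eigenvectors. On these
  \<open>T\<close> can be inverted, as 2^i and 2^j differ, and \<open>y\<close> minus the preimage
  of \<open>T y\<close> is an eigenvector for 2^j.\<close>

lemma eig_decomposition:
  assumes Q: "of_nat (good_exp d) \<noteq> (0::'f)" and h: "h' * h = 1" "h * h' = 1" "h \<in> V" "h' \<in> V"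
    and u: "1 + x \<in> V" "(1 + x) * h = h * ((1 + x) * (1 + x))" "x ^ d = 0"
    and j: "1 \<le> j" "j \<le> d"
  shows "y \<in> add_span {sc c * x ^ i | c i. j \<le> i} \<Longrightarrow> y \<in> add_span (\<Union>i\<in>{j..<d}. eig h' h i)"
  using j(2) j(1)
proof (induction j arbitrary: y rule: inc_induct)
  case base
  have "{sc c * x ^ i | c i. d \<le> i} \<subseteq> {0}"
    using u(3) by (auto simp: le_iff_add power_add)
  then have "y \<in> add_span {0}"
    using base add_span_mono by blast
  then have "y = 0"
    by (induction rule: add_span.induct) auto
  then show ?case
    by (simp add: add_span.zero)
next
  case (step j)
  define J where "J j = {sc c * x ^ i | c i. j \<le> i}" for j :: nat
  define T where "T y = h' * y * h - sc (2 ^ j) * y" for y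
  have xV: "x \<in> V"
    using V_add[OF u(1) V_uminus[OF V_1]] by simp
  have conj_x: "h' * x * h = x * (2 + x)"
  proof -
    have "x * h = h * (x * (2 + x))"
      using u(2) by (simp add: algebra_simps mult_2_right)
    then have "h' * x * h = (h' * h) * (x * (2 + x))"
      by (simp add: mult.assoc)
    then show ?thesis using h(1) by simp
  qed
  have comm_x: "x * (2 + x) = (2 + x) * x"
    by (simp add: algebra_simps mult_2 mult_2_right)
  have conj_pow: "h' * x ^ i * h = x ^ i * (2 + x) ^ i" for i
  proof (induction i)
    case (Suc i)
    have "h' * x ^ Suc i * h = (h' * x * h) * (h' * x ^ i * h)"
      using h(2) by (metis mult.assoc mult_1 power_Suc)
    also have "\<dots> = x * ((2 + x) * x ^ i) * (2 + x) ^ i"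
      unfolding conj_x Suc.IH by (simp add: mult.assoc)
    also have "(2 + x) * x ^ i = x ^ i * (2 + x)"
      using power_commuting_commutes[of "x" "2 + x" i] comm_x by simp
    finally show ?case
      by (simp add: mult.assoc)
  qed (simp add: h(1))
  have J_mult: "v * w \<in> add_span (J (i + k))" if "v \<in> add_span (J i)" "w \<in> add_span (J k)" for v w i k
  proof (rule add_span_mult[OF _ that])
    fix s t assume "s \<in> J i" "t \<in> J k"
    then obtain c c' i' k' where s: "s = sc c * x ^ i'" "t = sc c' * x ^ k'" "i \<le> i'" "k \<le> k'"
      unfolding J_def by blast
    have "s * t = sc (c * c') * x ^ (i' + k')"
      unfolding s sc_mult power_add by (metis mult.assoc sc_comm)
    then show "s * t \<in> J (i + k)"
      unfolding J_def using s by (intro CollectI exI[of _ "c * c'"] exI[of _ "i' + k'"]) auto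
  qed
  have J_anti: "add_span (J k) \<subseteq> add_span (J i)" if "i \<le> k" for i k
  proof (rule add_span_mono, rule subsetI)
    fix s assume "s \<in> J k"
    then obtain c i' where "s = sc c * x ^ i'" "k \<le> i'"
      unfolding J_def by blast
    then show "s \<in> J i"
      using that unfolding J_def by (intro CollectI exI[of _ c] exI[of _ i']) simp
  qed
  have J_base: "sc c * x ^ i \<in> add_span (J k)" if "k \<le> i" for c i k
    using that by (intro add_span_base) (auto simp: J_def)
  have two_plus: "2 + x \<in> add_span (J 0)"
    using add_span_add[OF J_base[of 0 0 2] J_base[of 0 1 1]] by (simp add: sc_2)
  have pow_J0: "(2 + x) ^ i \<in> add_span (J 0)" for i
  proof (induction i)
    case 0
    show ?case using J_base[of 0 0 1] by simp
  next
    case (Suc i)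
    show ?case using J_mult[OF two_plus Suc] by simp
  qed
  have pow_J1: "(2 + x) ^ i - sc (2 ^ i) \<in> add_span (J 1)" for i
  proof (induction i)
    case 0
    show ?case by (simp add: add_span.zero)
  next
    case (Suc i)
    have "(2 + x) ^ Suc i - sc (2 ^ Suc i) = (2 + x) * ((2 + x) ^ i - sc (2 ^ i)) + x * sc (2 ^ i)"
      by (simp add: algebra_simps sc_mult sc_2)
    moreover have "x * sc (2 ^ i) \<in> add_span (J 1)"
      using J_base[of 1 1 "2 ^ i"] by (simp add: sc_comm)
    ultimately show ?case
      using add_span_add J_mult[OF two_plus Suc] by simp
  qed
  have T_gen: "T s \<in> add_span (J (Suc j))" if s: "s \<in> J j" for s
  proof -
    obtain c i where ci: "s = sc c * x ^ i" "j \<le> i"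
      using s unfolding J_def by blast
    have "h' * s * h = sc c * (h' * x ^ i * h)"
      unfolding ci by (rule sc_conj)
    then have c: "h' * s * h = (sc c * x ^ i) * (2 + x) ^ i"
      unfolding conj_pow by (simp only: mult.assoc)
    show ?thesis
    proof (cases "i = j")
      case True
      have "T s = (sc c * x ^ j) * ((2 + x) ^ j - sc (2 ^ j))"
        unfolding T_def c using True ci(1) by (simp add: right_diff_distrib sc_comm[of _ "sc c * x ^ j"])
      then show ?thesis
        using J_mult[OF J_base[of j j c] pow_J1[of j]] by simp
    next
      case False
      then have "Suc j \<le> i" using ci(2) by simp
      have "sc c * x ^ i * (2 + x) ^ i \<in> add_span (J (Suc j))"
        using J_mult[OF J_base[of "Suc j" i c] pow_J0] \<open>Suc j \<le> i\<close> by simp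
      moreover have "- (sc (2 ^ j) * s) \<in> add_span (J (Suc j))"
        using add_span_uminus[OF J_base[of "Suc j" i "2 ^ j * c"]] \<open>Suc j \<le> i\<close> ci(1)
        by (simp only: sc_mult mult.assoc)
      ultimately show ?thesis
        using add_span_add unfolding T_def c by fastforce
    qed
  qed
  have eig_preimage: "\<exists>z\<in>(\<Union>i\<in>{Suc j..<d}. eig h' h i). T z = s"
    if "s \<in> (\<Union>i\<in>{Suc j..<d}. eig h' h i)" for s
  proof -
    obtain i where "i \<in> {Suc j..<d}" "s \<in> eig h' h i"
      using \<open>s \<in> (\<Union>i\<in>{Suc j..<d}. eig h' h i)\<close> by blast
    then have i: "Suc j \<le> i" "i < d" "s \<in> V" "h' * s * h = sc (2 ^ i) * s"
      by (simp_all add: eig_def)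
    have "i - j \<le> d"
      using i(2) by simp
    also have "d \<le> d * d"
      by (cases d) simp_all
    finally have "i - j \<le> d * d" .
    then have nz: "(2::'f) ^ i - 2 ^ j \<noteq> 0"
      using two_power_inj[OF Q, of j i] i(1) by auto
    define c where "c = inverse ((2::'f) ^ i - 2 ^ j)"
    have conj: "h' * (sc c * s) * h = sc (2 ^ i) * (sc c * s)"
      unfolding sc_conj i(4) by (rule sc_swap)
    then have "sc c * s \<in> eig h' h i"
      using V_mult V_sc i(3) by (simp add: eig_def)
    moreover have "T (sc c * s) = sc ((2 ^ i - 2 ^ j) * c) * s"
      unfolding T_def conj by (simp add: sc_diff sc_mult left_diff_distrib mult.assoc)
    then have "T (sc c * s) = s"
      using nz by (simp add: c_def)
    ultimately show ?thesis
      using i by auto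
  qed
  have T_add: "T (v + w) = T v + T w" "T (v - w) = T v - T w" for v w
    by (simp_all add: T_def algebra_simps)
  have "T y \<in> add_span (J (Suc j))"
    using step.prems unfolding J_def[symmetric]
  proof (induction y rule: add_span.induct)
    case zero
    show ?case by (simp add: T_def add_span.zero)
  next
    case (plus s v)
    then show ?case using add_span_add T_gen T_add by metis
  next
    case (minus s v)
    then show ?case using add_span_add add_span_uminus T_gen T_add(2) by (metis diff_conv_add_uminus)
  qed
  then have "T y \<in> add_span (\<Union>i\<in>{Suc j..<d}. eig h' h i)"
    unfolding J_def by (rule step.IH) simp
  moreover have "\<exists>z\<in>add_span (\<Union>i\<in>{Suc j..<d}. eig h' h i). T z = t"
    if "t \<in> add_span (\<Union>i\<in>{Suc j..<d}. eig h' h i)" for t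
    using that
  proof (induction t rule: add_span.induct)
    case zero
    then show ?case by (intro bexI[of _ 0]) (auto simp: T_def add_span.zero)
  next
    case (plus s v)
    then obtain z where z: "z \<in> add_span (\<Union>i\<in>{Suc j..<d}. eig h' h i)" "T z = v" by blast
    obtain z' where z': "z' \<in> (\<Union>i\<in>{Suc j..<d}. eig h' h i)" "T z' = s"
      using eig_preimage[OF plus(1)] by blast
    show ?case
      by (rule bexI[OF _ add_span.plus[OF z'(1) z(1)]]) (simp add: T_add(1) z(2) z'(2))
  next
    case (minus s v)
    then obtain z where z: "z \<in> add_span (\<Union>i\<in>{Suc j..<d}. eig h' h i)" "T z = v" by blast
    obtain z' where z': "z' \<in> (\<Union>i\<in>{Suc j..<d}. eig h' h i)" "T z' = s"
      using eig_preimage[OF minus(1)] by blast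
    show ?case
      by (rule bexI[OF _ add_span.minus[OF z'(1) z(1)]]) (simp add: T_add(2) z(2) z'(2))
  qed
  ultimately obtain z where z: "z \<in> add_span (\<Union>i\<in>{Suc j..<d}. eig h' h i)" "T z = T y"
    by blast
  have sub_V: "add_span S \<subseteq> V" if "S \<subseteq> V" for S
  proof
    fix v assume "v \<in> add_span S"
    then show "v \<in> V"
    proof (induction v rule: add_span.induct)
      case (minus s v)
      then have "v + - s \<in> V" using that by (intro V_add V_uminus) auto
      then show ?case by simp
    qed (use that V_0 V_add in auto)
  qed
  have "J j \<subseteq> V"
    unfolding J_def using V_mult V_sc V_power[OF xV] by auto
  then have "y \<in> V"
    using step.prems sub_V[of "J j"] unfolding J_def by blast
  moreover have "z \<in> V"
    by (rule subsetD[OF sub_V z(1)]) (auto simp: eig_def)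
  ultimately have "y + - z \<in> V"
    by (intro V_add V_uminus)
  moreover have "T (y - z) = 0"
    using z(2) T_add(2) by simp
  ultimately have "y - z \<in> eig h' h j"
    by (simp add: eig_def T_def)
  then have "y - z \<in> (\<Union>i\<in>{j..<d}. eig h' h i)"
    using step.hyps by (intro UN_I[of j]) simp_all
  moreover have "z \<in> add_span (\<Union>i\<in>{j..<d}. eig h' h i)"
    by (rule subsetD[OF add_span_mono z(1)], rule UN_mono) simp_all
  ultimately have "(y - z) + z \<in> add_span (\<Union>i\<in>{j..<d}. eig h' h i)"
    by (rule add_span.plus)
  then show ?case
    by simp
qed

text \<open>The first \<open>d + 1\<close> nonempty prefixes of \<open>xs\<close> have eigenvalues
  2^e with strictly increasing \<open>e\<close>. Nonzero eigenvectors for distinct eigenvalues are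
  independent, which \<open>d + 1\<close> elements of \<open>V\<close> cannot be; so some prefix has
  product 0. Each weight is below \<open>d\<close>, hence the exponents differ by at most
  \<open>d * d\<close>, the range that \<open>good_exp\<close> covers.\<close>

lemma eig_product_zero:
  assumes Q: "of_nat (good_exp d) \<noteq> (0::'f)" and h: "h' * h = 1" "h * h' = 1"
    and xs: "set xs \<subseteq> (\<Union>i\<in>{1..<d}. eig h' h i)" "d < length xs"
  shows "prod_list xs = 0"
proof -
  define wt where "wt y = (SOME i. i \<in> {1..<d} \<and> y \<in> eig h' h i)" for y
  have wt: "wt y \<in> {1..<d} \<and> y \<in> eig h' h (wt y)" if "y \<in> set xs" for y
  proof -
    have "\<exists>i. i \<in> {1..<d} \<and> y \<in> eig h' h i"
      using that xs(1) by blast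
    then show ?thesis
      unfolding wt_def by (rule someI_ex)
  qed
  define v where "v j = prod_list (take (Suc j) xs)" for j
  define e where "e j = sum_list (map wt (take (Suc j) xs))" for j
  have prod: "prod_list ys \<in> V \<and> h' * prod_list ys * h = sc (2 ^ sum_list (map wt ys)) * prod_list ys"
    if "set ys \<subseteq> set xs" for ys
    using that
  proof (induction ys)
    case (Cons y ys)
    have y: "y \<in> V" "h' * y * h = sc (2 ^ wt y) * y"
      using wt[of y] Cons.prems by (auto simp: eig_def)
    have IH: "prod_list ys \<in> V" "h' * prod_list ys * h = sc (2 ^ sum_list (map wt ys)) * prod_list ys"
      using Cons by auto
    have "h' * (y * prod_list ys) * h = (h' * y * h) * (h' * prod_list ys * h)"
      using h(2) by (metis mult.assoc mult_1)
    also have "\<dots> = sc (2 ^ wt y) * (y * (sc (2 ^ sum_list (map wt ys)) * prod_list ys))"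
      unfolding y IH by (simp only: mult.assoc)
    also have "\<dots> = sc (2 ^ wt y) * (sc (2 ^ sum_list (map wt ys)) * (y * prod_list ys))"
      using sc_conj[of y _ "prod_list ys" 1] by simp
    finally show ?case
      using V_mult y(1) IH(1) by (simp add: power_add sc_mult mult.assoc)
  qed (simp add: V_1 h(1))
  have take_sub: "set (take k xs) \<subseteq> set xs" for k
    by (rule set_take_subset)
  have e_diff: "e i < e j \<and> e j - e i \<le> (j - i) * d" if "i < j" "j \<le> d" for i j
    using that
  proof (induction j)
    case (Suc j)
    have e_Suc: "e (Suc j) = e j + wt (xs ! Suc j)"
      unfolding e_def using Suc.prems xs(2) by (simp add: take_Suc_conv_app_nth)
    have w: "wt (xs ! Suc j) \<in> {1..<d}"
      using wt[of "xs ! Suc j"] Suc.prems xs(2) by simp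
    show ?case
    proof (cases "i = j")
      case True
      then show ?thesis using e_Suc w by simp
    next
      case False
      then have "e i < e j \<and> e j - e i \<le> (j - i) * d"
        using Suc by simp
      moreover have "Suc j - i = Suc (j - i)"
        using Suc.prems False by simp
      ultimately show ?thesis
        using e_Suc w by auto
    qed
  qed simp
  have e_inj: "inj_on (\<lambda>j. (2::'f) ^ e j) {..d}"
  proof (rule inj_onI)
    fix i j assume ij: "i \<in> {..d}" "j \<in> {..d}" "(2::'f) ^ e i = 2 ^ e j"
    have "(2::'f) ^ e i \<noteq> 2 ^ e j" if "i < j" "j \<le> d" for i j
    proof (rule two_power_inj[OF Q])
      show "e i < e j"
        using e_diff[OF that] by simp
      have "e j - e i \<le> (j - i) * d"
        using e_diff[OF that] by simp
      also have "\<dots> \<le> d * d"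
        using that by (intro mult_right_mono) auto
      finally show "e j - e i \<le> d * d" .
    qed
    then show "i = j"
      using ij by (metis atMost_iff linorder_neqE_nat)
  qed
  have "v i \<in> V" for i
    unfolding v_def using prod[OF take_sub] by (rule conjunct1)
  then obtain \<gamma> where \<gamma>: "\<exists>i\<le>d. \<gamma> i \<noteq> 0" "(\<Sum>i\<le>d. sc (\<gamma> i) * v i) = 0"
    using dependent[of v] by blast
  have "\<forall>i\<in>{..d}. sc (\<gamma> i) * v i = 0"
  proof (rule eig_distinct[OF _ e_inj _ \<gamma>(2)])
    show "h' * (sc (\<gamma> i) * v i) * h = sc (2 ^ e i) * (sc (\<gamma> i) * v i)" for i
    proof -
      have "h' * (sc (\<gamma> i) * v i) * h = sc (\<gamma> i) * (h' * v i * h)"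
        by (rule sc_conj)
      also have "h' * v i * h = sc (2 ^ e i) * v i"
        using prod[OF take_sub, of "Suc i"] unfolding v_def e_def by simp
      also have "sc (\<gamma> i) * (sc (2 ^ e i) * v i) = sc (2 ^ e i) * (sc (\<gamma> i) * v i)"
        by (rule sc_swap)
      finally show ?thesis .
    qed
  qed simp
  then obtain i where i: "i \<le> d" "v i = 0"
    using \<gamma>(1) sc_cancel by blast
  have "prod_list xs = v i * prod_list (drop (Suc i) xs)"
    unfolding v_def by (metis append_take_drop_id prod_list.append)
  then show ?thesis
    using i by simp
qed

end

lemma dstep_trivial:
  assumes "quad_all (\<lambda>x. x = 1) q"
  shows "quad_all (\<lambda>x. x = (1::'e::ring_1)) ((dstep (*) ^^ k) q)"
  using assms
proof (induction k)
  case (Suc k)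
  then show ?case
    by (cases "(dstep (*) ^^ k) q") (simp add: dstep_def)
qed simp

context findim_algebra
begin

text \<open>If \<open>good_exp d\<close> vanishes in the field, its power kills unipotent elements
  and the quadruple is trivial before any step. Otherwise each entry is 1 plus a sum of eigenvectors
  of weight at least 1, and every step doubles the number of eigenvectors in a product;
  \<open>2 ^ Suc d\<close> of them are more than \<open>d\<close>.\<close>

theorem dstep_power_trivial:
  assumes d: "1 \<le> d" and V: "a \<in> V" "a' \<in> V" "b \<in> V" "b' \<in> V" "h \<in> V" "h' \<in> V"
    and inv: "a * a' = 1" "a' * a = 1" "b * b' = 1" "b' * b = 1" "h * h' = 1" "h' * h = 1"
    and rel: "a * h = h * (a * a)" "b * h = h * (b * b)"
  shows "quad_all (\<lambda>x. x = 1) ((dstep (*) ^^ Suc d)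
    (quad_map (\<lambda>x. x ^ unipotent_exp d) (a, a', b, b')))"
proof -
  \<comment> \<open>The inverse satisfies the same relation, so that all four entries of the
    quadruple can be treated alike.\<close>
  have rel_inv: "g' * h = h * (g' * g')" if "g * h = h * (g * g)" "g * g' = 1" "g' * g = 1" for g g'
  proof -
    have "(g * g) * (g' * g') = g * (g * g') * g'"
      by (simp only: mult.assoc)
    then have "g' * h = g' * (h * (g * g)) * (g' * g')"
      using that(2) by (simp add: mult.assoc)
    also have "\<dots> = (g' * g) * h * (g' * g')"
      unfolding that(1)[symmetric] by (simp only: mult.assoc)
    finally show ?thesis
      using that(3) by simp
  qed
  have rel_pow: "g ^ k * h = h * (g ^ k * g ^ k)" if "g * h = h * (g * g)" for g k
  proof -
    have "g ^ k * h = h * (g * g) ^ k"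
    proof (induction k)
      case (Suc k)
      show ?case
        unfolding power_Suc2 mult.assoc that by (simp only: mult.assoc[symmetric] Suc)
    qed simp
    also have "(g * g) ^ k = g ^ k * g ^ k"
      by (simp only: power2_eq_square[symmetric] power_mult[symmetric] power_add[symmetric] mult_2 mult_2_right)
    finally show ?thesis .
  qed
  have pow_inv: "g' ^ k * g ^ k = 1" if "g' * g = 1" for g g' :: 'e and k
  proof (induction k)
    case (Suc k)
    have "g' ^ Suc k * g ^ Suc k = g' ^ k * (g' * g) * g ^ k"
      by (simp only: power_Suc2[of g' k] power_Suc[of g k] mult.assoc)
    then show ?case
      unfolding that mult_1_right Suc .
  qed simp
  define q where "q = quad_map (\<lambda>x. x ^ unipotent_exp d) (a, a', b, b')"
  have uni: "(g ^ unipotent_exp d - 1) ^ d = 0" if "g \<in> V" "g' * g = 1" "g * h = h * (g * g)" for g g'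
    unfolding unipotent_exp_def power_mult
    by (rule power_root_exp_unipotent[OF V_power[OF that(1)] pow_inv[OF that(2)] inv(6) rel_pow[OF that(3)]])
  show ?thesis
  proof (cases "of_nat (good_exp d) = (0::'f)")
    case True
    then have Q0: "of_nat (good_exp d) = (0::'e)"
      using sc_of_nat[of "good_exp d"] by simp
    have g1: "g ^ unipotent_exp d = 1" if "g \<in> V" "g' * g = 1" "g * h = h * (g * g)" for g g'
    proof -
      have u: "(g ^ root_exp d - 1) ^ d = 0"
        by (rule power_root_exp_unipotent[OF that(1,2) inv(6) that(3)])
      obtain z where "(1 + (g ^ root_exp d - 1)) ^ (good_exp d ^ d) = 1 + (g ^ root_exp d - 1) ^ (2 ^ d) * z"
        using one_plus_power_characteristic[OF Q0] by blast
      moreover have "(2::nat) ^ d = d + (2 ^ d - d)"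
        using less_exp[of d] by simp
      then have "(g ^ root_exp d - 1) ^ (2 ^ d) = 0"
        using u by (metis power_add mult_zero_left)
      ultimately show ?thesis
        unfolding unipotent_exp_def mult.commute[of "good_exp d ^ d"] power_mult by simp
    qed
    then have "quad_all (\<lambda>x. x = 1) q"
      unfolding q_def quad_map_simp quad_all_simp
      by (intro conjI g1[OF V(1) inv(2) rel(1)] g1[OF V(3) inv(4) rel(2)]
        g1[OF V(2) inv(1) rel_inv[OF rel(1) inv(1,2)]] g1[OF V(4) inv(3) rel_inv[OF rel(2) inv(3,4)]])
    then show ?thesis
      unfolding q_def by (rule dstep_trivial)
  next
    case False
    define E where "E = (\<Union>i\<in>{1..<d}. eig h' h i)"
    define S where "S j = {prod_list xs | xs. set xs \<subseteq> E \<and> j \<le> length xs}" for j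
    interpret ring_filtration "\<lambda>j. add_span (S j)"
    proof (rule ring_filtration_add_span)
      fix i j s t assume "s \<in> S i" "t \<in> S j"
      then obtain xs ys where "s = prod_list xs" "t = prod_list ys" "set xs \<subseteq> E" "set ys \<subseteq> E"
        "i \<le> length xs" "j \<le> length ys"
        unfolding S_def by blast
      then have "s * t = prod_list (xs @ ys) \<and> set (xs @ ys) \<subseteq> E \<and> i + j \<le> length (xs @ ys)"
        by simp
      then show "s * t \<in> S (i + j)"
        unfolding S_def by blast
    next
      fix i
      show "S (Suc i) \<subseteq> S i"
      proof
        fix s assume "s \<in> S (Suc i)"
        then obtain xs where "s = prod_list xs" "set xs \<subseteq> E" "i \<le> length xs"
          unfolding S_def using Suc_leD by blast
        then show "s \<in> S i"
          unfolding S_def by blast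
      qed
    qed
    have g1: "g ^ unipotent_exp d - 1 \<in> add_span (S 1)" if "g \<in> V" "g' * g = 1" "g * h = h * (g * g)" for g g'
    proof -
      define x where "x = g ^ unipotent_exp d - 1"
      have x: "1 + x = g ^ unipotent_exp d"
        by (simp add: x_def)
      have "sc 1 * x ^ 1 \<in> add_span {sc c * x ^ i | c i. 1 \<le> i}"
        by (intro add_span_base) blast
      then have "x \<in> add_span {sc c * x ^ i | c i. 1 \<le> i}"
        by simp
      moreover have "x ^ d = 0"
        unfolding x_def by (rule uni[OF that])
      ultimately have "x \<in> add_span E"
        unfolding E_def using d
        by (intro eig_decomposition[OF False inv(6,5) V(5,6), where j = 1 and x = x])
          (simp_all add: x V_power[OF that(1)] rel_pow[OF that(3)])
      moreover have "E \<subseteq> S 1"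
      proof
        fix y assume "y \<in> E"
        then have "y = prod_list [y] \<and> set [y] \<subseteq> E \<and> 1 \<le> length [y]"
          by simp
        then show "y \<in> S 1"
          unfolding S_def by blast
      qed
      ultimately show ?thesis
        using add_span_mono unfolding x_def by blast
    qed
    have "quad_all (\<lambda>x. x - 1 \<in> add_span (S 1)) q"
      unfolding q_def quad_map_simp quad_all_simp
      by (intro conjI g1[OF V(1) inv(2) rel(1)] g1[OF V(3) inv(4) rel(2)]
        g1[OF V(2) inv(1) rel_inv[OF rel(1) inv(1,2)]] g1[OF V(4) inv(3) rel_inv[OF rel(2) inv(3,4)]])
    moreover have "quad_inv q"
      unfolding q_def quad_inv_def quad_map_simp using pow_inv inv by simp
    ultimately have "quad_all (\<lambda>x. x - 1 \<in> add_span (S (2 ^ Suc d))) ((dstep (*) ^^ Suc d) q)"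
      by (intro dstep_iter)
    moreover have "S (2 ^ Suc d) \<subseteq> {0}"
    proof
      fix s assume "s \<in> S (2 ^ Suc d)"
      then obtain xs where xs: "s = prod_list xs" "set xs \<subseteq> E" "2 ^ Suc d \<le> length xs"
        unfolding S_def by blast
      then have "d < length xs"
        using less_exp[of "Suc d"] by linarith
      then show "s \<in> {0}"
        using eig_product_zero[OF False inv(6,5)] xs unfolding E_def by blast
    qed
    then have "x = 1" if "x - 1 \<in> add_span (S (2 ^ Suc d))" for x
    proof -
      have "v = 0" if "v \<in> add_span (S (2 ^ Suc d))" for v
        using that by (induction v rule: add_span.induct) (use \<open>S (2 ^ Suc d) \<subseteq> {0}\<close> in auto)
      from this[OF that] show ?thesis by simp
    qed
    ultimately show ?thesis
      unfolding q_def[symmetric] by (rule quad_all_mono[rotated])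
  qed
qed

end

section \<open>Matrices over commutative rings\<close>

typedef (overloaded) 'a lin = "{T :: (nat \<Rightarrow> 'a::comm_ring_1) \<Rightarrow> nat \<Rightarrow> 'a.
    \<forall>x v w. T (\<lambda>i. x * v i + w i) = (\<lambda>i. x * T v i + T w i)}"
  by (rule exI[of _ "\<lambda>v. v"]) simp

setup_lifting type_definition_lin

lemma lin_add: "T (\<lambda>i. v i + w i) = (\<lambda>i. T v i + T w i)" and
  lin_scale: "T (\<lambda>i. x * v i) = (\<lambda>i. x * T v i)"
  if "\<forall>x v w. T (\<lambda>i. x * v i + w i) = (\<lambda>i. x * T v i + T w i)"
  for T :: "(nat \<Rightarrow> 'a::comm_ring_1) \<Rightarrow> nat \<Rightarrow> 'a"
proof -
  show 1: "T (\<lambda>i. v i + w i) = (\<lambda>i. T v i + T w i)" for v w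
    using that[rule_format, of 1 v w] by simp
  have "T (\<lambda>i. 0) = (\<lambda>i. 0)"
    using 1[of "\<lambda>i. 0" "\<lambda>i. 0"] by (simp add: fun_eq_iff)
  then show "T (\<lambda>i. x * v i) = (\<lambda>i. x * T v i)" for x v
    using that[rule_format, of x v "\<lambda>i. 0"] by simp
qed

instantiation lin :: (comm_ring_1) ring_1
begin

lift_definition zero_lin :: "'a lin" is "\<lambda>v i. 0" by simp
lift_definition one_lin :: "'a lin" is "\<lambda>v. v" by simp
lift_definition plus_lin :: "'a lin \<Rightarrow> 'a lin \<Rightarrow> 'a lin" is "\<lambda>S T v i. S v i + T v i"
  by (simp add: algebra_simps)
lift_definition uminus_lin :: "'a lin \<Rightarrow> 'a lin" is "\<lambda>S v i. - S v i"
  by (simp add: algebra_simps)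
lift_definition minus_lin :: "'a lin \<Rightarrow> 'a lin \<Rightarrow> 'a lin" is "\<lambda>S T v i. S v i - T v i"
  by (simp add: algebra_simps)
lift_definition times_lin :: "'a lin \<Rightarrow> 'a lin \<Rightarrow> 'a lin" is "\<lambda>S T v. S (T v)"
  by simp

instance
proof
  show "(0::'a lin) \<noteq> 1"
    by transfer (auto simp: fun_eq_iff intro!: exI[of _ "\<lambda>_. 1"])
  show "a * (b + c) = a * b + a * c" for a b c :: "'a lin"
    by transfer (simp add: lin_add fun_eq_iff)
qed (transfer; simp add: fun_eq_iff algebra_simps)+

end

lift_definition lin_scalar :: "'a::comm_ring_1 \<Rightarrow> 'a lin" is "\<lambda>x v i. x * v i"
  by (simp add: algebra_simps)

text \<open>The \<open>n \<times> n\<close> matrix \<open>A\<close> as the block diagonal operator with infinitely many blocks \<open>A\<close>;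
  in this way matrices of all sizes live in a single unital ring.\<close>

lift_definition block_diag :: "nat \<Rightarrow> 'a::comm_ring_1 mat \<Rightarrow> 'a lin" is
  "\<lambda>n A v i. \<Sum>r<n. A $$ (i mod n, r) * v (n * (i div n) + r)"
  by (simp add: algebra_simps sum.distrib sum_distrib_left)

lemma lin_scalar_simps: "lin_scalar 0 = 0" "lin_scalar 1 = 1"
  "lin_scalar (x + y) = lin_scalar x + lin_scalar y" "lin_scalar (x * y) = lin_scalar x * lin_scalar y"
  by (transfer, simp add: algebra_simps)+

lemma lin_scalar_comm: "lin_scalar x * e = e * lin_scalar x"
  by transfer (simp add: lin_scale)

lemma block_diag_mult:
  assumes "n \<ge> 1" "A \<in> carrier_mat n n" "B \<in> carrier_mat n n"
  shows "block_diag n (A * B) = block_diag n A * block_diag n B"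
  using assms
proof (transfer, intro ext)
  fix n and A B :: "'a mat" and v :: "nat \<Rightarrow> 'a" and i
  assume n: "1 \<le> n" and A: "A \<in> carrier_mat n n" and B: "B \<in> carrier_mat n n"
  have "i mod n < n" using n by simp
  then have "(\<Sum>s<n. (A * B) $$ (i mod n, s) * v (n * (i div n) + s)) =
    (\<Sum>s<n. \<Sum>r<n. A $$ (i mod n, r) * B $$ (r, s) * v (n * (i div n) + s))"
    using A B by (simp add: scalar_prod_def sum_distrib_right atLeast0LessThan)
  also have "\<dots> = (\<Sum>r<n. \<Sum>s<n. A $$ (i mod n, r) * B $$ (r, s) * v (n * (i div n) + s))"
    by (rule sum.swap)
  also have "\<dots> = (\<Sum>r<n. A $$ (i mod n, r) * (\<Sum>s<n. B $$ ((n * (i div n) + r) mod n, s) *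
      v (n * ((n * (i div n) + r) div n) + s)))"
    by (simp add: sum_distrib_left mult.assoc)
  finally show "(\<Sum>s<n. (A * B) $$ (i mod n, s) * v (n * (i div n) + s)) = \<dots>" .
qed

lemma block_diag_add:
  assumes "n \<ge> 1" "A \<in> carrier_mat n n" "B \<in> carrier_mat n n"
  shows "block_diag n (A + B) = block_diag n A + block_diag n B"
  using assms by transfer (auto simp: fun_eq_iff algebra_simps sum.distrib)

lemma sum_delta_mult: "r < (n::nat) \<Longrightarrow> (\<Sum>s<n. (if r = s then (1::'a::comm_ring_1) else 0) * f s) = f r"
  by (subst sum.remove[of _ r]) (auto intro!: sum.neutral)

lemma block_diag_one: "n \<ge> 1 \<Longrightarrow> block_diag n (1\<^sub>m n) = 1"
proof (transfer, intro ext)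
  fix n i :: nat and v :: "nat \<Rightarrow> 'a" assume "1 \<le> n"
  then have "(\<Sum>r<n. 1\<^sub>m n $$ (i mod n, r) * v (n * (i div n) + r)) =
    (\<Sum>r<n. (if i mod n = r then 1 else 0) * v (n * (i div n) + r))"
    by (intro sum.cong) auto
  also have "\<dots> = v i"
    using \<open>1 \<le> n\<close> by (subst sum_delta_mult) auto
  finally show "(\<Sum>r<n. 1\<^sub>m n $$ (i mod n, r) * v (n * (i div n) + r)) = v i" .
qed

lemma block_diag_scalar: "n \<ge> 1 \<Longrightarrow> block_diag n (x \<cdot>\<^sub>m 1\<^sub>m n) = lin_scalar x"
proof (transfer, intro ext)
  fix n i :: nat and x and v :: "nat \<Rightarrow> 'a" assume "1 \<le> n"
  then have "(\<Sum>r<n. (x \<cdot>\<^sub>m 1\<^sub>m n) $$ (i mod n, r) * v (n * (i div n) + r)) =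
    (\<Sum>r<n. (if i mod n = r then 1 else 0) * (x * v (n * (i div n) + r)))"
    by (intro sum.cong) auto
  also have "\<dots> = x * v i"
    using \<open>1 \<le> n\<close> by (subst sum_delta_mult) auto
  finally show "(\<Sum>r<n. (x \<cdot>\<^sub>m 1\<^sub>m n) $$ (i mod n, r) * v (n * (i div n) + r)) = x * v i" .
qed

lemma block_diag_inj:
  assumes "A \<in> carrier_mat n n" "B \<in> carrier_mat n n" "block_diag n A = block_diag n B"
  shows "A = B"
proof (rule eq_matI)
  fix i j assume "i < dim_row B" "j < dim_col B"
  then have ij: "i < n" "j < n" using assms by auto
  let ?v = "\<lambda>k. if k = j then 1 else 0 :: 'a"
  have "(\<Sum>r<n. C $$ (i mod n, r) * ?v (n * (i div n) + r)) = C $$ (i, j)" for C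
    using ij by (simp add: if_distrib cong: if_cong)
  moreover have "Rep_lin (block_diag n A) ?v i = Rep_lin (block_diag n B) ?v i"
    using assms(3) by simp
  ultimately show "A $$ (i, j) = B $$ (i, j)"
    by (simp add: block_diag.rep_eq)
qed (use assms in auto)

lemma block_diag_power:
  assumes "n \<ge> 1" "A \<in> carrier_mat n n"
  shows "block_diag n (A ^\<^sub>m k) = block_diag n A ^ k"
proof (induction k)
  case 0
  then show ?case using assms block_diag_one by simp
next
  case (Suc k)
  then show ?case using assms by (simp add: block_diag_mult pow_carrier_mat power_commutes)
qed

lemma Rep_lin_sum: "Rep_lin (sum f I) v i = (\<Sum>k\<in>I. Rep_lin (f k) v i)"
  by (induction I rule: infinite_finite_induct) (simp_all add: zero_lin.rep_eq plus_lin.rep_eq)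

lemma linear_dependence:
  fixes f :: "nat \<Rightarrow> nat \<Rightarrow> 'f::field"
  shows "\<exists>\<gamma>. (\<exists>i\<le>d. \<gamma> i \<noteq> 0) \<and> (\<forall>k<d. (\<Sum>i\<le>d. \<gamma> i * f i k) = 0)"
proof -
  define c where "c k = vec (Suc d) (\<lambda>i. f i k)" for k
  \<comment> \<open>The additional zero row makes the matrix square and singular, so the dependence
    comes from the determinant.\<close>
  define A where "A = mat\<^sub>r (Suc d) (Suc d) (\<lambda>k. if k = d then 0\<^sub>v (Suc d) else c k)"
  have "det A = 0"
    unfolding A_def by (rule det_row_0) (auto simp: c_def)
  then obtain v where v: "v \<in> carrier_vec (Suc d)" "v \<noteq> 0\<^sub>v (Suc d)" "A *\<^sub>v v = 0\<^sub>v (Suc d)"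
    using det_0_iff_vec_prod_zero_field[of A "Suc d"] unfolding A_def by auto
  have "\<exists>i\<le>d. v $ i \<noteq> 0"
  proof (rule ccontr)
    assume "\<not> (\<exists>i\<le>d. v $ i \<noteq> 0)"
    then have "v = 0\<^sub>v (Suc d)"
      using v(1) by (intro eq_vecI) auto
    then show False using v(2) by simp
  qed
  moreover have "(\<Sum>i\<le>d. v $ i * f i k) = 0" if "k < d" for k
  proof -
    have "row A k \<bullet> v = (A *\<^sub>v v) $ k"
      using that by (simp add: A_def)
    also have "\<dots> = 0"
      using v(3) that by simp
    also have "row A k = c k"
      using that unfolding A_def by (intro eq_vecI) (auto simp: c_def)
    finally show ?thesis
      using v(1) by (simp add: c_def scalar_prod_def atLeast0LessThan lessThan_Suc_atMost mult.commute)
  qed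
  ultimately show ?thesis
    by blast
qed

lemma findim_algebra_matrices:
  assumes "n \<ge> 1"
  shows "findim_algebra (lin_scalar :: 'f::alg_closed_field \<Rightarrow> _) (block_diag n ` carrier_mat n n) (n * n)"
proof
  show "\<exists>\<gamma>. (\<exists>i\<le>n * n. \<gamma> i \<noteq> 0) \<and> (\<Sum>i\<le>n * n. lin_scalar (\<gamma> i) * f i) = 0"
    if "\<And>i. i \<le> n * n \<Longrightarrow> f i \<in> block_diag n ` carrier_mat n n" for f :: "nat \<Rightarrow> 'f lin"
  proof -
    have "\<exists>A. i \<le> n * n \<longrightarrow> f i = block_diag n A" for i
      using that by blast
    then obtain F where F: "\<And>i. i \<le> n * n \<Longrightarrow> f i = block_diag n (F i)"
      by metis
    obtain \<gamma> where \<gamma>: "\<exists>i\<le>n * n. \<gamma> i \<noteq> 0"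
      and 0: "\<And>k. k < n * n \<Longrightarrow> (\<Sum>i\<le>n * n. \<gamma> i * F i $$ (k div n, k mod n)) = 0"
      using linear_dependence[of "n * n" "\<lambda>i k. F i $$ (k div n, k mod n)"] by blast
    have 00: "(\<Sum>i\<le>n * n. \<gamma> i * F i $$ (r, s)) = 0" if "r < n" "s < n" for r s
    proof -
      have "n * r + s < n * Suc r"
        using that by simp
      also have "\<dots> \<le> n * n"
        using that by (intro mult_left_mono) auto
      finally have "n * r + s < n * n" .
      from 0[OF this] show ?thesis
        using that by simp
    qed
    have "(\<Sum>i\<le>n * n. lin_scalar (\<gamma> i) * f i) = (\<Sum>i\<le>n * n. lin_scalar (\<gamma> i) * block_diag n (F i))"
      using F by simp
    also have "\<dots> = 0"
    proof (rule Rep_lin_inject[THEN iffD1], intro ext)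
      fix v j
      have "Rep_lin (\<Sum>i\<le>n * n. lin_scalar (\<gamma> i) * block_diag n (F i)) v j =
        (\<Sum>i\<le>n * n. \<gamma> i * (\<Sum>s<n. F i $$ (j mod n, s) * v (n * (j div n) + s)))"
        by (simp add: Rep_lin_sum times_lin.rep_eq lin_scalar.rep_eq block_diag.rep_eq)
      also have "\<dots> = (\<Sum>s<n. (\<Sum>i\<le>n * n. \<gamma> i * F i $$ (j mod n, s)) * v (n * (j div n) + s))"
        unfolding sum_distrib_left sum_distrib_right mult.assoc by (rule sum.swap)
      also have "\<dots> = 0"
        using 00 assms by simp
      finally show "Rep_lin (\<Sum>i\<le>n * n. lin_scalar (\<gamma> i) * block_diag n (F i)) v j = Rep_lin 0 v j"
        by (simp add: zero_lin.rep_eq)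
    qed
    finally show ?thesis
      using \<gamma> by blast
  qed
  have im: "block_diag n A \<in> block_diag n ` carrier_mat n n" if "A \<in> carrier_mat n n" for A :: "'f mat"
    using that by (rule imageI)
  show "(1 :: 'f lin) \<in> block_diag n ` carrier_mat n n"
    using im[OF one_carrier_mat] by (simp add: block_diag_one[OF assms])
  show "lin_scalar x \<in> block_diag n ` carrier_mat n n" for x :: 'f
    using im[of "x \<cdot>\<^sub>m 1\<^sub>m n"] block_diag_scalar[OF assms, of x] by simp
  fix u v :: "'f lin"
  assume "u \<in> block_diag n ` carrier_mat n n" "v \<in> block_diag n ` carrier_mat n n"
  then obtain A B where AB: "u = block_diag n A" "v = block_diag n B" "A \<in> carrier_mat n n" "B \<in> carrier_mat n n"
    by blast
  show "u + v \<in> block_diag n ` carrier_mat n n"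
    using im[of "A + B"] AB block_diag_add[OF assms AB(3,4)] by simp
  show "u * v \<in> block_diag n ` carrier_mat n n"
    using im[of "A * B"] AB block_diag_mult[OF assms AB(3,4)] by simp
qed (rule lin_scalar_simps lin_scalar_comm)+

text \<open>In the application \<open>h\<close> is the image of \<open>scale_map 2\<close>. The same
  \<open>h\<close> has to serve \<open>a\<close> and \<open>b\<close>, since eigenvectors arising
  from both are multiplied with each other.\<close>

definition squaring_data :: "nat \<Rightarrow> 'a::comm_ring_1 mat quad \<Rightarrow> 'a mat \<Rightarrow> 'a mat \<Rightarrow> bool" where
  "squaring_data n = (\<lambda>(a, a', b, b') h h'. {a, a', b, b', h, h'} \<subseteq> carrier_mat n n \<and>
     a * a' = 1\<^sub>m n \<and> a' * a = 1\<^sub>m n \<and> b * b' = 1\<^sub>m n \<and> b' * b = 1\<^sub>m n \<and> h * h' = 1\<^sub>m n \<and> h' * h = 1\<^sub>m n \<and>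
     a * h = h * (a * a) \<and> b * h = h * (b * b))"

definition mat_exp :: "nat \<Rightarrow> nat" where
  "mat_exp n = unipotent_exp (n * n)"

text \<open>Exponent and number of steps are functions of \<open>n\<close> alone, so that the same
  words can be mapped to every residue field.\<close>

definition deep_commutators :: "nat \<Rightarrow> 'a::comm_ring_1 mat quad \<Rightarrow> 'a mat quad" where
  "deep_commutators n q = (dstep (*) ^^ Suc (n * n)) (quad_map (\<lambda>A. A ^\<^sub>m mat_exp n) q)"

lemma dstep_block_diag:
  assumes "n \<ge> 1" "quad_all (\<lambda>A. A \<in> carrier_mat n n) q"
  shows "quad_map (block_diag n) ((dstep (*) ^^ k) q) = (dstep (*) ^^ k) (quad_map (block_diag n) q)"
  by (rule dstep_hom[of "carrier_mat n n" "(*)" "block_diag n" "(*)", OF mult_carrier_mat block_diag_mult[OF assms(1)] assms(2)])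

lemma quad_all_power:
  assumes "quad_all (\<lambda>A. A \<in> carrier_mat n n) q"
  shows "quad_all (\<lambda>A. A \<in> carrier_mat n n) (quad_map (\<lambda>A. A ^\<^sub>m k) q)"
  using assms by (cases q) (simp add: pow_carrier_mat)

lemma deep_commutators_carrier:
  assumes "quad_all (\<lambda>A. A \<in> carrier_mat n n) q"
  shows "quad_all (\<lambda>A. A \<in> carrier_mat n n) (deep_commutators n q)"
  unfolding deep_commutators_def
  by (rule dstep_closed[OF mult_carrier_mat quad_all_power[OF assms]])

lemma deep_commutators_field:
  fixes h :: "'f::alg_closed_field mat"
  assumes n: "n \<ge> 1" and D: "squaring_data n q h h'"
  shows "quad_all (\<lambda>A. A = 1\<^sub>m n) (deep_commutators n q)"
proof -
  obtain a a' b b' where q: "q = (a, a', b, b')"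
    by (cases q)
  note D = D[unfolded q squaring_data_def prod.case]
  have c: "a \<in> carrier_mat n n" "a' \<in> carrier_mat n n" "b \<in> carrier_mat n n" "b' \<in> carrier_mat n n"
    "h \<in> carrier_mat n n" "h' \<in> carrier_mat n n"
    using D by auto
  interpret findim_algebra lin_scalar "block_diag n ` carrier_mat n n" "n * n"
    by (rule findim_algebra_matrices[OF n])
  let ?B = "block_diag n"
  have one: "?B (1\<^sub>m n :: 'f mat) = 1"
    by (rule block_diag_one[OF n])
  have rel: "?B x * ?B y = 1" if "x * y = 1\<^sub>m n" "x \<in> carrier_mat n n" "y \<in> carrier_mat n n"
    for x y :: "'f mat"
    using that block_diag_mult[OF n that(2,3)] one by simp
  have rel2: "?B g * ?B h = ?B h * (?B g * ?B g)" if "g * h = h * (g * g)" "g \<in> carrier_mat n n"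
    for g :: "'f mat"
    using that c by (simp flip: block_diag_mult[OF n])
  have "quad_all (\<lambda>x. x = 1) ((dstep (*) ^^ Suc (n * n))
     (quad_map (\<lambda>x. x ^ unipotent_exp (n * n)) (?B a, ?B a', ?B b, ?B b')))"
  proof (rule dstep_power_trivial[where h = "?B h" and h' = "?B h'"])
    show "1 \<le> n * n"
      using n by simp
  qed (use c D in \<open>simp_all add: rel rel2\<close>)
  also have "quad_map (\<lambda>x. x ^ unipotent_exp (n * n)) (?B a, ?B a', ?B b, ?B b') =
      quad_map ?B (quad_map (\<lambda>A. A ^\<^sub>m mat_exp n) q)"
    using c by (simp add: q block_diag_power[OF n] mat_exp_def)
  also have "(dstep (*) ^^ Suc (n * n)) \<dots> = quad_map ?B (deep_commutators n q)"
    unfolding deep_commutators_def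
    by (rule dstep_block_diag[OF n quad_all_power, symmetric]) (use c in \<open>simp add: q\<close>)
  finally have 1: "quad_all (\<lambda>A. ?B A = 1) (deep_commutators n q)"
    by (simp add: quad_all_map)
  have "quad_all (\<lambda>A. A \<in> carrier_mat n n) (deep_commutators n q)"
    using c by (intro deep_commutators_carrier) (simp add: q)
  moreover have "A = 1\<^sub>m n" if "A \<in> carrier_mat n n" "?B A = 1" for A :: "'f mat"
    using block_diag_inj[OF that(1) one_carrier_mat] that(2) one by simp
  ultimately show ?thesis
    using 1 by (cases "deep_commutators n q") simp
qed

section \<open>Prime ideals and residue fields\<close>

definition ideal_set :: "'a::comm_ring_1 set \<Rightarrow> bool" where
  "ideal_set I \<longleftrightarrow> 0 \<in> I \<and> (\<forall>x\<in>I. \<forall>y\<in>I. x + y \<in> I) \<and> (\<forall>x\<in>I. \<forall>r. r * x \<in> I)"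

definition prime_set :: "'a::comm_ring_1 set \<Rightarrow> bool" where
  "prime_set P \<longleftrightarrow> ideal_set P \<and> 1 \<notin> P \<and> (\<forall>x y. x * y \<in> P \<longrightarrow> x \<in> P \<or> y \<in> P)"

lemma ideal_set_extend:
  assumes "ideal_set I"
  shows "ideal_set {p + r * x | p r. p \<in> I}"
  unfolding ideal_set_def
proof (intro conjI ballI allI)
  show "0 \<in> {p + r * x | p r. p \<in> I}"
    using assms unfolding ideal_set_def by (intro CollectI exI[of _ 0]) simp
next
  fix u v assume "u \<in> {p + r * x | p r. p \<in> I}" "v \<in> {p + r * x | p r. p \<in> I}"
  then obtain p r q s where "u = p + r * x" "v = q + s * x" "p \<in> I" "q \<in> I" by blast
  then show "u + v \<in> {p + r * x | p r. p \<in> I}"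
    using assms unfolding ideal_set_def
    by (intro CollectI exI[of _ "p + q"] exI[of _ "r + s"]) (simp add: algebra_simps)
next
  fix u t assume "u \<in> {p + r * x | p r. p \<in> I}"
  then obtain p r where "u = p + r * x" "p \<in> I" by blast
  then show "t * u \<in> {p + r * x | p r. p \<in> I}"
    using assms unfolding ideal_set_def
    by (intro CollectI exI[of _ "t * p"] exI[of _ "t * r"]) (simp add: algebra_simps)
qed

text \<open>An ideal maximal among those that contain no power of \<open>f\<close> is prime:
  adjoining \<open>x\<close> or \<open>y\<close> from outside would capture powers of
  \<open>f\<close>, whose product then lies in the ideal if \<open>x * y\<close> does.\<close>

lemma prime_set_avoiding:
  fixes f :: "'a::comm_ring_1"
  assumes "\<And>n. f ^ n \<noteq> 0"
  obtains P where "prime_set P" "f \<notin> P"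
proof -
  define \<A> where "\<A> = {I. ideal_set I \<and> (\<forall>n. f ^ n \<notin> I)}"
  have "{0} \<in> \<A>"
    using assms by (auto simp: \<A>_def ideal_set_def)
  then have ne: "\<A> \<noteq> {}" by blast
  have "\<exists>M\<in>\<A>. \<forall>Y\<in>\<A>. M \<subseteq> Y \<longrightarrow> Y = M"
  proof (rule subset_Zorn_nonempty[OF ne])
    fix C assume C: "C \<noteq> {}" "subset.chain \<A> C"
    then have CA: "C \<subseteq> \<A>" and tot: "\<And>x y. x \<in> C \<Longrightarrow> y \<in> C \<Longrightarrow> x \<subseteq> y \<or> y \<subseteq> x"
      unfolding subset.chain_def by auto
    have "ideal_set (\<Union> C)"
      unfolding ideal_set_def
    proof (intro conjI ballI allI)
      show "0 \<in> \<Union> C"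
        using C(1) CA unfolding \<A>_def ideal_set_def by blast
      show "x + y \<in> \<Union> C" if xy: "x \<in> \<Union> C" "y \<in> \<Union> C" for x y
      proof -
        obtain I J where "I \<in> C" "x \<in> I" "J \<in> C" "y \<in> J"
          using xy by blast
        then obtain L where "L \<in> C" "x \<in> L" "y \<in> L"
          using tot[of I J] by blast
        then show ?thesis
          using CA unfolding \<A>_def ideal_set_def by blast
      qed
      show "r * x \<in> \<Union> C" if "x \<in> \<Union> C" for x r
        using that CA unfolding \<A>_def ideal_set_def by blast
    qed
    then show "\<Union> C \<in> \<A>"
      using CA unfolding \<A>_def by blast
  qed
  then obtain M where M: "M \<in> \<A>" and max: "\<And>Y. Y \<in> \<A> \<Longrightarrow> M \<subseteq> Y \<Longrightarrow> Y = M"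
    by blast
  have I: "ideal_set M" and pow: "\<And>n. f ^ n \<notin> M"
    using M unfolding \<A>_def by auto
  have ext: "\<exists>n p r. f ^ n = p + r * x \<and> p \<in> M" if "x \<notin> M" for x
  proof (rule ccontr)
    let ?J = "{p + r * x | p r. p \<in> M}"
    assume "\<not> ?thesis"
    then have "?J \<in> \<A>"
      using ideal_set_extend[OF I, of x] unfolding \<A>_def by blast
    moreover have "M \<subseteq> ?J"
    proof
      fix m assume "m \<in> M"
      then show "m \<in> ?J"
        by (intro CollectI exI[of _ m] exI[of _ 0]) simp
    qed
    ultimately have "?J = M"
      by (rule max)
    moreover have "x \<in> ?J"
      using I unfolding ideal_set_def by (intro CollectI exI[of _ 0] exI[of _ 1]) simp
    ultimately show False
      using that by blast
  qed
  have "prime_set M"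
    unfolding prime_set_def
  proof (intro conjI allI impI I)
    show "1 \<notin> M"
      using pow[of 0] by simp
    show "x \<in> M \<or> y \<in> M" if xy: "x * y \<in> M" for x y
    proof (rule ccontr)
      assume "\<not> (x \<in> M \<or> y \<in> M)"
      then obtain m p r n q s where *: "f ^ m = p + r * x" "p \<in> M" "f ^ n = q + s * y" "q \<in> M"
        using ext[of x] ext[of y] by blast
      have "f ^ (m + n) = (q + s * y) * p + (r * x) * q + (r * s) * (x * y)"
        by (simp add: power_add * algebra_simps)
      also have "\<dots> \<in> M"
        using I *(2,4) xy unfolding ideal_set_def by (meson)
      finally show False
        using pow by blast
    qed
  qed
  then show thesis
    using that pow[of 1] by simp
qed

lemma prime_set_exists: "\<exists>P :: 'a::comm_ring_1 set. prime_set P"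
  using prime_set_avoiding[of 1] by auto

definition entries_mod :: "nat \<Rightarrow> 'a::comm_ring_1 set \<Rightarrow> 'a mat \<Rightarrow> bool" where
  "entries_mod n I A \<longleftrightarrow> (\<forall>i<n. \<forall>j<n. (A - 1\<^sub>m n) $$ (i, j) \<in> I)"

text \<open>The size and the matrices are quantified here because the prime that defines the residue
  field as a type may depend on the ring only, not on given matrices.\<close>

definition bad_prime :: "'a::comm_ring_1 set \<Rightarrow> bool" where
  "bad_prime P \<longleftrightarrow> prime_set P \<and> (\<exists>n q h h'. n \<ge> 1 \<and> squaring_data n q h h' \<and>
     \<not> quad_all (entries_mod n P) (deep_commutators n q))"

text \<open>A residue field of the ring has to be available as a type. A single prime suffices for this:
  one at which the claim fails, if there is any such prime at all.\<close>

definition test_prime :: "'a::comm_ring_1 set" where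
  "test_prime = (if \<exists>P :: 'a set. bad_prime P then SOME P. bad_prime P else SOME P. prime_set P)"

lemma bad_primeD: "bad_prime P \<Longrightarrow> prime_set P"
  by (simp add: bad_prime_def)

lemma prime_test_prime: "prime_set (test_prime :: 'a::comm_ring_1 set)"
proof (cases "\<exists>P :: 'a set. bad_prime P")
  case True
  then show ?thesis
    using bad_primeD[OF someI_ex[OF True]] unfolding test_prime_def by simp
next
  case False
  then show ?thesis
    using someI_ex[OF prime_set_exists[where 'a = 'a]] unfolding test_prime_def if_not_P[OF False] by simp
qed

lemma bad_test_prime: "bad_prime (P :: 'a::comm_ring_1 set) \<Longrightarrow> bad_prime (test_prime :: 'a set)"
  unfolding test_prime_def using someI_ex[of "bad_prime :: 'a set \<Rightarrow> bool"] by auto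

lemma test_prime_simps:
  fixes x y :: "'a::comm_ring_1"
  shows "0 \<in> (test_prime :: 'a set)" "(1 :: 'a) \<notin> test_prime"
    "x \<in> test_prime \<Longrightarrow> y \<in> test_prime \<Longrightarrow> x + y \<in> test_prime"
    "x \<in> test_prime \<Longrightarrow> r * x \<in> test_prime" "x \<in> test_prime \<Longrightarrow> x * r \<in> test_prime"
    "x * y \<in> test_prime \<Longrightarrow> x \<in> test_prime \<or> y \<in> test_prime"
    "x \<in> test_prime \<Longrightarrow> - x \<in> test_prime"
    "x \<in> test_prime \<Longrightarrow> y \<in> test_prime \<Longrightarrow> x - y \<in> test_prime"
proof -
  note p = prime_test_prime[where 'a = 'a, unfolded prime_set_def ideal_set_def]
  show "0 \<in> (test_prime :: 'a set)" "(1 :: 'a) \<notin> test_prime"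
    "x * y \<in> test_prime \<Longrightarrow> x \<in> test_prime \<or> y \<in> test_prime"
    using p by blast+
  show add: "x \<in> test_prime \<Longrightarrow> y \<in> test_prime \<Longrightarrow> x + y \<in> test_prime" for x y :: 'a
    using p by blast
  show mult: "x \<in> test_prime \<Longrightarrow> r * x \<in> test_prime" for x r :: 'a
    using p by blast
  show "x \<in> test_prime \<Longrightarrow> x * r \<in> test_prime"
    using mult[of x r] by (simp add: mult.commute)
  show um: "x \<in> test_prime \<Longrightarrow> - x \<in> test_prime" for x :: 'a
    using mult[of x "- 1"] by simp
  show "x \<in> test_prime \<Longrightarrow> y \<in> test_prime \<Longrightarrow> x - y \<in> test_prime"
    using add[of x "- y"] um[of y] by simp
qed

definition resid_rel :: "'a::comm_ring_1 \<Rightarrow> 'a \<Rightarrow> bool" where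
  "resid_rel x y \<longleftrightarrow> x - y \<in> test_prime"

lemma equivp_resid_rel: "equivp (resid_rel :: 'a::comm_ring_1 \<Rightarrow> _)"
proof (rule equivpI)
  show "symp (resid_rel :: 'a \<Rightarrow> _)"
  proof (rule sympI)
    fix x y :: 'a assume "resid_rel x y"
    then show "resid_rel y x"
      using test_prime_simps(7)[of "x - y"] unfolding resid_rel_def by simp
  qed
  show "transp (resid_rel :: 'a \<Rightarrow> _)"
  proof (rule transpI)
    fix x y z :: 'a assume "resid_rel x y" "resid_rel y z"
    then show "resid_rel x z"
      using test_prime_simps(3)[of "x - y" "y - z"] unfolding resid_rel_def by simp
  qed
qed (simp add: reflp_def resid_rel_def test_prime_simps)

quotient_type (overloaded) 'a resid = "'a::comm_ring_1" / resid_rel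
  by (rule equivp_resid_rel)

instantiation resid :: (comm_ring_1) idom
begin

lift_definition zero_resid :: "'a resid" is 0 .
lift_definition one_resid :: "'a resid" is 1 .
lift_definition plus_resid :: "'a resid \<Rightarrow> 'a resid \<Rightarrow> 'a resid" is "(+)"
proof -
  fix x y z w :: 'a assume "resid_rel x y" "resid_rel z w"
  then have "(x - y) + (z - w) \<in> test_prime"
    unfolding resid_rel_def by (rule test_prime_simps)
  then show "resid_rel (x + z) (y + w)"
    unfolding resid_rel_def by (simp add: algebra_simps)
qed
lift_definition uminus_resid :: "'a resid \<Rightarrow> 'a resid" is uminus
proof -
  fix x y :: 'a assume "resid_rel x y"
  then have "- (x - y) \<in> test_prime"
    unfolding resid_rel_def by (rule test_prime_simps)
  then show "resid_rel (- x) (- y)"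
    unfolding resid_rel_def by (simp add: algebra_simps)
qed
lift_definition minus_resid :: "'a resid \<Rightarrow> 'a resid \<Rightarrow> 'a resid" is "(-)"
proof -
  fix x y z w :: 'a assume "resid_rel x y" "resid_rel z w"
  then have "(x - y) - (z - w) \<in> test_prime"
    unfolding resid_rel_def by (rule test_prime_simps)
  then show "resid_rel (x - z) (y - w)"
    unfolding resid_rel_def by (simp add: algebra_simps)
qed
lift_definition times_resid :: "'a resid \<Rightarrow> 'a resid \<Rightarrow> 'a resid" is "(*)"
proof -
  fix x y z w :: 'a assume "resid_rel x y" "resid_rel z w"
  then have "(x - y) * z + y * (z - w) \<in> test_prime"
    unfolding resid_rel_def by (intro test_prime_simps(3) test_prime_simps(4) test_prime_simps(5))
  moreover have "(x - y) * z + y * (z - w) = x * z - y * w"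
    by (simp add: algebra_simps)
  ultimately show "resid_rel (x * z) (y * w)"
    unfolding resid_rel_def by simp
qed

instance
proof
  show "(0::'a resid) \<noteq> 1"
    by transfer (use test_prime_simps(7)[of "- 1"] test_prime_simps(2) in \<open>auto simp: resid_rel_def\<close>)
  show "a \<noteq> 0 \<Longrightarrow> b \<noteq> 0 \<Longrightarrow> a * b \<noteq> 0" for a b :: "'a resid"
    by transfer (simp add: resid_rel_def, use test_prime_simps(6) in blast)
qed (transfer; simp add: resid_rel_def algebra_simps test_prime_simps(1))+

end

definition residue :: "'a::comm_ring_1 \<Rightarrow> 'a resid fract alg_closure" where
  "residue x = to_ac (to_fract (abs_resid x))"

lemma residue_eq_0: "residue x = 0 \<longleftrightarrow> x \<in> test_prime"
proof -
  have "residue x = 0 \<longleftrightarrow> abs_resid x = abs_resid 0"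
    by (simp add: residue_def flip: zero_resid_def)
  then show ?thesis
    by (simp add: resid.abs_eq_iff resid_rel_def)
qed

interpretation residue: comm_ring_hom residue
proof
  show "residue (x + y) = residue x + residue y" "residue (x * y) = residue x * residue y" for x y :: 'a
    unfolding residue_def plus_resid.abs_eq[symmetric] times_resid.abs_eq[symmetric] by simp_all
  show "residue (1 :: 'a) = 1" "residue (0 :: 'a) = 0"
    unfolding residue_def zero_resid_def[symmetric] one_resid_def[symmetric] by simp_all
qed

lemma squaring_data_carrier: "squaring_data n q h h' \<Longrightarrow> quad_all (\<lambda>A. A \<in> carrier_mat n n) q"
  by (cases q) (simp add: squaring_data_def)

lemma squaring_data_hom:
  assumes "semiring_hom \<phi>" "squaring_data n q h h'"
  shows "squaring_data n (quad_map (map_mat \<phi>) q) (map_mat \<phi> h) (map_mat \<phi> h')"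
proof -
  interpret semiring_hom \<phi> by (rule assms(1))
  obtain a a' b b' where q: "q = (a, a', b, b')"
    by (cases q)
  note D = assms(2)[unfolded q squaring_data_def prod.case]
  have c: "a \<in> carrier_mat n n" "a' \<in> carrier_mat n n" "b \<in> carrier_mat n n" "b' \<in> carrier_mat n n"
    "h \<in> carrier_mat n n" "h' \<in> carrier_mat n n"
    using D by auto
  note m = mat_hom_mult[of _ n n _ n, symmetric]
  show ?thesis
    using D c unfolding squaring_data_def q quad_map_simp prod.case by (simp add: m mat_hom_one)
qed

lemma deep_commutators_hom:
  assumes "semiring_hom \<phi>" "quad_all (\<lambda>A. A \<in> carrier_mat n n) q"
  shows "deep_commutators n (quad_map (map_mat \<phi>) q) = quad_map (map_mat \<phi>) (deep_commutators n q)"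
proof -
  interpret semiring_hom \<phi> by (rule assms(1))
  have "quad_map (\<lambda>A. A ^\<^sub>m mat_exp n) (quad_map (map_mat \<phi>) q) =
      quad_map (map_mat \<phi>) (quad_map (\<lambda>A. A ^\<^sub>m mat_exp n) q)"
    using assms(2) by (cases q) (simp add: mat_hom_pow[where n = n])
  then show ?thesis
    unfolding deep_commutators_def
    using dstep_hom[of "carrier_mat n n" "(*)" "map_mat \<phi>" "(*)", OF mult_carrier_mat[of _ n n _ n]
      mat_hom_mult[of _ n n _ n] quad_all_power[OF assms(2)]] by (simp only:)
qed

text \<open>A non-nilpotent entry is avoided by some prime, which is then bad. Hence
  \<open>test_prime\<close> is bad as well, though perhaps for another size and other matrices.
  These have images over an algebraically closed field, where \<open>deep_commutators_field\<close>
  refutes badness.\<close>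

lemma deep_commutators_nilpotent:
  fixes q :: "'a::comm_ring_1 mat quad"
  assumes "n \<ge> 1" "squaring_data n q h h'"
  shows "quad_all (entries_mod n {f. \<exists>k. f ^ k = 0}) (deep_commutators n q)"
proof (rule ccontr)
  assume neg: "\<not> ?thesis"
  obtain w1 w2 w3 w4 where w: "deep_commutators n q = (w1, w2, w3, w4)"
    by (cases "deep_commutators n q")
  then obtain A i j where A: "A \<in> {w1, w2, w3, w4}" "i < n" "j < n" "\<And>k. ((A - 1\<^sub>m n) $$ (i, j)) ^ k \<noteq> 0"
    using neg unfolding entries_mod_def by auto
  obtain P where P: "prime_set P" "(A - 1\<^sub>m n) $$ (i, j) \<notin> P"
    using prime_set_avoiding[OF A(4)] by blast
  then have "\<not> entries_mod n P A"
    using A(2,3) unfolding entries_mod_def by blast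
  then have "\<not> quad_all (entries_mod n P) (deep_commutators n q)"
    using A(1) unfolding w by auto
  then have "bad_prime P"
    using P(1) assms unfolding bad_prime_def by blast
  then have "bad_prime (test_prime :: 'a set)"
    by (rule bad_test_prime)
  then obtain n q and h h' :: "'a mat" where n: "n \<ge> 1" and D: "squaring_data n q h h'"
    and N: "\<not> quad_all (entries_mod n test_prime) (deep_commutators n q)"
    unfolding bad_prime_def by blast
  have hom: "semiring_hom (residue :: 'a \<Rightarrow> _)" ..
  have "quad_all (\<lambda>A. A = 1\<^sub>m n) (deep_commutators n (quad_map (map_mat residue) q))"
    by (rule deep_commutators_field[OF n squaring_data_hom[OF hom D]])
  then have "quad_all (\<lambda>A. map_mat residue A = 1\<^sub>m n) (deep_commutators n q)"
    unfolding deep_commutators_hom[OF hom squaring_data_carrier[OF D]] quad_all_map .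
  moreover have "quad_all (\<lambda>A. A \<in> carrier_mat n n) (deep_commutators n q)"
    by (rule deep_commutators_carrier[OF squaring_data_carrier[OF D]])
  moreover have "entries_mod n test_prime A" if "map_mat residue A = 1\<^sub>m n" "A \<in> carrier_mat n n"
    for A :: "'a mat"
    unfolding entries_mod_def
  proof (intro allI impI)
    fix i j assume ij: "i < n" "j < n"
    have "residue (A $$ (i, j)) = map_mat residue A $$ (i, j)"
      using ij that(2) by simp
    also have "\<dots> = residue (1\<^sub>m n $$ (i, j))"
      using ij that(1) by simp
    finally have "residue ((A - 1\<^sub>m n) $$ (i, j)) = 0"
      using ij that(2) by (simp add: residue.hom_minus)
    then show "(A - 1\<^sub>m n) $$ (i, j) \<in> test_prime"
      by (simp add: residue_eq_0)
  qed
  ultimately show False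
    using N by (cases "deep_commutators n q") simp
qed

text \<open>In a long product either \<open>f\<close> occurs often enough to vanish, or enough
  factors from the smaller set remain; so the required lengths add up.\<close>

lemma nilpotent_products_vanish:
  fixes J :: "'a::comm_ring_1 set"
  assumes "finite J" "\<And>f. f \<in> J \<Longrightarrow> \<exists>k. f ^ k = 0"
  shows "\<exists>k. \<forall>xs. set xs \<subseteq> J \<and> k \<le> length xs \<longrightarrow> prod_list xs = 0"
  using assms
proof (induction J rule: finite_induct)
  case empty
  then show ?case by (intro exI[of _ 1]) auto
next
  case (insert f J)
  obtain k where k: "\<And>xs. set xs \<subseteq> J \<Longrightarrow> k \<le> length xs \<Longrightarrow> prod_list xs = 0"
    using insert by blast
  obtain e where e: "f ^ e = 0"
    using insert.prems by blast
  have split: "prod_list xs = f ^ length (filter (\<lambda>x. x = f) xs) * prod_list (filter (\<lambda>x. x \<noteq> f) xs)" for xs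
    by (induction xs) (auto simp: mult_ac)
  have "prod_list xs = 0" if xs: "set xs \<subseteq> insert f J" "e + k \<le> length xs" for xs
  proof (cases "e \<le> length (filter (\<lambda>x. x = f) xs)")
    case True
    then have "f ^ length (filter (\<lambda>x. x = f) xs) = 0"
      using e by (metis le_add_diff_inverse mult_zero_left power_add)
    then show ?thesis
      by (simp add: split[of xs])
  next
    case False
    then have "k \<le> length (filter (\<lambda>x. x \<noteq> f) xs)"
      using sum_length_filter_compl[of "\<lambda>x. x = f" xs] xs(2) by simp
    then have "prod_list (filter (\<lambda>x. x \<noteq> f) xs) = 0"
      using xs(1) by (intro k) auto
    then show ?thesis
      by (simp add: split[of xs])
  qed
  then show ?case
    by blast
qed

definition unit_mat :: "nat \<Rightarrow> nat \<Rightarrow> nat \<Rightarrow> 'a::comm_ring_1 mat" where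
  "unit_mat n i j = mat n n (\<lambda>p. if p = (i, j) then 1 else 0)"

lemma block_diag_decompose:
  assumes "n \<ge> 1" "A \<in> carrier_mat n n"
  shows "block_diag n A = (\<Sum>i<n. \<Sum>j<n. lin_scalar (A $$ (i, j)) * block_diag n (unit_mat n i j))"
proof (rule Rep_lin_inject[THEN iffD1], intro ext)
  fix v :: "nat \<Rightarrow> 'a" and k
  have k: "k mod n < n"
    using assms by simp
  have e: "(\<Sum>r<n. unit_mat n i j $$ (k mod n, r) * v (n * (k div n) + r)) =
      (if k mod n = i then 1 else 0) * v (n * (k div n) + j)" if "j < n" for i j
  proof -
    have "(\<Sum>r<n. unit_mat n i j $$ (k mod n, r) * v (n * (k div n) + r)) =
      (\<Sum>r<n. (if j = r then 1 else 0) * ((if k mod n = i then 1 else 0) * v (n * (k div n) + r)))"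
      using k by (intro sum.cong) (auto simp: unit_mat_def)
    then show ?thesis
      using that by (simp only: sum_delta_mult)
  qed
  have "Rep_lin (\<Sum>i<n. \<Sum>j<n. lin_scalar (A $$ (i, j)) * block_diag n (unit_mat n i j)) v k =
    (\<Sum>i<n. \<Sum>j<n. A $$ (i, j) * ((if k mod n = i then 1 else 0) * v (n * (k div n) + j)))"
    by (simp add: Rep_lin_sum times_lin.rep_eq lin_scalar.rep_eq block_diag.rep_eq e del: mult_eq_if)
  also have "\<dots> = (\<Sum>i<n. (if k mod n = i then 1 else 0) * (\<Sum>j<n. A $$ (i, j) * v (n * (k div n) + j)))"
    unfolding sum_distrib_left by (intro sum.cong refl mult.left_commute)
  also have "\<dots> = (\<Sum>j<n. A $$ (k mod n, j) * v (n * (k div n) + j))"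
    using k by (simp only: sum_delta_mult)
  finally show "Rep_lin (block_diag n A) v k =
    Rep_lin (\<Sum>i<n. \<Sum>j<n. lin_scalar (A $$ (i, j)) * block_diag n (unit_mat n i j)) v k"
    by (simp add: block_diag.rep_eq)
qed

text \<open>After the steps that suffice over fields, the entries differ from those of the identity
  by finitely many nilpotent elements. The ring is now filtered by how many of these occur in a
  product. Every further step doubles this number until \<open>nilpotent_products_vanish\<close>
  applies, so the total number of steps depends on the matrices.\<close>

theorem iterated_commutators_trivial:
  fixes q :: "'a::comm_ring_1 mat quad"
  assumes n: "n \<ge> 1" and D: "squaring_data n q h h'"
  shows "\<exists>k. quad_all (\<lambda>A. A = 1\<^sub>m n) ((dstep (*) ^^ k) (quad_map (\<lambda>A. A ^\<^sub>m mat_exp n) q))"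
proof -
  let ?B = "block_diag n :: 'a mat \<Rightarrow> 'a lin"
  have cq: "quad_all (\<lambda>A. A \<in> carrier_mat n n) q"
    by (rule squaring_data_carrier[OF D])
  note cp = quad_all_power[OF cq, of "mat_exp n"]
  obtain w1 w2 w3 w4 where w: "deep_commutators n q = (w1, w2, w3, w4)"
    by (cases "deep_commutators n q")
  have cw: "A \<in> carrier_mat n n" if "A \<in> {w1, w2, w3, w4}" for A
    using deep_commutators_carrier[OF cq] that unfolding w by auto
  define J where "J = (\<lambda>(A, i, j). (A - 1\<^sub>m n) $$ (i, j)) ` ({w1, w2, w3, w4} \<times> {..<n} \<times> {..<n})"
  have "finite J"
    unfolding J_def by (intro finite_imageI finite_cartesian_product) auto
  moreover have "\<exists>k. f ^ k = 0" if "f \<in> J" for f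
    using that deep_commutators_nilpotent[OF n D] unfolding J_def w entries_mod_def by auto
  ultimately obtain k where k: "\<And>xs. set xs \<subseteq> J \<Longrightarrow> k \<le> length xs \<Longrightarrow> prod_list xs = 0"
    using nilpotent_products_vanish[of J] by blast
  define S where "S l = {lin_scalar (prod_list xs) * y | xs y. set xs \<subseteq> J \<and> l \<le> length xs}" for l
  have S_I: "lin_scalar (prod_list xs) * y \<in> S l" if "set xs \<subseteq> J" "l \<le> length xs" for xs y l
    using that unfolding S_def by blast
  interpret ring_filtration "\<lambda>l. add_span (S l)"
  proof (rule ring_filtration_add_span)
    fix i j s t assume "s \<in> S i" "t \<in> S j"
    then obtain xs ys y z where st: "s = lin_scalar (prod_list xs) * y" "t = lin_scalar (prod_list ys) * z"
      "set xs \<subseteq> J" "set ys \<subseteq> J" "i \<le> length xs" "j \<le> length ys"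
      unfolding S_def by blast
    have "s * t = lin_scalar (prod_list xs) * (y * lin_scalar (prod_list ys)) * z"
      by (simp only: st mult.assoc)
    also have "\<dots> = lin_scalar (prod_list (xs @ ys)) * (y * z)"
      unfolding lin_scalar_comm[of "prod_list ys" y, symmetric]
      by (simp only: prod_list.append lin_scalar_simps mult.assoc)
    finally show "s * t \<in> S (i + j)"
      using S_I[of "xs @ ys" "i + j"] st by simp
  next
    show "S (Suc i) \<subseteq> S i" for i
    proof
      fix s assume "s \<in> S (Suc i)"
      then obtain xs y where "s = lin_scalar (prod_list xs) * y" "set xs \<subseteq> J" "i \<le> length xs"
        unfolding S_def using Suc_leD by blast
      then show "s \<in> S i"
        using S_I by blast
    qed
  qed
  have one: "?B (1\<^sub>m n) = 1"
    by (rule block_diag_one[OF n])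
  have S1: "?B A - 1 \<in> add_span (S 1)" if A: "A \<in> {w1, w2, w3, w4}" for A
  proof -
    define C where "C = A - 1\<^sub>m n"
    have C: "C \<in> carrier_mat n n"
      unfolding C_def by (rule minus_carrier_mat[OF one_carrier_mat])
    have AC: "A = C + 1\<^sub>m n"
      by (rule eq_matI) (use cw[OF A] in \<open>simp_all add: C_def\<close>)
    have "?B A - 1 = ?B C"
      unfolding AC block_diag_add[OF n C one_carrier_mat] one by simp
    moreover have "?B C \<in> add_span (S 1)"
      unfolding block_diag_decompose[OF n C]
    proof (intro add_span_sum add_span_base)
      fix i j assume ij: "i \<in> {..<n}" "j \<in> {..<n}"
      have "(A, i, j) \<in> {w1, w2, w3, w4} \<times> {..<n} \<times> {..<n}"
        using A ij by blast
      then have "C $$ (i, j) \<in> J"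
        unfolding J_def C_def by (rule rev_image_eqI) simp
      then show "lin_scalar (C $$ (i, j)) * block_diag n (unit_mat n i j) \<in> S 1"
        using S_I[of "[C $$ (i, j)]" 1] by simp
    qed
    ultimately show ?thesis
      by simp
  qed
  have "quad_inv (quad_map ?B (deep_commutators n q))"
  proof -
    obtain a a' b b' where q: "q = (a, a', b, b')"
      by (cases q)
    note D' = D[unfolded q squaring_data_def prod.case]
    have c: "a \<in> carrier_mat n n" "a' \<in> carrier_mat n n" "b \<in> carrier_mat n n" "b' \<in> carrier_mat n n"
      using D' by auto
    have rel: "?B x ^ m * ?B y ^ m = 1"
      if "x * y = 1\<^sub>m n" "x \<in> carrier_mat n n" "y \<in> carrier_mat n n" for x y m
    proof (induction m)
      case (Suc m)
      have "?B x ^ Suc m * ?B y ^ Suc m = ?B x ^ m * (?B x * ?B y) * ?B y ^ m"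
        by (simp only: power_Suc2[of "?B x"] power_Suc[of "?B y"] mult.assoc)
      also have "?B x * ?B y = 1"
        using that block_diag_mult[OF n that(2,3)] one by simp
      finally show ?case using Suc by simp
    qed simp
    have "quad_inv (quad_map ?B (quad_map (\<lambda>A. A ^\<^sub>m mat_exp n) q))"
      using D' c unfolding q quad_inv_def by (simp add: block_diag_power[OF n] rel)
    then show ?thesis
      unfolding deep_commutators_def dstep_block_diag[OF n cp] by (rule quad_inv_iter)
  qed
  moreover have "quad_all (\<lambda>x. x - 1 \<in> add_span (S 1)) (quad_map ?B (deep_commutators n q))"
    unfolding w using S1 by simp
  ultimately have *: "quad_all (\<lambda>x. x - 1 \<in> add_span (S (2 ^ k)))
      ((dstep (*) ^^ k) (quad_map ?B (deep_commutators n q)))"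
    by (rule dstep_iter)
  have "S (2 ^ k) \<subseteq> {0}"
  proof
    fix s assume "s \<in> S (2 ^ k)"
    then obtain xs y where xs: "s = lin_scalar (prod_list xs) * y" "set xs \<subseteq> J" "2 ^ k \<le> length xs"
      unfolding S_def by blast
    then have "prod_list xs = 0"
      using less_exp[of k] by (intro k) linarith+
    then show "s \<in> {0}"
      by (simp add: xs(1) lin_scalar_simps)
  qed
  then have "x = 1" if "x - 1 \<in> add_span (S (2 ^ k))" for x
  proof -
    have "v = 0" if "v \<in> add_span (S (2 ^ k))" for v
      using that by (induction v rule: add_span.induct) (use \<open>S (2 ^ k) \<subseteq> {0}\<close> in auto)
    from this[OF that] show ?thesis by simp
  qed
  with * have **: "quad_all (\<lambda>x. x = 1) ((dstep (*) ^^ k) (quad_map ?B (deep_commutators n q)))"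
    by (rule quad_all_mono[rotated])
  define u where "u = (dstep (*) ^^ (k + Suc (n * n))) (quad_map (\<lambda>A. A ^\<^sub>m mat_exp n) q)"
  have "u = (dstep (*) ^^ k) (deep_commutators n q)"
    unfolding u_def deep_commutators_def funpow_add comp_def ..
  then have "(dstep (*) ^^ k) (quad_map ?B (deep_commutators n q)) = quad_map ?B u"
    using dstep_block_diag[OF n deep_commutators_carrier[OF cq]] by simp
  then have B: "quad_all (\<lambda>A. ?B A = 1) u"
    using ** by (simp add: quad_all_map)
  have C: "quad_all (\<lambda>A. A \<in> carrier_mat n n) u"
    unfolding u_def by (rule dstep_closed[OF mult_carrier_mat cp])
  have inj: "A = 1\<^sub>m n" if "A \<in> carrier_mat n n" "?B A = 1" for A :: "'a mat"
    by (rule block_diag_inj[OF that(1) one_carrier_mat]) (simp add: that(2) one)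
  obtain u1 u2 u3 u4 where u: "u = (u1, u2, u3, u4)"
    by (cases u)
  have "quad_all (\<lambda>A. A = 1\<^sub>m n) u"
    using B C unfolding u quad_all_simp by (elim conjE) (intro conjI inj)
  then show ?thesis
    unfolding u_def by (rule exI)
qed

abbreviation const2 :: "'a::comm_ring_1 \<Rightarrow> 'a poly poly" where
  "const2 a \<equiv> [:[:a:]:]"

section \<open>Polynomial self-maps of the plane\<close>

text \<open>Additive and multiplicative identities, such as associativity of substitution and the
  chain rule, are thereby checked on constants and the two variables.\<close>

lemma poly2_induct [case_names const x y add mult]:
  fixes p :: "'a::comm_ring_1 poly poly"
  assumes "\<And>a. P (const2 a)" "P var_x" "P var_y"
    and add: "\<And>p q. P p \<Longrightarrow> P q \<Longrightarrow> P (p + q)" and mult: "\<And>p q. P p \<Longrightarrow> P q \<Longrightarrow> P (p * q)"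
  shows "P p"
proof (induction p)
  case 0
  show ?case using assms(1)[of 0] by simp
next
  case (pCons c p)
  have "P [:c:]"
  proof (induction c)
    case 0
    show ?case using assms(1)[of 0] by simp
  next
    case (pCons a c)
    have "[:pCons a c:] = const2 a + var_x * [:c:]"
      by simp
    then show ?case
      using add[OF assms(1) mult[OF assms(2) pCons(2)]] by metis
  qed
  moreover have "pCons c p = [:c:] + var_y * p"
    by simp
  ultimately show ?case
    using add mult assms(3) pCons by metis
qed

lemma smult_const_one [simp]: "smult [:1:] p = (p :: 'a::comm_ring_1 poly poly)"
  by (simp flip: one_pCons)

lemma poly_map_poly_hom:
  fixes f :: "'a::comm_ring_1 \<Rightarrow> 'b::comm_ring_1"
  assumes "f 0 = 0" "\<And>a b. f (a + b) = f a + f b" "\<And>a b. f (a * b) = f a * f b"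
  shows "poly (map_poly f (p + q)) z = poly (map_poly f p) z + poly (map_poly f q) z"
    and "poly (map_poly f (p * q)) z = poly (map_poly f p) z * poly (map_poly f q) z"
proof -
  have P: "map_poly f (pCons c p) = pCons (f c) (map_poly f p)" for c p
    using assms(1) by (rule map_poly_pCons)
  show add: "poly (map_poly f (p + q)) z = poly (map_poly f p) z + poly (map_poly f q) z" for p q
    by (induction p q rule: poly_induct2) (simp_all add: P assms(2) algebra_simps)
  have smult: "poly (map_poly f (smult c q)) z = f c * poly (map_poly f q) z" for c q
    by (induction q) (simp_all add: P assms algebra_simps)
  show "poly (map_poly f (p * q)) z = poly (map_poly f p) z * poly (map_poly f q) z"
    by (induction p) (simp_all add: P assms add smult algebra_simps)
qed

definition subst1 :: "'a::comm_ring_1 poly \<Rightarrow> 'a poly poly \<Rightarrow> 'a poly poly" where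
  "subst1 c q = poly (map_poly (\<lambda>a. [:[:a:]:]) c) q"

lemma subst1_simps [simp]:
  "subst1 0 q = 0" "subst1 (pCons a c) q = const2 a + q * subst1 c q"
  "subst1 (c + d) q = subst1 c q + subst1 d q" "subst1 (c * d) q = subst1 c q * subst1 d q"
  unfolding subst1_def by (simp_all add: map_poly_pCons poly_map_poly_hom)

lemma subst1_1 [simp]: "subst1 1 q = 1"
  by (simp add: one_pCons)

lemma subst2_subst1: "subst2 p q r = poly (map_poly (\<lambda>c. subst1 c q) p) r"
  by (simp add: subst2_def subst1_def)

lemma subst2_add [simp]: "subst2 (p + p') q r = subst2 p q r + subst2 p' q r"
  and subst2_mult [simp]: "subst2 (p * p') q r = subst2 p q r * subst2 p' q r"
  unfolding subst2_subst1 by (intro poly_map_poly_hom; simp)+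

lemma subst2_pCons [simp]: "subst2 (pCons c p) q r = subst1 c q + r * subst2 p q r"
  unfolding subst2_subst1 by (simp add: map_poly_pCons)

lemma subst2_0 [simp]: "subst2 0 q r = 0"
  unfolding subst2_subst1 by simp

lemma subst2_1 [simp]: "subst2 1 q r = 1"
  by (simp add: one_pCons)

lemma subst2_power [simp]: "subst2 (p ^ n) q r = subst2 p q r ^ n"
  by (induction n) simp_all

lemma subst2_uminus [simp]: "subst2 (- p) q r = - subst2 p q r"
  using subst2_add[of p "- p" q r] by (simp add: eq_neg_iff_add_eq_0 add.commute del: subst2_add)

lemma subst2_diff [simp]: "subst2 (p - p') q r = subst2 p q r - subst2 p' q r"
  using subst2_add[of p "- p'" q r] by simp

lemma subst2_assoc: "subst2 (subst2 p q r) s t = subst2 p (subst2 q s t) (subst2 r s t)"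
  by (induction p rule: poly2_induct) simp_all

lemma subst2_id [simp]: "subst2 p var_x var_y = p"
  by (induction p rule: poly2_induct) simp_all

lemma eval2_hom [simp]:
  "eval2 (p + q) a b = eval2 p a b + eval2 q a b" "eval2 (p * q) a b = eval2 p a b * eval2 q a b"
  "eval2 (const2 c) a b = c" "eval2 var_x a b = a" "eval2 var_y a b = b"
  by (simp_all add: eval2_def)

lemma eval2_subst2: "eval2 (subst2 p q r) a b = eval2 p (eval2 q a b) (eval2 r a b)"
proof (induction p rule: poly2_induct)
  case x
  then show ?case by (simp del: eval2_hom) (simp add: eval2_def)
next
  case y
  then show ?case by (simp del: eval2_hom) (simp add: eval2_def)
qed (simp_all add: eval2_def)

lemma deriv_x_add: "deriv_x (p + q) = deriv_x p + deriv_x q"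
  by (simp add: deriv_x_def poly_eq_iff coeff_map_poly pderiv_add)

lemma deriv_x_pCons: "deriv_x (pCons c p) = pCons (pderiv c) (deriv_x p)"
  by (simp add: deriv_x_def map_poly_pCons)

lemma deriv_x_0 [simp]: "deriv_x 0 = 0"
  by (simp add: deriv_x_def)

lemma deriv_x_smult: "deriv_x (smult c p) = smult (pderiv c) p + smult c (deriv_x p)"
  by (induction p) (simp_all add: deriv_x_pCons pderiv_mult algebra_simps)

lemma deriv_x_mult: "deriv_x (p * q) = deriv_x p * q + p * deriv_x q"
  by (induction p) (simp_all add: deriv_x_pCons deriv_x_add deriv_x_smult algebra_simps)

lemma deriv_y_add: "deriv_y (p + q) = deriv_y p + deriv_y q"
  by (simp add: deriv_y_def pderiv_add)

lemma deriv_y_mult: "deriv_y (p * q) = deriv_y p * q + p * deriv_y q"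
  by (simp add: deriv_y_def pderiv_mult algebra_simps)

lemma deriv_vars [simp]:
  "deriv_x (const2 a) = 0" "deriv_y (const2 a) = 0" "deriv_x var_x = 1" "deriv_y var_x = 0"
  "deriv_x var_y = 0" "deriv_y var_y = 1"
  by (simp_all add: deriv_x_pCons deriv_y_def pderiv_pCons one_pCons)

lemma deriv_x_subst2:
  "deriv_x (subst2 p q r) = subst2 (deriv_x p) q r * deriv_x q + subst2 (deriv_y p) q r * deriv_x r"
  by (induction p rule: poly2_induct)
    (simp_all add: deriv_x_add deriv_x_mult deriv_y_add deriv_y_mult algebra_simps)

lemma deriv_y_subst2:
  "deriv_y (subst2 p q r) = subst2 (deriv_x p) q r * deriv_y q + subst2 (deriv_y p) q r * deriv_y r"
  by (induction p rule: poly2_induct)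
    (simp_all add: deriv_x_add deriv_x_mult deriv_y_add deriv_y_mult algebra_simps)

lemma jacobian_comp:
  "jacobian (plane_comp \<phi> \<psi>) = subst2 (jacobian \<phi>) (fst \<psi>) (snd \<psi>) * jacobian \<psi>"
  by (simp add: jacobian_def plane_comp_def deriv_x_subst2 deriv_y_subst2 algebra_simps)

lemma jacobian_id [simp]: "jacobian plane_id = 1"
  by (simp add: jacobian_def plane_id_def)

lemma plane_comp_assoc: "plane_comp (plane_comp \<phi> \<psi>) \<chi> = plane_comp \<phi> (plane_comp \<psi> \<chi>)"
  by (simp add: plane_comp_def subst2_assoc)

lemma plane_comp_id [simp]: "plane_comp plane_id \<phi> = \<phi>" "plane_comp \<phi> plane_id = \<phi>"
  by (simp_all add: plane_comp_def plane_id_def)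

lemma plane_apply_comp: "plane_apply (plane_comp \<phi> \<psi>) = plane_apply \<phi> \<circ> plane_apply \<psi>"
  by (auto simp: fun_eq_iff plane_apply_def plane_comp_def eval2_subst2)

lemma plane_apply_id: "plane_apply plane_id = id"
  by (auto simp: fun_eq_iff plane_apply_def plane_id_def)

section \<open>Groups of plane automorphisms\<close>

definition plane_monoid :: "'a::field plane_map monoid" where
  "plane_monoid = \<lparr>carrier = UNIV, mult = plane_comp, one = plane_id\<rparr>"

lemma monoid_plane: "monoid (plane_monoid :: 'a::field plane_map monoid)"
  by unfold_locales (simp_all add: plane_monoid_def plane_comp_assoc)

lemma Aut_plane_simps [simp]:
  "mult Aut_plane = plane_comp" "one Aut_plane = plane_id"
  "mult Aut0_plane = plane_comp" "one Aut0_plane = plane_id"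
  "mult SAut0_plane = plane_comp" "one SAut0_plane = plane_id"
  by (simp_all add: Aut_plane_def Aut0_plane_def SAut0_plane_def units_of_def)

lemma carrier_Aut_plane:
  "\<phi> \<in> carrier Aut_plane \<longleftrightarrow> (\<exists>\<psi>. plane_comp \<psi> \<phi> = plane_id \<and> plane_comp \<phi> \<psi> = plane_id)"
  by (simp add: Aut_plane_def units_of_def Units_def)

lemma carrier_Aut0_plane:
  "\<phi> \<in> carrier Aut0_plane \<longleftrightarrow> \<phi> \<in> carrier Aut_plane \<and> plane_apply \<phi> (0, 0) = (0, 0)"
  by (simp add: Aut0_plane_def)

lemma carrier_SAut0_plane:
  "\<phi> \<in> carrier SAut0_plane \<longleftrightarrow> \<phi> \<in> carrier Aut0_plane \<and> jacobian \<phi> = 1"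
  by (simp add: SAut0_plane_def)

lemma group_Aut_plane: "group (Aut_plane :: 'a::field plane_map monoid)"
  unfolding Aut_plane_def using monoid.units_group[OF monoid_plane] by (simp add: plane_monoid_def)

lemma inv_Aut_plane:
  assumes "\<phi> \<in> carrier (Aut_plane :: 'a::field plane_map monoid)"
  shows "inv\<^bsub>Aut_plane\<^esub> \<phi> \<in> carrier Aut_plane" "plane_comp (inv\<^bsub>Aut_plane\<^esub> \<phi>) \<phi> = plane_id"
    "plane_comp \<phi> (inv\<^bsub>Aut_plane\<^esub> \<phi>) = plane_id"
  using group.inv_closed[OF group_Aut_plane assms] group.l_inv[OF group_Aut_plane assms]
    group.r_inv[OF group_Aut_plane assms] by simp_all

lemma group_Aut0_plane: "group (Aut0_plane :: 'a::field plane_map monoid)"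
proof -
  let ?H = "{\<phi> \<in> carrier (Aut_plane :: 'a plane_map monoid). plane_apply \<phi> (0, 0) = (0, 0)}"
  have "subgroup ?H Aut_plane"
  proof (rule group.subgroupI[OF group_Aut_plane])
    have "plane_id \<in> ?H"
      using monoid.one_closed[OF group.axioms(1)[OF group_Aut_plane]] by (simp add: plane_apply_id)
    then show "?H \<noteq> {}"
      by blast
    fix \<phi> assume \<phi>: "\<phi> \<in> ?H"
    then have c: "\<phi> \<in> carrier Aut_plane"
      by simp
    have "plane_apply (inv\<^bsub>Aut_plane\<^esub> \<phi>) (plane_apply \<phi> (0, 0)) = (0, 0)"
      using inv_Aut_plane(2)[of \<phi>] \<phi> plane_apply_comp[of "inv\<^bsub>Aut_plane\<^esub> \<phi>" \<phi>] plane_apply_id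
      by (metis (no_types, lifting) comp_apply id_apply mem_Collect_eq)
    then show "inv\<^bsub>Aut_plane\<^esub> \<phi> \<in> ?H"
      using inv_Aut_plane(1)[OF c] \<phi> by simp
    fix \<psi> assume "\<psi> \<in> ?H"
    then show "\<phi> \<otimes>\<^bsub>Aut_plane\<^esub> \<psi> \<in> ?H"
      using \<phi> monoid.m_closed[OF group.axioms(1)[OF group_Aut_plane], of \<phi> \<psi>] by (simp add: plane_apply_comp)
  qed auto
  then show ?thesis
    unfolding Aut0_plane_def by (rule subgroup.subgroup_is_group[OF _ group_Aut_plane])
qed

lemma group_SAut0_plane: "group (SAut0_plane :: 'a::field plane_map monoid)"
proof -
  let ?H = "{\<phi> \<in> carrier (Aut0_plane :: 'a plane_map monoid). jacobian \<phi> = 1}"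
  note gr = group_Aut0_plane[where 'a = 'a]
  have "subgroup ?H Aut0_plane"
  proof (rule group.subgroupI[OF gr])
    have "plane_id \<in> ?H"
      using monoid.one_closed[OF group.axioms(1)[OF gr]] by simp
    then show "?H \<noteq> {}"
      by blast
    fix \<phi> assume \<phi>: "\<phi> \<in> ?H"
    then have c: "\<phi> \<in> carrier Aut0_plane" and j: "jacobian \<phi> = 1"
      by auto
    let ?i = "inv\<^bsub>Aut0_plane\<^esub> \<phi>"
    have l: "plane_comp ?i \<phi> = plane_id" and r: "plane_comp \<phi> ?i = plane_id"
      using group.l_inv[OF gr c] group.r_inv[OF gr c] by simp_all
    have "subst2 1 (fst ?i) (snd ?i) * jacobian ?i = 1"
      using jacobian_comp[of \<phi> ?i] unfolding j r by simp
    then show "?i \<in> ?H"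
      using group.inv_closed[OF gr c] by (simp add: carrier_Aut0_plane)
    fix \<psi> assume "\<psi> \<in> ?H"
    then show "\<phi> \<otimes>\<^bsub>Aut0_plane\<^esub> \<psi> \<in> ?H"
      using \<phi> monoid.m_closed[OF group.axioms(1)[OF gr], of \<phi> \<psi>] by (simp add: jacobian_comp)
  qed auto
  then show ?thesis
    unfolding SAut0_plane_def by (rule subgroup.subgroup_is_group[OF _ gr])
qed

datatype 'r with_int = With_int 'r int

text \<open>Adjoining a factor \<open>int\<close> makes any commutative ring, the zero ring included, an instance of
  the class \<open>comm_ring_1\<close>, which requires \<open>0 \<noteq> 1\<close>.\<close>

instantiation with_int :: ("{comm_ring, comm_monoid_mult}") comm_ring_1
begin

definition "0 = With_int 0 0"
definition "1 = With_int 1 1"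
fun plus_with_int where "plus_with_int (With_int x i) (With_int y j) = With_int (x + y) (i + j)"
fun minus_with_int where "minus_with_int (With_int x i) (With_int y j) = With_int (x - y) (i - j)"
fun times_with_int where "times_with_int (With_int x i) (With_int y j) = With_int (x * y) (i * j)"
fun uminus_with_int where "uminus_with_int (With_int x i) = With_int (- x) (- i)"

instance
proof
  fix a b c :: "'a with_int"
  show "a + b + c = a + (b + c)" "a * b * c = a * (b * c)" "(a + b) * c = a * c + b * c"
    by (cases a; cases b; cases c; simp add: algebra_simps)+
  show "a + b = b + a" "a * b = b * a" "a - b = a + - b"
    by (cases a; cases b; simp add: algebra_simps)+
  show "0 + a = a" "1 * a = a" "- a + a = 0"
    by (cases a; simp add: zero_with_int_def one_with_int_def)+
  show "(0 :: 'a with_int) \<noteq> 1"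
    by (simp add: zero_with_int_def one_with_int_def)
qed

end

text \<open>The integer component is the identity matrix for every \<open>A\<close>, which makes the
  map multiplicative and unital.\<close>

definition mat_with_int :: "nat \<Rightarrow> 'r::{comm_ring, comm_monoid_mult} mat \<Rightarrow> 'r with_int mat" where
  "mat_with_int n A = mat n n (\<lambda>(i, j). With_int (A $$ (i, j)) (if i = j then 1 else 0))"

lemma mat_with_int_carrier [simp]: "mat_with_int n A \<in> carrier_mat n n"
  by (simp add: mat_with_int_def)

lemma sum_With_int: "(\<Sum>k\<in>I. With_int (f k) (g k)) = With_int (sum f I) (sum g I)"
  by (induction I rule: infinite_finite_induct) (simp_all add: zero_with_int_def)

lemma mat_with_int_mult:
  assumes "A \<in> carrier_mat n n" "B \<in> carrier_mat n n"
  shows "mat_with_int n (A * B) = mat_with_int n A * mat_with_int n B"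
proof (rule eq_matI)
  fix i j assume "i < dim_row (mat_with_int n A * mat_with_int n B)"
    "j < dim_col (mat_with_int n A * mat_with_int n B)"
  then have ij: "i < n" "j < n"
    by (simp_all add: mat_with_int_def)
  have "(\<Sum>k = 0..<n. (if i = k then 1 else 0) * (if k = j then 1 else 0 :: int)) = (if i = j then 1 else 0)"
    using ij by (subst sum.remove[of _ i]) (auto intro!: sum.neutral)
  then show "mat_with_int n (A * B) $$ (i, j) = (mat_with_int n A * mat_with_int n B) $$ (i, j)"
    using assms ij by (simp add: mat_with_int_def scalar_prod_def sum_With_int)
qed (simp_all add: mat_with_int_def)

lemma mat_with_int_inj:
  assumes "A \<in> carrier_mat n n" "B \<in> carrier_mat n n" "mat_with_int n A = mat_with_int n B"
  shows "A = B"
proof (rule eq_matI)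
  fix i j assume "i < dim_row B" "j < dim_col B"
  then have ij: "i < n" "j < n"
    using assms(2) by auto
  have "mat_with_int n A $$ (i, j) = mat_with_int n B $$ (i, j)"
    using assms(3) by simp
  then show "A $$ (i, j) = B $$ (i, j)"
    using ij by (simp add: mat_with_int_def)
qed (use assms in auto)

lemma mat_with_int_one: "mat_with_int n (1\<^sub>m n) = 1\<^sub>m n"
  by (rule eq_matI) (auto simp: mat_with_int_def one_with_int_def zero_with_int_def)

section \<open>The group generated by \<open>S\<close> and \<open>T\<close>\<close>

definition lower_map :: "'a::field \<Rightarrow> 'a plane_map" where
  "lower_map c = (var_x, var_y + const2 c * var_x\<^sup>2)"

text \<open>The half comes from conjugation by \<open>S_map\<close>: with this normalisation
  \<open>upper_map c\<close> is the conjugate of \<open>lower_map c\<close> for the same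
  \<open>c\<close>.\<close>

definition upper_map :: "'a::field \<Rightarrow> 'a plane_map" where
  "upper_map c = (var_x + const2 (c / 2) * var_y\<^sup>2, var_y)"

definition scale_map :: "'a::field \<Rightarrow> 'a plane_map" where
  "scale_map c = (const2 c * var_x, const2 c * var_y)"

definition S_inv :: "'a::field plane_map" where
  "S_inv = (const2 (1 / 2) * var_y, var_x)"

lemma plane_maps_comp:
  "plane_comp (lower_map c) (lower_map d) = lower_map (c + d)"
  "plane_comp (upper_map c) (upper_map d) = upper_map (c + d)"
  "plane_comp (scale_map c) (scale_map d) = scale_map (c * d)"
  by (simp_all add: plane_comp_def lower_map_def upper_map_def scale_map_def power2_eq_square add_divide_distrib)

lemma plane_maps_id: "lower_map 0 = plane_id" "upper_map 0 = plane_id" "scale_map 1 = plane_id"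
  by (simp_all add: plane_id_def lower_map_def upper_map_def scale_map_def)

text \<open>This is the relation required by \<open>squaring_data\<close>, with the square of
  \<open>S_map\<close> as the conjugating element: the quadratic term scales by 2 relative to the
  linear one.\<close>

lemma lower_scale:
  "plane_comp (lower_map c) (scale_map 2) = plane_comp (scale_map 2) (plane_comp (lower_map c) (lower_map c))"
  by (simp add: plane_comp_def lower_map_def scale_map_def power2_eq_square)

lemma upper_scale:
  fixes c :: "'a::field_char_0"
  shows "plane_comp (upper_map c) (scale_map 2) = plane_comp (scale_map 2) (plane_comp (upper_map c) (upper_map c))"
  by (simp add: plane_comp_def upper_map_def scale_map_def power2_eq_square)

lemma S_map_relations:
  "plane_comp S_map S_map = scale_map 2" "plane_comp S_map S_inv = (plane_id :: 'a::field_char_0 plane_map)"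
  "plane_comp S_inv S_map = (plane_id :: 'a::field_char_0 plane_map)"
  "plane_comp S_inv (plane_comp T_map S_map) = (upper_map 1 :: 'a::field_char_0 plane_map)"
  by (simp_all add: plane_comp_def S_map_def S_inv_def T_map_def upper_map_def scale_map_def plane_id_def
     power2_eq_square numeral_poly one_pCons)

lemma T_map_lower: "T_map = lower_map 1"
  by (simp add: T_map_def lower_map_def)

lemma plane_apply_maps:
  "plane_apply (lower_map c) (x, y) = (x, y + c * x\<^sup>2)" "plane_apply (upper_map c) (x, y) = (x + c / 2 * y\<^sup>2, y)"
  "plane_apply (scale_map c) (x, y) = (c * x, c * y)" "plane_apply S_map (x, y) = (y, 2 * x)"
  "plane_apply S_inv (x, y) = (y / 2, x)"
  by (simp_all add: plane_apply_def lower_map_def upper_map_def scale_map_def S_map_def S_inv_def eval2_def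
     power2_eq_square numeral_poly)

lemma prod_two_powers_pos: "(\<Prod>j=1..e. (2::nat) ^ j - 1) > 0"
proof (rule prod_pos)
  fix j :: nat assume "j \<in> {1..e}"
  then have "(2::nat) ^ 1 \<le> 2 ^ j"
    by (intro power_increasing) auto
  then show "0 < (2::nat) ^ j - 1"
    by simp
qed

lemma good_exp_pos: "good_exp d > 0"
  using prod_two_powers_pos by (simp add: good_exp_def)

lemma root_exp_pos: "root_exp d > 0"
  using prod_two_powers_pos by (simp add: root_exp_def)

text \<open>Evenness clears the denominator in \<open>upper_map\<close>, so that integral points
  stay integral; the factor 2 in \<open>good_exp\<close> provides it.\<close>

lemma mat_exp_even_pos:
  assumes "n \<ge> 1"
  obtains m where "mat_exp n = 2 * m" "m > 0"
proof -
  have "even (good_exp (n * n) ^ (n * n))"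
    using assms by (simp add: good_exp_def)
  then have "even (mat_exp n)"
    by (simp add: mat_exp_def unipotent_exp_def)
  moreover have "mat_exp n > 0"
    using good_exp_pos root_exp_pos by (simp add: mat_exp_def unipotent_exp_def)
  ultimately show thesis
    using that by (auto elim!: evenE)
qed

text \<open>The field carries no order, so the ping-pong is played on integral points, which embed
  faithfully in characteristic zero. The bound 3 lets the quadratic term outweigh both
  coordinates.\<close>

definition steep :: "('a::field_char_0 \<times> 'a) set" where
  "steep = {(of_int x, of_int y) | x y. \<bar>x\<bar> < \<bar>y\<bar> \<and> 3 \<le> \<bar>x\<bar>}"

definition flat :: "('a::field_char_0 \<times> 'a) set" where
  "flat = {(of_int x, of_int y) | x y. \<bar>y\<bar> < \<bar>x\<bar> \<and> 3 \<le> \<bar>y\<bar>}"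

lemma square_dominates:
  fixes x y c :: int
  assumes "\<bar>y\<bar> < \<bar>x\<bar>" "3 \<le> \<bar>x\<bar>" "c \<noteq> 0"
  shows "\<bar>x\<bar> < \<bar>y + c * x\<^sup>2\<bar>"
proof -
  have "3 * \<bar>x\<bar> \<le> \<bar>x\<bar> * \<bar>x\<bar>"
    using assms(2) by (intro mult_right_mono) auto
  also have "\<dots> \<le> \<bar>c\<bar> * (\<bar>x\<bar> * \<bar>x\<bar>)"
    using assms(3) mult_right_mono[of 1 "\<bar>c\<bar>" "\<bar>x\<bar> * \<bar>x\<bar>"] by simp
  also have "\<dots> = \<bar>c * x\<^sup>2\<bar>"
    by (simp add: abs_mult power2_eq_square)
  finally show ?thesis
    using assms(1,2) by linarith
qed

lemma plane_apply_lower_power: "(plane_apply (lower_map c) ^^ k) (x, y) = (x, y + of_nat k * c * x\<^sup>2)"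
  by (induction k) (simp_all add: plane_apply_maps algebra_simps)

lemma plane_apply_upper_power: "(plane_apply (upper_map c) ^^ k) (x, y) = (x + of_nat k * c / 2 * y\<^sup>2, y)"
  by (induction k) (simp_all add: plane_apply_maps field_simps)

lemma pingpong_maps:
  assumes "m > 0"
  shows "pingpong steep flat (quad_map plane_apply
    (lower_map (of_int (2 * m)), lower_map (of_int (2 * - m)),
     upper_map (of_int (2 * m)), upper_map (of_int (2 * - m)) :: 'a::field_char_0 plane_map))"
proof -
  have inv: "plane_apply (lower_map c) \<circ> plane_apply (lower_map d) = id"
    "plane_apply (upper_map c) \<circ> plane_apply (upper_map d) = id" if "c + d = (0 :: 'a)" for c d
    using that unfolding plane_apply_comp[symmetric] plane_maps_comp by (simp_all add: plane_maps_id plane_apply_id)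
  have low: "(plane_apply (lower_map (of_int (2 * l))) ^^ k) ` flat \<subseteq> (steep :: ('a \<times> 'a) set)"
    if "k \<ge> 1" "l \<noteq> 0" for k l
  proof
    fix p assume "p \<in> (plane_apply (lower_map (of_int (2 * l))) ^^ k) ` (flat :: ('a \<times> 'a) set)"
    then obtain x y where xy: "\<bar>y\<bar> < \<bar>x\<bar>" "3 \<le> \<bar>y\<bar>"
      "p = (plane_apply (lower_map (of_int (2 * l))) ^^ k) (of_int x, of_int y)"
      unfolding flat_def by blast
    have "p = (of_int x, of_int (y + (int k * (2 * l)) * x\<^sup>2))"
      unfolding xy(3) plane_apply_lower_power by simp
    moreover have "\<bar>x\<bar> < \<bar>y + (int k * (2 * l)) * x\<^sup>2\<bar>"
      using xy that by (intro square_dominates) auto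
    ultimately show "p \<in> steep"
      using xy(1,2) unfolding steep_def
      by (intro CollectI exI[of _ x] exI[of _ "y + (int k * (2 * l)) * x\<^sup>2"] conjI) linarith+
  qed
  have up: "(plane_apply (upper_map (of_int (2 * l))) ^^ k) ` steep \<subseteq> (flat :: ('a \<times> 'a) set)"
    if "k \<ge> 1" "l \<noteq> 0" for k l
  proof
    fix p assume "p \<in> (plane_apply (upper_map (of_int (2 * l))) ^^ k) ` (steep :: ('a \<times> 'a) set)"
    then obtain x y where xy: "\<bar>x\<bar> < \<bar>y\<bar>" "3 \<le> \<bar>x\<bar>"
      "p = (plane_apply (upper_map (of_int (2 * l))) ^^ k) (of_int x, of_int y)"
      unfolding steep_def by blast
    have "p = (of_int (x + (int k * l) * y\<^sup>2), of_int y)"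
      unfolding xy(3) plane_apply_upper_power by simp
    moreover have "\<bar>y\<bar> < \<bar>x + (int k * l) * y\<^sup>2\<bar>"
      using xy that by (intro square_dominates) auto
    ultimately show "p \<in> flat"
      using xy(1,2) unfolding flat_def
      by (intro CollectI exI[of _ y] exI[of _ "x + (int k * l) * y\<^sup>2"] conjI) linarith+
  qed
  show ?thesis
    unfolding pingpong_def quad_map_simp prod.case
    by (intro conjI allI impI inv low up) (use assms in simp_all)
qed

lemma steep_flat: "(steep :: ('a::field_char_0 \<times> 'a) set) \<inter> flat = {}" "(flat :: ('a::field_char_0 \<times> 'a) set) \<noteq> {}"
proof -
  show "(steep :: ('a::field_char_0 \<times> 'a) set) \<inter> flat = {}"
    by (auto simp: steep_def flat_def)
  have "(of_int 4, of_int 3) \<in> (flat :: ('a \<times> 'a) set)"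
    unfolding flat_def by (intro CollectI exI[of _ 4] exI[of _ 3]) auto
  then show "(flat :: ('a::field_char_0 \<times> 'a) set) \<noteq> {}"
    by blast
qed

lemma plane_maps_Aut0:
  fixes c :: "'a::field_char_0"
  shows "lower_map c \<in> carrier Aut0_plane" "upper_map c \<in> carrier Aut0_plane"
    "c \<noteq> 0 \<Longrightarrow> scale_map c \<in> carrier Aut0_plane" "S_map \<in> carrier (Aut0_plane :: 'a plane_map monoid)"
proof -
  show "lower_map c \<in> carrier Aut0_plane"
    unfolding carrier_Aut0_plane carrier_Aut_plane
    by (intro conjI exI[of _ "lower_map (- c)"]) (simp_all add: plane_maps_comp plane_maps_id plane_apply_maps)
  show "upper_map c \<in> carrier Aut0_plane"
    unfolding carrier_Aut0_plane carrier_Aut_plane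
    by (intro conjI exI[of _ "upper_map (- c)"]) (simp_all add: plane_maps_comp plane_maps_id plane_apply_maps)
  show "scale_map c \<in> carrier Aut0_plane" if "c \<noteq> 0"
    unfolding carrier_Aut0_plane carrier_Aut_plane using that
    by (intro conjI exI[of _ "scale_map (inverse c)"]) (simp_all add: plane_maps_comp plane_maps_id plane_apply_maps)
  show "S_map \<in> carrier (Aut0_plane :: 'a plane_map monoid)"
    unfolding carrier_Aut0_plane carrier_Aut_plane
    by (intro conjI exI[of _ S_inv]) (simp_all add: S_map_relations plane_apply_maps)
qed

lemma inv_Aut0_plane:
  fixes \<phi> :: "'a::field_char_0 plane_map"
  assumes "\<phi> \<in> carrier Aut0_plane" "\<psi> \<in> carrier Aut0_plane" "plane_comp \<psi> \<phi> = plane_id"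
  shows "inv\<^bsub>Aut0_plane\<^esub> \<phi> = \<psi>"
  using group.inv_equality[OF group_Aut0_plane, of \<psi> \<phi>] assms by simp

theorem not_linear_S_T:
  "\<not> linear_over TYPE('r::{comm_ring, comm_monoid_mult})
     (subgroup_generated Aut0_plane {S_map, T_map} :: 'a::field_char_0 plane_map monoid)"
proof
  let ?\<Gamma> = "subgroup_generated Aut0_plane {S_map, T_map} :: 'a plane_map monoid"
  assume "linear_over TYPE('r) ?\<Gamma>"
  then obtain n and \<theta> :: "'a plane_map \<Rightarrow> 'r mat" where n: "n \<ge> 1" and \<theta>: "\<theta> \<in> mon ?\<Gamma> (GL n)"
    unfolding linear_over_def by blast
  define A where "A = (Aut0_plane :: 'a plane_map monoid)"
  define C where "C = generate A {S_map, T_map}"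
  have ST: "S_map \<in> carrier A" "T_map \<in> carrier A"
    unfolding A_def T_map_lower by (rule plane_maps_Aut0)+
  then have "carrier A \<inter> {S_map, T_map} = {S_map, T_map}"
    by blast
  then have carr: "carrier ?\<Gamma> = C"
    unfolding carrier_subgroup_generated C_def A_def by simp
  have CA: "C \<subseteq> carrier A"
    unfolding C_def using group.generate_incl[OF group_Aut0_plane, of "{S_map, T_map}"] ST
    unfolding A_def by blast
  have C_comp: "plane_comp \<phi> \<psi> \<in> C" if "\<phi> \<in> C" "\<psi> \<in> C" for \<phi> \<psi>
    using generate.eng[of \<phi> A _ \<psi>] that unfolding C_def by (simp add: A_def)
  have C_id: "plane_id \<in> C"
    using generate.one[of A] unfolding C_def by (simp add: A_def)
  have C_S: "S_map \<in> C" "T_map \<in> C"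
    unfolding C_def by (auto intro: generate.incl)
  have C_Sinv: "S_inv \<in> C" and C_Tinv: "lower_map (- 1) \<in> C"
  proof -
    have Si: "S_inv \<in> carrier A"
      unfolding A_def carrier_Aut0_plane carrier_Aut_plane
      by (intro conjI exI[of _ S_map]) (simp_all add: S_map_relations plane_apply_maps)
    have "inv\<^bsub>A\<^esub> S_map = S_inv"
      using inv_Aut0_plane[of S_map S_inv] ST Si unfolding A_def by (simp add: S_map_relations)
    moreover have "inv\<^bsub>A\<^esub> S_map \<in> C"
      unfolding C_def by (rule generate.inv) simp
    ultimately show "S_inv \<in> C" by simp
    have "inv\<^bsub>A\<^esub> T_map = lower_map (- 1)"
      unfolding A_def T_map_lower
      by (rule inv_Aut0_plane[OF plane_maps_Aut0(1) plane_maps_Aut0(1)]) (simp add: plane_maps_comp plane_maps_id)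
    moreover have "inv\<^bsub>A\<^esub> T_map \<in> C"
      unfolding C_def by (rule generate.inv) simp
    ultimately show "lower_map (- 1) \<in> C" by simp
  qed
  have upper_conj: "upper_map c = plane_comp S_inv (plane_comp (lower_map c) S_map)" for c :: 'a
    by (simp add: plane_comp_def S_map_def S_inv_def lower_map_def upper_map_def power2_eq_square numeral_poly)
  have scale_half: "scale_map (1 / 2) = plane_comp S_inv (S_inv :: 'a plane_map)"
    by (simp add: plane_comp_def S_inv_def scale_map_def)
  have lower_C: "lower_map (of_int k) \<in> C" for k
  proof -
    have nat: "lower_map (of_nat m) \<in> C \<and> lower_map (- of_nat m) \<in> C" for m
    proof (induction m)
      case 0
      show ?case using C_id by (simp add: plane_maps_id)
    next
      case (Suc m)
      then show ?case
        using C_comp[OF C_S(2), of "lower_map (of_nat m)"] C_comp[OF C_Tinv, of "lower_map (- of_nat m)"]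
        by (simp add: T_map_lower plane_maps_comp)
    qed
    show ?thesis
      by (cases k rule: int_cases2) (use nat in auto)
  qed
  then have upper_C: "upper_map (of_int k) \<in> C" for k
    unfolding upper_conj using C_comp C_S C_Sinv by blast
  have scale_C: "scale_map 2 \<in> C" "scale_map (1 / 2) \<in> C"
    unfolding scale_half S_map_relations(1)[symmetric] using C_comp C_S C_Sinv by blast+
  have hom: "\<theta> \<in> hom ?\<Gamma> (GL n)" and inj: "inj_on \<theta> C"
    using \<theta> carr unfolding mon_def by auto
  have \<theta>_GL: "\<theta> \<phi> \<in> carrier (GL n)" if "\<phi> \<in> C" for \<phi>
    using hom that carr unfolding hom_def by auto
  then have \<theta>_carrier: "\<theta> \<phi> \<in> carrier_mat n n" if "\<phi> \<in> C" for \<phi>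
    using that unfolding GL_def units_of_def Units_def by auto
  have \<theta>_mult: "\<theta> (plane_comp \<phi> \<psi>) = \<theta> \<phi> * \<theta> \<psi>" if "\<phi> \<in> C" "\<psi> \<in> C" for \<phi> \<psi>
    using hom that carr unfolding hom_def by (auto simp: GL_def units_of_def)
  \<comment> \<open>The passage to \<open>with_int\<close> turns the arbitrary ring into one of
    class \<open>comm_ring_1\<close>, to which the results on matrices apply.\<close>
  define \<psi> where "\<psi> \<phi> = mat_with_int n (\<theta> \<phi>)" for \<phi>
  have \<psi>_carrier [simp]: "\<psi> \<phi> \<in> carrier_mat n n" for \<phi>
    by (simp add: \<psi>_def)
  have \<psi>_mult: "\<psi> (plane_comp f g) = \<psi> f * \<psi> g" if "f \<in> C" "g \<in> C" for f g
    unfolding \<psi>_def \<theta>_mult[OF that] by (rule mat_with_int_mult[OF \<theta>_carrier[OF that(1)] \<theta>_carrier[OF that(2)]])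
  have \<psi>_inj: "f = g" if "f \<in> C" "g \<in> C" "\<psi> f = \<psi> g" for f g
  proof -
    have "\<theta> f = \<theta> g"
      by (rule mat_with_int_inj[OF \<theta>_carrier[OF that(1)] \<theta>_carrier[OF that(2)]])
        (use that(3) in \<open>simp add: \<psi>_def\<close>)
    then show ?thesis
      using inj that by (auto dest: inj_onD)
  qed
  \<comment> \<open>The image of the identity is idempotent, and membership in \<open>GL n\<close>
    supplies a right inverse; so it is the identity matrix.\<close>
  have \<psi>_id: "\<psi> plane_id = 1\<^sub>m n"
  proof -
    obtain F where F: "F \<in> carrier_mat n n" "\<theta> plane_id * F = 1\<^sub>m n"
      using \<theta>_GL[OF C_id] unfolding GL_def units_of_def Units_def by auto
    then have i: "\<psi> plane_id * mat_with_int n F = 1\<^sub>m n"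
      unfolding \<psi>_def by (simp add: mat_with_int_mult[OF \<theta>_carrier[OF C_id] F(1), symmetric] mat_with_int_one)
    have "\<psi> plane_id * \<psi> plane_id = \<psi> plane_id"
      using \<psi>_mult[OF C_id C_id] by simp
    then have "\<psi> plane_id * (\<psi> plane_id * mat_with_int n F) = \<psi> plane_id * mat_with_int n F"
      by (metis assoc_mult_mat \<psi>_carrier mat_with_int_carrier)
    then show ?thesis
      unfolding i by (simp add: right_mult_one_mat[OF \<psi>_carrier])
  qed
  have lower_C1: "lower_map 1 \<in> C" "lower_map (- 1) \<in> C" "upper_map 1 \<in> C" "upper_map (- 1) \<in> C"
    using lower_C[of 1] lower_C[of "- 1"] upper_C[of 1] upper_C[of "- 1"] by simp_all
  let ?Q = "\<lambda>c. (lower_map c, lower_map (- c), upper_map c, upper_map (- c)) :: 'a plane_map quad"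
  have inv: "\<psi> f * \<psi> g = 1\<^sub>m n" if "f \<in> C" "g \<in> C" "plane_comp f g = plane_id" for f g
    using \<psi>_mult[OF that(1,2)] that(3) \<psi>_id by simp
  have sq: "\<psi> f * \<psi> s = \<psi> s * (\<psi> f * \<psi> f)" if "f \<in> C" "s \<in> C"
    "plane_comp f s = plane_comp s (plane_comp f f)" for f s
    using that C_comp by (simp flip: \<psi>_mult)
  have D: "squaring_data n (quad_map \<psi> (?Q 1)) (\<psi> (scale_map 2)) (\<psi> (scale_map (1 / 2)))"
    unfolding squaring_data_def quad_map_simp prod.case
    by (intro conjI inv sq lower_C1 scale_C lower_scale upper_scale)
      (simp_all add: plane_maps_comp plane_maps_id)
  obtain k where k: "quad_all (\<lambda>A. A = 1\<^sub>m n)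
      ((dstep (*) ^^ k) (quad_map (\<lambda>A. A ^\<^sub>m mat_exp n) (quad_map \<psi> (?Q 1))))"
    using iterated_commutators_trivial[OF n D] by blast
  obtain m where m: "mat_exp n = 2 * m" "m > 0"
    using mat_exp_even_pos[OF n] by blast
  have pow: "\<psi> (lower_map (of_int e * of_nat j)) = \<psi> (lower_map (of_int e)) ^\<^sub>m j"
    "\<psi> (upper_map (of_int e * of_nat j)) = \<psi> (upper_map (of_int e)) ^\<^sub>m j" for e j
  proof -
    show "\<psi> (lower_map (of_int e * of_nat j)) = \<psi> (lower_map (of_int e)) ^\<^sub>m j"
    proof (induction j)
      case 0
      show ?case by (simp add: plane_maps_id \<psi>_id carrier_matD(1)[OF \<psi>_carrier])
    next
      case (Suc j)
      have "lower_map (of_int e * of_nat (Suc j)) = plane_comp (lower_map (of_int e * of_nat j)) (lower_map (of_int e :: 'a))"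
        by (simp add: plane_maps_comp algebra_simps)
      then show ?case
        using \<psi>_mult[OF lower_C[of "e * int j"] lower_C[of e]] Suc by simp
    qed
    show "\<psi> (upper_map (of_int e * of_nat j)) = \<psi> (upper_map (of_int e)) ^\<^sub>m j"
    proof (induction j)
      case 0
      show ?case by (simp add: plane_maps_id \<psi>_id carrier_matD(1)[OF \<psi>_carrier])
    next
      case (Suc j)
      have "upper_map (of_int e * of_nat (Suc j)) = plane_comp (upper_map (of_int e * of_nat j)) (upper_map (of_int e :: 'a))"
        by (simp add: plane_maps_comp algebra_simps)
      then show ?case
        using \<psi>_mult[OF upper_C[of "e * int j"] upper_C[of e]] Suc by simp
    qed
  qed
  \<comment> \<open>Powers of the matrices correspond to multiples of the parameter, and the
    exponent \<open>mat_exp n\<close> is \<open>2 * m\<close>.\<close>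
  let ?c = "of_int (2 * int m) :: 'a"
  have Q: "quad_map (\<lambda>A. A ^\<^sub>m mat_exp n) (quad_map \<psi> (?Q 1)) = quad_map \<psi> (?Q ?c)"
    using pow[of 1 "mat_exp n"] pow[of "- 1" "mat_exp n"] m(1) by simp
  have QC: "quad_all (\<lambda>f. f \<in> C) (?Q ?c)"
    using lower_C[of "2 * int m"] lower_C[of "- (2 * int m)"] upper_C[of "2 * int m"] upper_C[of "- (2 * int m)"]
    by simp
  define w where "w = (dstep plane_comp ^^ k) (?Q ?c)"
  have E: "quad_map \<psi> w = (dstep (*) ^^ k) (quad_map \<psi> (?Q ?c))"
    unfolding w_def by (rule dstep_hom[of C plane_comp \<psi> "(*)", OF C_comp \<psi>_mult QC])
  have "quad_all (\<lambda>f. \<psi> f = 1\<^sub>m n) w"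
    using k unfolding Q E[symmetric] quad_all_map .
  moreover have "quad_all (\<lambda>f. f \<in> C) w"
    unfolding w_def by (rule dstep_closed[OF C_comp QC])
  ultimately have "fst w = plane_id"
    using \<psi>_inj[OF _ C_id] \<psi>_id by (cases w) auto
  moreover have "quad_map plane_apply w = (dstep (\<circ>) ^^ k) (quad_map plane_apply (?Q ?c))"
    unfolding w_def by (rule dstep_hom[of UNIV]) (simp_all add: plane_apply_comp quad_all_def split: prod.split)
  moreover have "fst (quad_map plane_apply w) = plane_apply (fst w)"
    by (cases w) simp
  ultimately have "fst ((dstep (\<circ>) ^^ k) (quad_map plane_apply (?Q ?c))) = id"
    by (simp add: plane_apply_id)
  moreover have "pingpong steep flat (quad_map plane_apply (?Q ?c))"
    using pingpong_maps[of "int m", where 'a = 'a] m(2) by simp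
  ultimately show False
    using pingpong_not_id[OF pingpong_iter steep_flat] by blast
qed

section \<open>Generators of the special automorphism group\<close>

definition blowup :: "'a::comm_ring_1 poly poly \<Rightarrow> 'a poly poly" where
  "blowup p = subst2 p (var_x * var_y) var_y"

lemma blowup_simps [simp]:
  "blowup (p + q) = blowup p + blowup q" "blowup (p * q) = blowup p * blowup q"
  "blowup (p - q) = blowup p - blowup q" "blowup (- p) = - blowup p" "blowup (const2 a) = const2 a"
  "blowup var_x = var_x * var_y" "blowup var_y = var_y" "blowup 0 = 0" "blowup 1 = 1" "blowup (p ^ n) = blowup p ^ n"
  unfolding blowup_def by simp_all

lemma coeff_subst1_blowup:
  "coeff (coeff (subst1 c [:0, [:0, 1:]:]) k) i = (if k = i then coeff c i else 0)"
proof (induction c arbitrary: k i)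
  case (pCons a c)
  show ?case
    by (cases k; cases i) (simp_all add: pCons.IH)
qed simp

lemma coeff_blowup:
  "coeff (coeff (blowup p) k) i = (if i \<le> k then coeff (coeff p (k - i)) i else 0)"
proof (induction p arbitrary: k i)
  case (pCons c p)
  have "blowup (pCons c p) = subst1 c (var_x * var_y) + var_y * blowup p"
    by (simp add: blowup_def)
  then have "coeff (coeff (blowup (pCons c p)) k) i =
      (if k = i then coeff c i else 0) + (if k = 0 then 0 else coeff (coeff (blowup p) (k - 1)) i)"
    by (simp add: coeff_subst1_blowup coeff_pCons split: nat.split)
  also have "\<dots> = (if i \<le> k then coeff (coeff (pCons c p) (k - i)) i else 0)"
  proof (cases "k - i")
    case (Suc l)
    then have "k - Suc i = l"
      by simp
    then show ?thesis
      unfolding pCons.IH using Suc by (auto simp: coeff_pCons)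
  qed (auto simp: pCons.IH coeff_pCons)
  finally show ?case .
qed simp

text \<open>Substituting \<open>(xy, y)\<close> turns the total degree into the degree in \<open>y\<close>.\<close>

definition total_degree :: "'a::comm_ring_1 poly poly \<Rightarrow> nat" where
  "total_degree p = degree (blowup p)"

lemma coeff_total_degree: "total_degree p < i + j \<Longrightarrow> coeff (coeff p j) i = 0"
  using coeff_blowup[of p "i + j" i] by (simp add: total_degree_def coeff_eq_0)

text \<open>The factor \<open>var_y\<close> is the jacobian of the substitution itself.\<close>

lemma jacobian_blowup:
  "jacobian (blowup f, blowup g) = blowup (jacobian (f, g)) * var_y"
  using jacobian_comp[of "(f, g)" "(var_x * var_y, var_y)"]
  by (simp add: plane_comp_def blowup_def jacobian_def deriv_x_pCons pderiv_pCons mult.commute[of "[:0, 1:]"])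

lemma jacobian_subst2: "jacobian (F, subst2 P F G) = subst2 (deriv_y P) F G * jacobian (F, G)"
  using jacobian_comp[of "(var_x, P)" "(F, G)"] by (simp add: plane_comp_def jacobian_def)

lemma degree_deriv_x_le: "degree (deriv_x p) \<le> degree p"
  by (rule degree_le) (simp add: deriv_x_def coeff_map_poly coeff_eq_0)

lemma degree_jacobian:
  fixes F H :: "'a::{idom,ring_char_0} poly poly"
  assumes "jacobian (F, H) \<noteq> 0"
  shows "degree (jacobian (F, H)) + 1 \<le> degree F + degree H"
proof -
  have bound: "degree (deriv_x p * deriv_y q) + 1 \<le> degree p + degree q"
    if "deriv_x p * deriv_y q \<noteq> 0" for p q :: "'a poly poly"
  proof -
    have "deriv_y q \<noteq> 0" using that by auto
    then have "degree q > 0"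
      by (auto simp: deriv_y_def pderiv_eq_0_iff)
    moreover have "degree (deriv_x p * deriv_y q) \<le> degree (deriv_x p) + degree (deriv_y q)"
      by (rule degree_mult_le)
    moreover have "degree (deriv_y q) = degree q - 1"
      by (simp add: deriv_y_def degree_pderiv)
    ultimately show ?thesis
      using degree_deriv_x_le[of p] by simp
  qed
  have eq: "jacobian (F, H) = deriv_x F * deriv_y H - deriv_x H * deriv_y F"
    by (simp add: jacobian_def mult.commute)
  show ?thesis
  proof (cases "deriv_x F * deriv_y H = 0 \<or> deriv_x H * deriv_y F = 0")
    case True
    then show ?thesis
      using assms bound[of F H] bound[of H F] unfolding eq by auto
  next
    case False
    then show ?thesis
      using bound[of F H] bound[of H F] degree_diff_le_max[of "deriv_x F * deriv_y H" "deriv_x H * deriv_y F"]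
      unfolding eq by auto
  qed
qed

section \<open>Multiplicities of roots and vanishing Wronskians\<close>

lemma order_pderiv_iter:
  fixes p :: "'a::{idom,semiring_char_0} poly"
  assumes "p \<noteq> 0"
  shows "poly ((pderiv ^^ order a p) p) a \<noteq> 0"
  using assms
proof (induction "order a p" arbitrary: p)
  case 0
  then show ?case by (simp add: order_root)
next
  case (Suc k)
  then have "poly p a = 0"
    by (metis nat.distinct(1) order_root)
  then have o: "order a p = Suc (order a (pderiv p))"
    using Suc.prems by (rule order_pderiv[rotated])
  have "pderiv p \<noteq> 0"
  proof
    assume "pderiv p = 0"
    then obtain c where "p = [:c:]"
      using pderiv_iszero by blast
    then show False
      using \<open>poly p a = 0\<close> Suc.prems by simp
  qed
  then have "poly ((pderiv ^^ order a (pderiv p)) (pderiv p)) a \<noteq> 0"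
    using Suc.hyps o by (intro Suc.hyps(1)) auto
  then show ?case
    unfolding o funpow_Suc_right by simp
qed

lemma pcompose_power_left: "pcompose (p ^ n) q = pcompose p q ^ n"
  for p q :: "'a::comm_ring_1 poly"
  by (induction n) (simp_all add: pcompose_mult pcompose_1)

lemma order_power_left: "p \<noteq> 0 \<Longrightarrow> order a (p ^ n) = n * order a p"
  for p :: "'a::idom poly"
  by (induction n) (simp_all add: order_mult order_0I)

text \<open>\<open>H\<close> is a power of the variable X times h(X^p). Since \<open>a\<close> is
  nonzero and the characteristic is zero, \<open>a\<close> is a simple root of X^p - a^p, so its
  order in \<open>H\<close> is the order of a^p in \<open>h\<close>. This is at most the degree of
  \<open>h\<close>, and h(X^p) has \<open>p\<close> times that degree.\<close>

lemma order_residue_class: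
  fixes H :: "'a::{idom,ring_char_0} poly"
  assumes "H \<noteq> 0" "a \<noteq> 0" "p \<ge> 1"
    and cong: "\<And>i j. coeff H i \<noteq> 0 \<Longrightarrow> coeff H j \<noteq> 0 \<Longrightarrow> i mod p = j mod p"
  shows "p * order a H \<le> degree H"
proof -
  define b where "b = degree H mod p"
  define L where "L = degree H div p"
  define h where "h = (\<Sum>l\<le>L. monom (coeff H (b + p * l)) l)"
  have cH: "coeff H i = 0" if "i mod p \<noteq> b" for i
    using cong[of i "degree H"] that assms(1) unfolding b_def by auto
  have monom_pow: "pcompose (monom c l) (monom 1 p) = monom c (p * l)" for l and c :: 'a
  proof (induction l)
    case 0
    then show ?case by (simp add: monom_0)
  next
    case (Suc l)
    then show ?case by (simp add: monom_Suc pcompose_pCons mult_monom)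
  qed
  have H: "H = monom 1 b * pcompose h (monom 1 p)"
  proof (rule poly_eqI)
    fix i
    have "monom 1 b * pcompose h (monom 1 p) = (\<Sum>l\<le>L. monom (coeff H (b + p * l)) (b + p * l))"
      by (simp add: h_def pcompose_sum monom_pow sum_distrib_left mult_monom)
    then have *: "coeff (monom 1 b * pcompose h (monom 1 p)) i =
        (\<Sum>l\<le>L. if b + p * l = i then coeff H (b + p * l) else 0)"
      by (simp add: coeff_sum)
    show "coeff H i = coeff (monom 1 b * pcompose h (monom 1 p)) i"
    proof (cases "coeff H i = 0")
      case True
      then show ?thesis
        unfolding * True by (intro sum.neutral[symmetric]) (use True in auto)
    next
      case False
      then have "i mod p = b" "i \<le> degree H"
        using cH[of i] le_degree by auto
      then have "i = b + p * (i div p)" "i div p \<le> L"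
        using div_le_mono unfolding L_def by auto
      moreover have "(b + p * l = i) = (l = i div p)" for l
        using \<open>i = b + p * (i div p)\<close> assms(3) by (metis add_left_cancel mult_cancel1 not_one_le_zero)
      ultimately show ?thesis
        unfolding * by simp
    qed
  qed
  have "h \<noteq> 0"
    using H assms(1) by auto
  then obtain q where q: "h = [:- (a ^ p), 1:] ^ order (a ^ p) h * q" "\<not> [:- (a ^ p), 1:] dvd q"
    using order_decomp by blast
  define r where "r = monom 1 p - [:a ^ p:]"
  have "pcompose [:- (a ^ p), 1:] (monom 1 p) = r"
    by (simp add: pcompose_pCons r_def)
  then have pc: "pcompose h (monom 1 p) = r ^ order (a ^ p) h * pcompose q (monom 1 p)"
    by (subst q(1)) (simp add: pcompose_mult pcompose_power_left)
  have r0: "r \<noteq> 0" and ra: "poly r a = 0"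
  proof -
    have "coeff r p = 1"
      using assms(3) by (simp add: r_def coeff_pCons split: nat.split)
    then show "r \<noteq> 0" by auto
    show "poly r a = 0"
      by (simp add: r_def poly_monom)
  qed
  have "poly (pderiv r) a = of_nat p * a ^ (p - 1)"
    by (simp add: r_def pderiv_diff pderiv_monom poly_monom pderiv_pCons)
  then have "poly (pderiv r) a \<noteq> 0"
    using assms by simp
  then have "order a r = 1"
    using order_pderiv[OF r0 ra] by (simp add: order_0I)
  moreover have "order a (pcompose q (monom 1 p)) = 0"
    using q(2) by (intro order_0I) (simp add: poly_pcompose poly_monom poly_eq_0_iff_dvd)
  moreover have "order a (monom 1 b) = 0"
    using assms(2) by (intro order_0I) (simp add: poly_monom)
  moreover have nz: "pcompose h (monom 1 p) \<noteq> 0"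
    using H assms(1) by auto
  ultimately have "order a H = order (a ^ p) h"
    using assms(1) r0 by (subst H) (simp add: order_mult pc order_power_left)
  also have "\<dots> \<le> degree h"
    by (rule order_degree[OF \<open>h \<noteq> 0\<close>])
  finally have "p * order a H \<le> p * degree h"
    by simp
  also have "\<dots> = degree (pcompose h (monom 1 p))"
    by (simp add: degree_pcompose degree_monom_eq)
  also have "\<dots> \<le> degree H"
    by (subst H) (use nz in \<open>simp add: degree_mult_eq\<close>)
  finally show ?thesis .
qed

text \<open>The hypothesis is a vanishing Wronskian. It survives the subtraction of a multiple of
  \<open>A\<close> that removes the coefficient of \<open>B\<close> at \<open>degree A\<close>. If a
  nonzero \<open>D\<close> remained, comparing leading coefficients would force it to have the
  degree of \<open>A\<close>, where its coefficient is 0.\<close>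

lemma proportional:
  fixes A B :: "'a::field_char_0 poly"
  assumes "A \<noteq> 0" "pderiv A * B = A * pderiv B"
  shows "\<exists>c. B = smult c A"
proof -
  define c where "c = coeff B (degree A) / lead_coeff A"
  define D where "D = B - smult c A"
  have D: "pderiv A * D = A * pderiv D" and cD: "coeff D (degree A) = 0"
    using assms by (simp_all add: D_def c_def pderiv_diff pderiv_smult algebra_simps)
  have "D = 0"
  proof (rule ccontr)
    assume D0: "D \<noteq> 0"
    then have ne: "degree D \<noteq> degree A"
      using cD by (metis leading_coeff_0_iff)
    define N where "N = degree A + degree D - 1"
    have co: "coeff (pderiv p * q) (degree p + degree q - 1) = of_nat (degree p) * (lead_coeff p * lead_coeff q)"
      if "degree p + degree q \<noteq> 0" for p q :: "'a poly"
    proof (cases "degree p = 0")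
      case True
      then have "pderiv p = 0"
        using pderiv_eq_0_iff by blast
      then show ?thesis using True by simp
    next
      case False
      then have "degree p + degree q - 1 = degree (pderiv p) + degree q"
        by (simp add: degree_pderiv)
      then have "coeff (pderiv p * q) (degree p + degree q - 1) = lead_coeff (pderiv p) * lead_coeff q"
        using coeff_mult_degree_sum by metis
      also have "lead_coeff (pderiv p) = of_nat (degree p) * lead_coeff p"
        using False by (simp add: degree_pderiv coeff_pderiv)
      finally show ?thesis by simp
    qed
    have "degree A + degree D \<noteq> 0"
      using ne by auto
    then have "of_nat (degree A) * (lead_coeff A * lead_coeff D) = coeff (pderiv A * D) (degree A + degree D - 1)"
      by (rule co[symmetric])
    also have "\<dots> = coeff (pderiv D * A) (degree D + degree A - 1)"
      unfolding D by (simp only: mult.commute add.commute)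
    also have "\<dots> = of_nat (degree D) * (lead_coeff D * lead_coeff A)"
      using \<open>degree A + degree D \<noteq> 0\<close> by (intro co) linarith
    finally have "of_nat (degree A) * (lead_coeff A * lead_coeff D) = of_nat (degree D) * (lead_coeff D * lead_coeff A)" .
    then have "(of_nat (degree A) :: 'a) = of_nat (degree D)"
      using assms(1) D0 by (simp add: mult.commute)
    then show False
      using ne by simp
  qed
  then show ?thesis
    unfolding D_def by auto
qed

lemma subst1_sum: "degree c \<le> N \<Longrightarrow> subst1 c q = (\<Sum>j\<le>N. const2 (coeff c j) * q ^ j)"
proof (induction c arbitrary: N)
  case (pCons a c)
  show ?case
  proof (cases N)
    case 0
    then have "c = 0" using pCons.prems by (simp split: if_splits)
    then show ?thesis using 0 by simp
  next
    case (Suc M)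
    then have "degree c \<le> M"
      using pCons.prems by (simp split: if_splits)
    from pCons.IH[OF this] show ?thesis
      unfolding Suc by (subst sum.atMost_Suc_shift) (simp add: sum_distrib_left algebra_simps)
  qed
qed simp

lemma subst2_sum: "degree p \<le> N \<Longrightarrow> subst2 p q r = (\<Sum>i\<le>N. subst1 (coeff p i) q * r ^ i)"
proof (induction p arbitrary: N)
  case (pCons c p)
  show ?case
  proof (cases N)
    case 0
    then have "p = 0" using pCons.prems by (simp split: if_splits)
    then show ?thesis using 0 by simp
  next
    case (Suc M)
    then have "degree p \<le> M"
      using pCons.prems by (simp split: if_splits)
    from pCons.IH[OF this] show ?thesis
      unfolding Suc by (subst sum.atMost_Suc_shift) (simp add: sum_distrib_left algebra_simps)
  qed
qed simp

section \<open>Cancellation of leading forms in Jung's theorem\<close>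

locale jung_pair =
  fixes f g :: "'a::field_char_0 poly poly"
  assumes jac: "jacobian (f, g) = 1"
    and pos: "total_degree f \<ge> 1" "total_degree g \<ge> 1"
begin

abbreviation "F \<equiv> blowup f"
abbreviation "G \<equiv> blowup g"
abbreviation "n \<equiv> degree F"
abbreviation "m \<equiv> degree G"

lemma n_pos: "n \<ge> 1" and m_pos: "m \<ge> 1"
  using pos by (simp_all add: total_degree_def)

lemma FG_nonzero: "F \<noteq> 0" "G \<noteq> 0"
  using n_pos m_pos by auto

lemma jac_FG: "jacobian (F, G) = var_y"
  using jacobian_blowup[of f g] jac by simp

text \<open>The jacobian of \<open>F\<close> and \<open>subst2 P F G\<close> is
  \<open>subst2 (deriv_y P) F G\<close> times \<open>var_y\<close>. One unit of the 2 is the degree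
  of this factor, the other is the loss in \<open>degree_jacobian\<close>.\<close>

lemma degree_subst2_deriv:
  assumes "subst2 (deriv_y P) F G \<noteq> 0"
  shows "degree (subst2 (deriv_y P) F G) + 2 \<le> n + degree (subst2 P F G)" "subst2 P F G \<noteq> 0"
proof -
  have eq: "jacobian (F, subst2 P F G) = subst2 (deriv_y P) F G * var_y"
    by (simp only: jacobian_subst2 jac_FG)
  have nz: "subst2 (deriv_y P) F G * var_y \<noteq> 0"
    using assms by (simp del: mult_pCons_right)
  have "degree (subst2 (deriv_y P) F G * var_y) = degree (subst2 (deriv_y P) F G) + 1"
    using assms by (subst degree_mult_eq) auto
  then show "degree (subst2 (deriv_y P) F G) + 2 \<le> n + degree (subst2 P F G)"
    using degree_jacobian[of F "subst2 P F G"] nz unfolding eq by simp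
  show "subst2 P F G \<noteq> 0"
  proof
    assume "subst2 P F G = 0"
    then have "jacobian (F, subst2 P F G) = 0"
      by (simp add: jacobian_def deriv_y_def)
    then show False
      using eq nz by metis
  qed
qed

lemma degree_subst2_deriv_iter:
  assumes "subst2 ((deriv_y ^^ k) P) F G \<noteq> 0"
  shows "degree (subst2 ((deriv_y ^^ k) P) F G) + 2 * k \<le> k * n + degree (subst2 P F G)"
  using assms
proof (induction k)
  case (Suc k)
  then have nz: "subst2 (deriv_y ((deriv_y ^^ k) P)) F G \<noteq> 0"
    by simp
  show ?case
    using Suc.IH[OF degree_subst2_deriv(2)[OF nz]] degree_subst2_deriv(1)[OF nz] by simp
qed simp

text \<open>The variables are weighted by the degrees of \<open>F\<close> and \<open>G\<close>,
  which replace them. So \<open>w\<close> is an upper bound for the degree of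
  \<open>subst2 P F G\<close>, and the degree can fall short of the largest weight by cancellation
  only.\<close>

definition weight_le :: "'a poly poly \<Rightarrow> nat \<Rightarrow> bool" where
  "weight_le P w \<longleftrightarrow> (\<forall>i j. coeff (coeff P i) j \<noteq> 0 \<longrightarrow> n * j + m * i \<le> w)"

text \<open>In the part of weight \<open>w\<close> the first variable is replaced by
  \<open>lead_coeff F\<close>, while the second stays the variable of \<open>top_form\<close>.
  Evaluation at \<open>lead_coeff G\<close> gives the coefficient of degree \<open>w\<close>;
  cancellation thus becomes a root, which has a multiplicity.\<close>

definition top_coeff :: "'a poly poly \<Rightarrow> nat \<Rightarrow> nat \<Rightarrow> 'a poly" where
  "top_coeff P w i = (if m * i \<le> w \<and> n dvd (w - m * i)
     then smult (coeff (coeff P i) ((w - m * i) div n)) (lead_coeff F ^ ((w - m * i) div n)) else 0)"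

definition top_form :: "'a poly poly \<Rightarrow> nat \<Rightarrow> 'a poly poly" where
  "top_form P w = (\<Sum>i\<le>degree P. monom (top_coeff P w i) i)"

lemma top_coeff_eq_0: "degree P < i \<Longrightarrow> top_coeff P w i = 0"
  by (simp add: top_coeff_def coeff_eq_0)

lemma coeff_top_form: "coeff (top_form P w) i = top_coeff P w i"
  using top_coeff_eq_0[of P i w] by (auto simp: top_form_def coeff_sum not_le)

lemma degree_top_form: "degree (top_form P w) \<le> degree P"
  by (rule degree_le) (simp add: coeff_top_form top_coeff_eq_0)

lemma weight_degree_top_form:
  assumes "top_form P w \<noteq> 0" "k \<le> degree (top_form P w)"
  shows "m * k \<le> w"
proof -
  have "top_coeff P w (degree (top_form P w)) \<noteq> 0"
    using assms(1) by (simp flip: coeff_top_form)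
  then have "m * degree (top_form P w) \<le> w"
    by (auto simp: top_coeff_def split: if_splits)
  then show ?thesis
    using assms(2) by (meson le_trans mult_le_mono2)
qed

lemma coeff_power_product:
  "degree (F ^ j * G ^ i) = n * j + m * i" "coeff (F ^ j * G ^ i) (n * j + m * i) = lead_coeff F ^ j * lead_coeff G ^ i"
proof -
  show d: "degree (F ^ j * G ^ i) = n * j + m * i"
    using FG_nonzero by (simp add: degree_mult_eq degree_power_eq mult.commute)
  show "coeff (F ^ j * G ^ i) (n * j + m * i) = lead_coeff F ^ j * lead_coeff G ^ i"
    unfolding d[symmetric] by (simp add: lead_coeff_mult lead_coeff_power)
qed

lemma subst2_top:
  assumes "weight_le P w"
  shows "coeff (subst2 P F G) w = poly (top_form P w) (lead_coeff G)"
proof -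
  define N where "N = Max ((\<lambda>i. degree (coeff P i)) ` {..degree P})"
  have N: "degree (coeff P i) \<le> N" for i
  proof (cases "i \<le> degree P")
    case True
    then show ?thesis unfolding N_def by (intro Max_ge) auto
  qed (simp add: coeff_eq_0)
  have "subst2 P F G = (\<Sum>i\<le>degree P. \<Sum>j\<le>max N w. const2 (coeff (coeff P i) j) * (F ^ j * G ^ i))"
  proof -
    have "subst1 (coeff P i) F = (\<Sum>j\<le>max N w. const2 (coeff (coeff P i) j) * F ^ j)" for i
      using N[of i] by (intro subst1_sum) simp
    then show ?thesis
      by (subst subst2_sum[OF order_refl]) (simp only: sum_distrib_right mult.assoc)
  qed
  then have "coeff (subst2 P F G) w =
      (\<Sum>i\<le>degree P. \<Sum>j\<le>max N w. smult (coeff (coeff P i) j) (coeff (F ^ j * G ^ i) w))"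
    by (simp add: coeff_sum)
  also have "\<dots> = (\<Sum>i\<le>degree P. top_coeff P w i * lead_coeff G ^ i)"
  proof (rule sum.cong[OF refl])
    fix i
    let ?t = "\<lambda>j. smult (coeff (coeff P i) j) (coeff (F ^ j * G ^ i) w)"
    have t0: "?t j = 0" if "n * j + m * i \<noteq> w" for j
    proof (cases "coeff (coeff P i) j = 0")
      case False
      then have "n * j + m * i < w"
        using assms that unfolding weight_le_def by (meson le_neq_implies_less)
      then show ?thesis
        using coeff_power_product(1)[of j i] by (simp add: coeff_eq_0)
    qed simp
    show "(\<Sum>j\<le>max N w. ?t j) = top_coeff P w i * lead_coeff G ^ i"
    proof (cases "m * i \<le> w \<and> n dvd (w - m * i)")
      case True
      then obtain j where j: "w - m * i = n * j" by (auto elim: dvdE)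
      then have w: "w = n * j + m * i" using True by simp
      have u: "n * j' + m * i = w \<longleftrightarrow> j' = j" for j'
        using w n_pos by simp
      have "1 * j \<le> n * j"
        using n_pos by (rule mult_le_mono1)
      then have "j \<le> w"
        using w by linarith
      then have jw: "j \<in> {..max N w}"
        by (simp add: le_max_iff_disj)
      have "(\<Sum>j'\<in>{..max N w} - {j}. ?t j') = 0"
        by (intro sum.neutral ballI t0) (use u in auto)
      then have "(\<Sum>j\<le>max N w. ?t j) = ?t j"
        by (subst sum.remove[OF finite_atMost jw]) simp
      also have "\<dots> = top_coeff P w i * lead_coeff G ^ i"
        using True n_pos unfolding top_coeff_def j by (simp add: w coeff_power_product(2))
      finally show ?thesis .
    next
      case False
      have "?t j = 0" for j
      proof (rule t0)
        show "n * j + m * i \<noteq> w" using False by auto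
      qed
      then have "(\<Sum>j\<le>max N w. ?t j) = 0"
        by (intro sum.neutral) blast
      then show ?thesis
        unfolding top_coeff_def if_not_P[OF False] by simp
    qed
  qed
  also have "\<dots> = poly (top_form P w) (lead_coeff G)"
    by (simp add: top_form_def poly_sum poly_monom)
  finally show ?thesis .
qed

lemma weight_deriv:
  assumes "weight_le P w" "m \<le> w"
  shows "weight_le (deriv_y P) (w - m)" "top_form (deriv_y P) (w - m) = pderiv (top_form P w)"
proof -
  have c: "coeff (coeff (deriv_y P) i) j = of_nat (Suc i) * coeff (coeff P (Suc i)) j" for i j
    by (simp add: deriv_y_def coeff_pderiv of_nat_poly)
  show "weight_le (deriv_y P) (w - m)"
    unfolding weight_le_def c
  proof (intro allI impI)
    fix i j assume "of_nat (Suc i) * coeff (coeff P (Suc i)) j \<noteq> (0 :: 'a)"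
    then have "n * j + m * Suc i \<le> w"
      using assms(1)[unfolded weight_le_def, rule_format, of "Suc i" j] by auto
    then show "n * j + m * i \<le> w - m"
      by simp
  qed
  show "top_form (deriv_y P) (w - m) = pderiv (top_form P w)"
  proof (rule poly_eqI)
    fix i
    have "m * i \<le> w - m \<longleftrightarrow> m * Suc i \<le> w" "w - m - m * i = w - m * Suc i"
      using assms(2) by auto
    then show "coeff (top_form (deriv_y P) (w - m)) i = coeff (pderiv (top_form P w)) i"
      unfolding coeff_pderiv coeff_top_form top_coeff_def c by (simp add: of_nat_poly)
  qed
qed

lemma weight_deriv_iter:
  assumes "weight_le P w" "k * m \<le> w"
  shows "weight_le ((deriv_y ^^ k) P) (w - k * m) \<and>
    top_form ((deriv_y ^^ k) P) (w - k * m) = (pderiv ^^ k) (top_form P w)"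
  using assms(2)
proof (induction k)
  case (Suc k)
  then have IH: "weight_le ((deriv_y ^^ k) P) (w - k * m)"
    "top_form ((deriv_y ^^ k) P) (w - k * m) = (pderiv ^^ k) (top_form P w)" by auto
  have "m \<le> w - k * m" "w - k * m - m = w - Suc k * m"
    using Suc.prems by auto
  then show ?case
    using weight_deriv[OF IH(1)] IH(2) by simp
qed (use assms(1) in simp)

lemma top_weight_exists:
  assumes "P \<noteq> 0"
  obtains w where "weight_le P w" "top_form P w \<noteq> 0" "m * degree P \<le> w"
proof -
  define I where "I = {i. i \<le> degree P \<and> coeff P i \<noteq> 0}"
  define w where "w = Max ((\<lambda>i. n * degree (coeff P i) + m * i) ` I)"
  have fin: "finite I" and D: "degree P \<in> I"
    using assms unfolding I_def by auto
  have ge: "n * degree (coeff P i) + m * i \<le> w" if "i \<in> I" for i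
    unfolding w_def using fin that by (intro Max_ge) auto
  have "w \<in> (\<lambda>i. n * degree (coeff P i) + m * i) ` I"
    unfolding w_def using fin D by (intro Max_in) auto
  then obtain i where i: "i \<in> I" "w = n * degree (coeff P i) + m * i"
    by blast
  show thesis
  proof
    show "weight_le P w"
      unfolding weight_le_def
    proof (intro allI impI)
      fix i j assume "coeff (coeff P i) j \<noteq> 0"
      then have "i \<in> I" "j \<le> degree (coeff P i)"
        unfolding I_def by (auto intro: le_degree)
      then show "n * j + m * i \<le> w"
        using ge[of i] by (meson add_mono_thms_linordered_semiring(3) le_trans mult_le_mono2)
    qed
    have "(w - m * i) div n = degree (coeff P i)" "m * i \<le> w" "n dvd w - m * i"
      using i(2) n_pos by auto
    then have "coeff (top_form P w) i \<noteq> 0"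
      using i(1) FG_nonzero unfolding coeff_top_form top_coeff_def I_def by simp
    then show "top_form P w \<noteq> 0"
      by auto
    show "m * degree P \<le> w"
      using ge[OF D] by simp
  qed
qed

text \<open>The exponents of the second variable in a part of fixed weight are congruent modulo
  \<open>n div gcd n m\<close>. If \<open>n\<close> does not divide \<open>m\<close>, this modulus
  is at least 2, and by \<open>order_residue_class\<close> a nonzero root has multiplicity at most
  half the degree.\<close>

lemma divides_if_deep_cancellation:
  assumes "top_form P w \<noteq> 0" "degree (top_form P w) < 2 * order (lead_coeff G) (top_form P w)"
  shows "n dvd m"
proof (rule ccontr)
  assume nd: "\<not> n dvd m"
  define d where "d = gcd n m"
  define p where "p = n div d"
  have np: "n = d * p" and d0: "d > 0"
    using n_pos unfolding p_def d_def by auto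
  have md: "d * (m div d) = m"
    unfolding d_def by simp
  have p2: "p \<ge> 2"
  proof (rule ccontr)
    assume "\<not> p \<ge> 2"
    moreover have "p \<noteq> 0" using np n_pos by (cases p) auto
    ultimately have "p = 1" by simp
    then have "n = d" using np by simp
    then show False
      using nd gcd_dvd2[of n m] unfolding d_def by simp
  qed
  have cop: "coprime p (m div d)"
    unfolding p_def d_def using n_pos by (intro div_gcd_coprime) auto
  have cong: "i mod p = j mod p"
    if ij: "coeff (top_form P w) i \<noteq> 0" "coeff (top_form P w) j \<noteq> 0" for i j
  proof -
    have "i mod p = j mod p" if "i \<le> j" "coeff (top_form P w) i \<noteq> 0" "coeff (top_form P w) j \<noteq> 0" for i j
    proof -
      have 1: "m * i \<le> w" "n dvd w - m * i" "m * j \<le> w" "n dvd w - m * j"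
        using that(2,3) unfolding coeff_top_form top_coeff_def by (auto split: if_splits)
      have "m * i \<le> m * j"
        using that(1) by simp
      then have "m * (j - i) = (w - m * i) - (w - m * j)"
        using 1(1,3) by (simp add: diff_mult_distrib2)
      moreover have "n dvd (w - m * i) - (w - m * j)"
        using 1(2,4) by (rule dvd_diff_nat)
      ultimately have "n dvd m * (j - i)"
        by (simp only:)
      then have "d * p dvd d * (m div d) * (j - i)"
        by (simp only: np[symmetric] md)
      then have "p dvd (m div d) * (j - i)"
        using d0 by simp
      then have "p dvd j - i"
        using cop by (simp add: coprime_dvd_mult_right_iff)
      then show ?thesis
        using mod_eq_dvd_iff_nat[OF that(1), of p] by simp
    qed
    from this[of i j] this[of j i] show ?thesis
      using ij by linarith
  qed
  have "p * order (lead_coeff G) (top_form P w) \<le> degree (top_form P w)"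
    by (rule order_residue_class[OF assms(1) _ _ cong]) (use FG_nonzero(2) p2 in simp_all)
  moreover have "2 * order (lead_coeff G) (top_form P w) \<le> p * order (lead_coeff G) (top_form P w)"
    using p2 by (rule mult_le_mono1)
  ultimately show False
    using assms(2) by simp
qed

text \<open>If a polynomial in \<open>f\<close> and \<open>g\<close> has total degree 1 although \<open>g\<close> occurs in it, then the
  leading forms must cancel to a high order \<open>k\<close>: differentiating \<open>k\<close> times by \<open>g\<close> removes the
  cancellation, while each derivation lowers the degree by at least \<open>2 - n\<close> only.\<close>

lemma divides_if_coordinate:
  assumes nm: "n \<le> m" "m \<ge> 2" and P: "degree P \<ge> 1" "degree (subst2 P F G) = 1"
  shows "n dvd m"
proof -
  have "P \<noteq> 0" using P(1) by auto
  then obtain w where w: "weight_le P w" "top_form P w \<noteq> 0" "m * degree P \<le> w"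
    using top_weight_exists by blast
  define k where "k = order (lead_coeff G) (top_form P w)"
  have kd: "k \<le> degree (top_form P w)"
    unfolding k_def by (rule order_degree[OF w(2)])
  have km: "k * m \<le> w"
    using weight_degree_top_form[OF w(2) kd] by (simp add: mult.commute)
  have "coeff (subst2 ((deriv_y ^^ k) P) F G) (w - k * m) \<noteq> 0"
    using subst2_top[of "(deriv_y ^^ k) P" "w - k * m"] weight_deriv_iter[OF w(1) km]
      order_pderiv_iter[OF w(2), of "lead_coeff G"] unfolding k_def by simp
  then have "w - k * m \<le> degree (subst2 ((deriv_y ^^ k) P) F G)"
    "subst2 ((deriv_y ^^ k) P) F G \<noteq> 0"
    by (auto intro: le_degree)
  then have "w - k * m + 2 * k \<le> k * n + 1"
    using degree_subst2_deriv_iter[of k P] P(2) by simp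
  then have le: "m * degree P + 2 * k \<le> k * n + k * m + 1"
    using w(3) km by simp
  \<comment> \<open>As \<open>n \<le> m\<close>, the gain \<open>2 * k\<close> on the left of the
    inequality would otherwise force \<open>k = 0\<close>, which leaves
    \<open>m * degree P \<le> 1\<close> although \<open>m \<ge> 2\<close>.\<close>
  have "degree P < 2 * k"
  proof (rule ccontr)
    assume "\<not> degree P < 2 * k"
    then have "m * (2 * k) \<le> m * degree P"
      by (intro mult_le_mono2) simp
    moreover have "k * n \<le> k * m"
      using nm(1) by simp
    moreover have "m * (2 * k) = k * m + k * m"
      by simp
    ultimately have "k = 0"
      using le by linarith
    then have "m * degree P \<le> 1" using le by simp
    moreover have "m * 1 \<le> m * degree P"
      using P(1) by (intro mult_le_mono2)
    ultimately show False
      using nm(2) by simp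
  qed
  then have "degree (top_form P w) < 2 * order (lead_coeff G) (top_form P w)"
    using degree_top_form[of P w] unfolding k_def by simp
  then show ?thesis
    by (rule divides_if_deep_cancellation[OF w(2)])
qed

text \<open>The jacobian of \<open>F\<close> and \<open>G\<close> is \<open>var_y\<close>, so its
  coefficient at \<open>n + m - 1\<close>, which is at least 2, vanishes. This coefficient is the
  difference of the two sides.\<close>

lemma leading_coeff_relation:
  assumes "n + m \<ge> 3"
  shows "of_nat m * (pderiv (lead_coeff F) * lead_coeff G) = of_nat n * (lead_coeff F * pderiv (lead_coeff G))"
proof -
  have top: "coeff (deriv_x p * deriv_y q) (degree p + degree q - 1) =
      of_nat (degree q) * (pderiv (lead_coeff p) * lead_coeff q)" if "degree q \<ge> 1" for p q :: "'a poly poly"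
  proof -
    have "coeff (deriv_x p) (degree p) = pderiv (lead_coeff p)"
      by (simp add: deriv_x_def coeff_map_poly)
    moreover have "coeff (deriv_y q) (degree q - 1) = of_nat (degree q) * lead_coeff q"
      using that by (simp add: deriv_y_def coeff_pderiv)
    moreover have "coeff (deriv_x p * deriv_y q) (degree p + (degree q - 1)) =
      coeff (deriv_x p) (degree p) * coeff (deriv_y q) (degree q - 1)"
    proof (cases "degree (deriv_x p) = degree p")
      case True
      then show ?thesis
        using coeff_mult_degree_sum[of "deriv_x p" "deriv_y q"] by (simp add: deriv_y_def degree_pderiv)
    next
      case False
      then have "degree (deriv_x p) < degree p"
        using degree_deriv_x_le[of p] by simp
      then have "degree (deriv_x p * deriv_y q) < degree p + (degree q - 1)"
        using degree_mult_le[of "deriv_x p" "deriv_y q"] by (simp add: deriv_y_def degree_pderiv)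
      then show ?thesis
        using \<open>degree (deriv_x p) < degree p\<close> by (simp add: coeff_eq_0)
    qed
    ultimately show ?thesis
      using that by simp
  qed
  have "0 = coeff (var_y :: 'a poly poly) (n + m - 1)"
    using assms by (simp add: coeff_pCons split: nat.split)
  also have "\<dots> = coeff (deriv_x F * deriv_y G) (n + m - 1) - coeff (deriv_x G * deriv_y F) (m + n - 1)"
    unfolding jac_FG[symmetric] jacobian_def by (simp add: mult.commute add.commute)
  also have "\<dots> = of_nat m * (pderiv (lead_coeff F) * lead_coeff G) - of_nat n * (pderiv (lead_coeff G) * lead_coeff F)"
    using top[OF m_pos, of F] top[OF n_pos, of G] by simp
  finally show ?thesis
    by (simp add: mult.commute)
qed

text \<open>After division by \<open>n\<close> the relation says that
  \<open>lead_coeff F ^ s\<close> and \<open>lead_coeff G\<close> have a vanishing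
  Wronskian.\<close>

lemma leading_coeff_power:
  assumes "n + m \<ge> 3" "m = n * s"
  shows "\<exists>c. lead_coeff G = smult c (lead_coeff F ^ s)"
proof (rule proportional)
  show "lead_coeff F ^ s \<noteq> 0"
    using FG_nonzero by simp
  have "of_nat n * (of_nat s * (pderiv (lead_coeff F) * lead_coeff G)) = of_nat n * (lead_coeff F * pderiv (lead_coeff G))"
    using leading_coeff_relation[OF assms(1)] assms(2) by (simp add: mult.assoc)
  then have *: "of_nat s * (pderiv (lead_coeff F) * lead_coeff G) = lead_coeff F * pderiv (lead_coeff G)"
    using n_pos by simp
  show "pderiv (lead_coeff F ^ s) * lead_coeff G = lead_coeff F ^ s * pderiv (lead_coeff G)"
  proof (cases s)
    case 0
    then show ?thesis using * FG_nonzero by auto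
  next
    case (Suc r)
    have "pderiv (lead_coeff F ^ s) * lead_coeff G = lead_coeff F ^ r * (of_nat s * (pderiv (lead_coeff F) * lead_coeff G))"
      unfolding Suc pderiv_power_Suc by (simp add: of_nat_poly mult.assoc)
    also have "\<dots> = lead_coeff F ^ s * pderiv (lead_coeff G)"
      by (subst *) (simp add: Suc mult.assoc mult.left_commute)
    finally show ?thesis .
  qed
qed

end

section \<open>Words in the generators and reduction of degrees\<close>

datatype ('p, 'a) generator = Elem 'p | Torus 'a | Weyl

type_synonym 'a gen = "('a poly, 'a) generator"

definition elem_map :: "'a::field poly \<Rightarrow> 'a plane_map" where
  "elem_map p = (var_x, var_y + [:p:])"

definition torus_map :: "'a::field \<Rightarrow> 'a plane_map" where
  "torus_map a = (const2 a * var_x, const2 (inverse a) * var_y)"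

definition weyl_map :: "'a::field plane_map" where
  "weyl_map = (var_y, - var_x)"

fun plane_gen :: "'a::field gen \<Rightarrow> 'a plane_map" where
  "plane_gen (Elem p) = elem_map p"
| "plane_gen (Torus a) = torus_map a"
| "plane_gen Weyl = weyl_map"

fun gen_ok :: "nat \<Rightarrow> 'a::field gen \<Rightarrow> bool" where
  "gen_ok N (Elem p) \<longleftrightarrow> coeff p 0 = 0 \<and> degree p < N"
| "gen_ok N (Torus a) \<longleftrightarrow> a \<noteq> 0"
| "gen_ok N Weyl \<longleftrightarrow> True"

definition plane_word :: "'a::field gen list \<Rightarrow> 'a plane_map" where
  "plane_word ws = foldr (\<lambda>g. plane_comp (plane_gen g)) ws plane_id"

lemma plane_word_simps [simp]:
  "plane_word [] = plane_id" "plane_word (g # ws) = plane_comp (plane_gen g) (plane_word ws)"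
  by (simp_all add: plane_word_def)

lemma plane_word_append: "plane_word (us @ vs) = plane_comp (plane_word us) (plane_word vs)"
  by (induction us) (simp_all add: plane_comp_assoc)

lemma smult_const_minus_one [simp]: "smult [:- 1:] p = - (p :: 'a::comm_ring_1 poly poly)"
  using smult_minus_left[of "[:1:]" p] by simp

lemma blowup_smult [simp]: "blowup (smult [:c:] p) = smult [:c:] (blowup p)"
  using blowup_simps(2)[of "const2 c" p] by simp

lemma weyl_comp: "plane_comp weyl_map \<phi> = (snd \<phi>, - fst \<phi>)"
  by (simp add: plane_comp_def weyl_map_def)

lemma torus_comp: "plane_comp (torus_map a) \<phi> = (const2 a * fst \<phi>, const2 (inverse a) * snd \<phi>)"
  by (simp add: plane_comp_def torus_map_def)

lemma elem_comp: "plane_comp (elem_map p) \<phi> = (fst \<phi>, snd \<phi> + subst1 p (fst \<phi>))"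
  by (simp add: plane_comp_def elem_map_def)

lemma subst1_var_x: "subst1 p var_x = [:p:]"
  by (induction p) simp_all

lemma subst1_minus [simp]: "subst1 (- p) q = - subst1 p q"
  using subst1_simps(3)[of p "- p" q] by (simp add: eq_neg_iff_add_eq_0 add.commute del: subst1_simps(3))

lemma subst1_monom: "subst1 (monom c s) q = const2 c * q ^ s"
  by (induction s) (simp_all add: monom_0 monom_Suc algebra_simps)

lemma elem_map_add: "plane_comp (elem_map p) (elem_map q) = elem_map (p + q)"
  by (simp add: elem_comp) (simp add: elem_map_def subst1_var_x add.commute)

lemma elem_map_0: "elem_map 0 = plane_id"
  by (simp add: elem_map_def plane_id_def)

lemma torus_map_mult: "plane_comp (torus_map a) (torus_map b) = torus_map (a * b)"
  by (simp add: plane_comp_def torus_map_def mult.commute)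

lemma torus_map_1: "torus_map 1 = plane_id"
  by (simp add: torus_map_def plane_id_def)

lemma weyl_map_square: "plane_comp weyl_map weyl_map = torus_map (- 1)"
  by (simp add: plane_comp_def weyl_map_def torus_map_def)

lemma carrier_SAut0I:
  assumes "plane_comp \<psi> \<phi> = plane_id" "plane_comp \<phi> \<psi> = plane_id" "plane_apply \<phi> (0, 0) = (0, 0)" "jacobian \<phi> = 1"
  shows "\<phi> \<in> carrier SAut0_plane"
  using assms unfolding carrier_SAut0_plane carrier_Aut0_plane carrier_Aut_plane by blast

lemma plane_gen_SAut0:
  assumes "gen_ok N g"
  shows "plane_gen g \<in> carrier SAut0_plane"
proof (cases g)
  case (Elem p)
  have "elem_map p \<in> carrier SAut0_plane"
  proof (rule carrier_SAut0I[of "elem_map (- p)"])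
    show "plane_apply (elem_map p) (0, 0) = (0, 0)"
      using assms by (simp add: Elem plane_apply_def elem_map_def poly_0_coeff_0 eval2_def)
    show "jacobian (elem_map p) = 1"
      by (simp add: jacobian_def elem_map_def deriv_y_def deriv_x_pCons pderiv_pCons one_pCons)
  qed (simp_all add: elem_map_add elem_map_0)
  then show ?thesis by (simp add: Elem)
next
  case (Torus a)
  have "torus_map a \<in> carrier SAut0_plane"
    using assms Torus
    by (intro carrier_SAut0I[of "torus_map (inverse a)"])
      (simp_all add: torus_map_mult torus_map_1,
       simp_all add: torus_map_def plane_apply_def eval2_def jacobian_def deriv_y_def deriv_x_pCons pderiv_pCons one_pCons)
  then show ?thesis by (simp add: Torus)
next
  case Weyl
  have "weyl_map \<in> carrier (SAut0_plane :: 'a plane_map monoid)"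
    by (intro carrier_SAut0I[of "plane_comp weyl_map (torus_map (- 1))"])
      (simp_all add: plane_comp_def weyl_map_def torus_map_def plane_id_def plane_apply_def eval2_def
        jacobian_def deriv_y_def deriv_x_pCons pderiv_pCons one_pCons)
  then show ?thesis by (simp add: Weyl)
qed

lemma SAut0_comp:
  "\<phi> \<in> carrier SAut0_plane \<Longrightarrow> \<psi> \<in> carrier SAut0_plane \<Longrightarrow> plane_comp \<phi> \<psi> \<in> carrier SAut0_plane"
  for \<phi> \<psi> :: "'a::field plane_map"
  using monoid.m_closed[OF group.axioms(1)[OF group_SAut0_plane], of \<phi> \<psi>] by simp

text \<open>A component of total degree 0 is constant, hence zero as the origin is fixed, and then
  the jacobian could not be 1.\<close>

lemma SAut0_degree_pos:
  fixes f g :: "'a::field_char_0 poly poly"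
  assumes "(f, g) \<in> carrier SAut0_plane"
  shows "jung_pair f g"
proof
  have j: "jacobian (f, g) = 1" and z: "eval2 f 0 0 = 0" "eval2 g 0 0 = 0"
    using assms by (auto simp: carrier_SAut0_plane carrier_Aut0_plane plane_apply_def)
  show "jacobian (f, g) = 1" by (rule j)
  have "h = 0" if h: "total_degree h = 0" "eval2 h 0 0 = 0" for h :: "'a poly poly"
  proof (intro poly_eqI)
    fix j i
    have "coeff (coeff h 0) 0 = 0"
      using h(2) by (simp add: eval2_def poly_0_coeff_0)
    then show "coeff (coeff h j) i = coeff (coeff 0 j) i"
      using coeff_total_degree[of h i j] h(1) by (cases "i + j = 0") auto
  qed
  moreover have "f \<noteq> 0" "g \<noteq> 0"
    using j by (auto simp: jacobian_def deriv_y_def)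
  ultimately have "total_degree f \<noteq> 0" "total_degree g \<noteq> 0"
    using z by blast+
  then show "total_degree f \<ge> 1" "total_degree g \<ge> 1"
    by simp_all
qed

text \<open>The inverse map writes \<open>var_x\<close> and \<open>var_y\<close> as polynomials in
  \<open>f\<close> and \<open>g\<close>, and its nonzero jacobian shows that \<open>g\<close> occurs
  in one of them. Now \<open>divides_if_coordinate\<close> gives the exponent \<open>s\<close>, and
  by \<open>leading_coeff_power\<close> a multiple of \<open>f ^ s\<close> cancels the whole leading
  form of \<open>g\<close>.\<close>

lemma jung_step:
  fixes f g :: "'a::field_char_0 poly poly"
  assumes A: "(f, g) \<in> carrier SAut0_plane" and nm: "total_degree f \<le> total_degree g" "total_degree g \<ge> 2"
  obtains c s where "s \<ge> 1" "(f, g - const2 c * f ^ s) \<in> carrier SAut0_plane"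
    "total_degree (g - const2 c * f ^ s) < total_degree g"
    "(f, g) = plane_comp (elem_map (monom c s)) (f, g - const2 c * f ^ s)"
proof -
  interpret jung_pair f g by (rule SAut0_degree_pos[OF A])
  obtain \<psi> where \<psi>: "plane_comp \<psi> (f, g) = plane_id"
    using A unfolding carrier_SAut0_plane carrier_Aut0_plane carrier_Aut_plane by blast
  have comp: "subst2 (fst \<psi>) f g = var_x" "subst2 (snd \<psi>) f g = var_y"
    using \<psi> by (simp_all add: plane_comp_def plane_id_def)
  have b: "subst2 P F G = blowup (subst2 P f g)" for P
    by (simp only: blowup_def subst2_assoc)
  have deg: "degree (subst2 (fst \<psi>) F G) = 1" "degree (subst2 (snd \<psi>) F G) = 1"
    unfolding b comp by simp_all
  have "jacobian \<psi> \<noteq> 0"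
    using jacobian_comp[of \<psi> "(f, g)"] unfolding \<psi> by auto
  then have "pderiv (fst \<psi>) \<noteq> 0 \<or> pderiv (snd \<psi>) \<noteq> 0"
    by (auto simp: jacobian_def deriv_y_def)
  then have "degree (fst \<psi>) \<ge> 1 \<or> degree (snd \<psi>) \<ge> 1"
    by (simp add: pderiv_eq_0_iff) linarith
  then have "n dvd m"
    using divides_if_coordinate[of "fst \<psi>"] divides_if_coordinate[of "snd \<psi>"] nm deg
    unfolding total_degree_def by blast
  then obtain s where s: "m = n * s" ..
  have s1: "s \<ge> 1"
    using s m_pos by (cases s) auto
  have "n + m \<ge> 3"
    using nm(2) n_pos unfolding total_degree_def by linarith
  then obtain c where c: "lead_coeff G = smult c (lead_coeff F ^ s)"
    using leading_coeff_power s by blast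
  define g1 where "g1 = g - const2 c * f ^ s"
  have eq: "(f, g1) = plane_comp (elem_map (- monom c s)) (f, g)"
    by (simp add: elem_comp subst1_monom g1_def)
  have B: "blowup g1 = G - const2 c * F ^ s"
    by (simp add: g1_def)
  have dFs: "degree (const2 c * F ^ s) \<le> m"
    using FG_nonzero s by (simp add: degree_power_eq mult.commute degree_smult_le le_trans[OF degree_smult_le])
  have "coeff (F ^ s) m = lead_coeff F ^ s"
    using FG_nonzero s by (metis degree_power_eq lead_coeff_power mult.commute)
  then have "coeff (blowup g1) m = 0"
    unfolding B using c by simp
  moreover have "degree (blowup g1) \<le> m"
    unfolding B using dFs by (intro degree_diff_le) auto
  ultimately have "degree (blowup g1) < m"
    using m_pos by (metis One_nat_def degree_0 leading_coeff_0_iff le_neq_implies_less less_eq_Suc_le)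
  moreover have "elem_map (- monom c s) \<in> carrier SAut0_plane"
    using plane_gen_SAut0[of "Suc s" "Elem (- monom c s)"] s1 by (simp add: degree_monom_le less_Suc_eq_le)
  then have "(f, g1) \<in> carrier SAut0_plane"
    unfolding eq by (rule SAut0_comp[OF _ A])
  moreover have "(f, g) = plane_comp (elem_map (monom c s)) (f, g1)"
    by (simp add: elem_comp subst1_monom g1_def)
  ultimately show thesis
    using that[of s c] s1 unfolding g1_def total_degree_def by simp
qed

text \<open>This is the Bruhat decomposition of SL2: \<open>b = 0\<close> describes the triangular
  subgroup, and all other matrices lie in the big cell with a single Weyl element.\<close>

lemma linear_plane_word:
  fixes a b c d :: "'a::field"
  assumes "a * d - b * c = 1"
  shows "\<exists>ws. (\<forall>g\<in>set ws. \<exists>N. gen_ok N g) \<and>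
    plane_word ws = (const2 a * var_x + const2 b * var_y, const2 c * var_x + const2 d * var_y)"
proof (cases "b = 0")
  case True
  then have "a * d = 1"
    using assms by simp
  then have a: "a \<noteq> 0" "inverse a = d"
    by (auto simp: inverse_unique)
  show ?thesis
    by (rule exI[of _ "[Elem [:0, c / a:], Torus a]"])
      (use a True in \<open>auto simp: elem_comp torus_map_def intro!: exI[of _ 2]\<close>)
next
  case False
  have 1: "c = d * a / b - inverse b"
    using assms False by (simp add: field_simps)
  show ?thesis
    by (rule exI[of _ "[Elem [:0, d / b:], Weyl, Elem [:0, a * b:], Torus (inverse b)]"])
      (use False 1 in \<open>auto simp: elem_comp torus_map_def weyl_comp divide_inverse mult_ac intro!: exI[of _ 2]\<close>)
qed

theorem SAut0_plane_word:
  fixes \<phi> :: "'a::field_char_0 plane_map"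
  assumes "\<phi> \<in> carrier SAut0_plane"
  shows "\<exists>ws. (\<forall>g\<in>set ws. \<exists>N. gen_ok N g) \<and> plane_word ws = \<phi>"
  using assms
proof (induction "total_degree (fst \<phi>) + total_degree (snd \<phi>)" arbitrary: \<phi> rule: less_induct)
  case less
  obtain f g where \<phi>: "\<phi> = (f, g)" by (cases \<phi>)
  note A = less.prems[unfolded \<phi>]
  have ok: "\<exists>N. gen_ok N (Elem (monom c s))" if "s \<ge> 1" for c :: 'a and s
    using that by (intro exI[of _ "Suc s"]) (simp add: degree_monom_le less_Suc_eq_le)
  consider "total_degree f \<le> 1" "total_degree g \<le> 1" | "total_degree f \<le> total_degree g" "total_degree g \<ge> 2"
    | "total_degree g < total_degree f" "total_degree f \<ge> 2"
    by linarith
  then show ?case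
  proof cases
    case 1
    have z: "eval2 f 0 0 = 0" "eval2 g 0 0 = 0"
      using A by (auto simp: carrier_SAut0_plane carrier_Aut0_plane plane_apply_def)
    have lin: "h = const2 (coeff (coeff h 0) 1) * var_x + const2 (coeff (coeff h 1) 0) * var_y"
      if h: "total_degree h \<le> 1" "eval2 h 0 0 = 0" for h :: "'a poly poly"
    proof (intro poly_eqI)
      fix j i
      have 0: "coeff (coeff h 0) 0 = 0"
        using h(2) by (simp add: eval2_def poly_0_coeff_0)
      show "coeff (coeff h j) i =
        coeff (coeff (const2 (coeff (coeff h 0) 1) * var_x + const2 (coeff (coeff h 1) 0) * var_y) j) i"
      proof (cases "i + j \<le> 1")
        case True
        then have "i = 0 \<and> j = 0 \<or> i = 1 \<and> j = 0 \<or> i = 0 \<and> j = 1" by auto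
        then show ?thesis using 0 by auto
      next
        case False
        then have "coeff (coeff h j) i = 0"
          using coeff_total_degree[of h i j] h(1) by simp
        then show ?thesis
          using False by (cases i; cases j; simp add: coeff_pCons split: nat.split)
      qed
    qed
    obtain a b c d where f: "f = const2 a * var_x + const2 b * var_y" and g: "g = const2 c * var_x + const2 d * var_y"
      using lin[OF 1(1) z(1)] lin[OF 1(2) z(2)] by blast
    have "jacobian (f, g) = const2 (a * d - b * c)"
      unfolding f g by (simp add: jacobian_def deriv_y_def deriv_x_pCons pderiv_pCons one_pCons)
    then have "a * d - b * c = 1"
      using A by (simp add: carrier_SAut0_plane one_pCons)
    then show ?thesis
      unfolding \<phi> f g by (rule linear_plane_word)
  next
    case 2
    obtain c s where cs: "s \<ge> 1" "(f, g - const2 c * f ^ s) \<in> carrier SAut0_plane"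
      "total_degree (g - const2 c * f ^ s) < total_degree g"
      "(f, g) = plane_comp (elem_map (monom c s)) (f, g - const2 c * f ^ s)"
      using jung_step[OF A 2] by blast
    obtain ws where ws: "\<forall>g\<in>set ws. \<exists>N. gen_ok N g" "plane_word ws = (f, g - const2 c * f ^ s)"
      using less.hyps[of "(f, g - const2 c * f ^ s)"] cs(2,3) \<phi> by auto
    show ?thesis
      by (rule exI[of _ "Elem (monom c s) # ws"]) (use ws cs(4) ok[OF cs(1)] \<phi> in auto)
  next
    case 3
    have w: "weyl_map \<in> carrier (SAut0_plane :: 'a plane_map monoid)"
      using plane_gen_SAut0[of 0 Weyl] by simp
    have eq: "plane_comp weyl_map (f, g) = (g, - f)"
      by (simp add: plane_comp_def weyl_map_def)
    have t: "total_degree (- f) = total_degree f"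
      by (simp add: total_degree_def)
    have "(g, - f) \<in> carrier SAut0_plane"
      using SAut0_comp[OF w A] unfolding eq .
    then obtain c s where cs: "s \<ge> 1" "(g, - f - const2 c * g ^ s) \<in> carrier SAut0_plane"
      "total_degree (- f - const2 c * g ^ s) < total_degree (- f)"
      "(g, - f) = plane_comp (elem_map (monom c s)) (g, - f - const2 c * g ^ s)"
      using jung_step[of g "- f"] 3 t by (metis less_imp_le_nat)
    obtain ws where ws: "\<forall>g\<in>set ws. \<exists>N. gen_ok N g" "plane_word ws = (g, - f - const2 c * g ^ s)"
      using less.hyps[of "(g, - f - const2 c * g ^ s)"] cs(2,3) \<phi> t by auto
    \<comment> \<open>As the square of \<open>weyl_map\<close> is \<open>torus_map (- 1)\<close>,
      the first two letters together invert \<open>weyl_map\<close> and undo the swap.\<close>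
    have "plane_word (Weyl # Torus (- 1) # Elem (monom c s) # ws) = (f, g)"
      unfolding plane_word_simps plane_gen.simps ws(2) cs(4)[symmetric] by (simp add: weyl_comp torus_comp)
    moreover have "\<forall>g\<in>set (Weyl # Torus (- 1) # Elem (monom c s) # ws). \<exists>N. gen_ok N g"
      using ws(1) ok[OF cs(1)] by auto
    ultimately show ?thesis
      using \<phi> by blast
  qed
qed

section \<open>The matrix representation\<close>

lemma smult_sum_right: "smult c (sum f A) = (\<Sum>x\<in>A. smult c (f x))"
  by (induction A rule: infinite_finite_induct) (simp_all add: smult_add_right)

lemma const_poly_sum: "(\<Sum>x\<in>A. [:f x:]) = [:sum f A:]"
  by (induction A rule: infinite_finite_induct) simp_all

lemma of_nat_mult_const: "of_nat k * [:x:] = [:of_nat k * x :: 'a::comm_ring_1:]"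
  by (simp add: of_nat_poly mult.commute)

section \<open>Exponential series with coefficients polynomial in t\<close>

fun exp_coeff :: "'a::field_char_0 poly fps \<Rightarrow> nat \<Rightarrow> 'a poly" where
  "exp_coeff P 0 = 1"
| "exp_coeff P (Suc d) = smult (inverse (of_nat (Suc d)))
     (\<Sum>i\<le>d. of_nat (Suc i) * fps_nth P (Suc i) * exp_coeff P (d - i))"

definition fexp :: "'a::field_char_0 poly fps \<Rightarrow> 'a poly fps" where
  "fexp P = Abs_fps (exp_coeff P)"

lemma fexp_0 [simp]: "fps_nth (fexp P) 0 = 1"
  by (simp add: fexp_def)

lemma fexp_Suc:
  "of_nat (Suc d) * fps_nth (fexp P) (Suc d) = (\<Sum>i\<le>d. of_nat (Suc i) * fps_nth P (Suc i) * fps_nth (fexp P) (d - i))"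
proof -
  have "of_nat (Suc d) * smult (inverse (of_nat (Suc d))) q = q" for q :: "'a poly"
    by (simp add: of_nat_poly del: of_nat_Suc)
  then show ?thesis
    by (simp add: fexp_def del: of_nat_Suc)
qed

lemma fps_deriv_fexp: "fps_deriv (fexp P) = fps_deriv P * fexp P"
  by (rule fps_ext) (simp add: fps_mult_nth fexp_Suc atLeast0AtMost del: of_nat_Suc)

text \<open>The equation determines a solution coefficient by coefficient from its constant term.
  The laws of \<open>fexp\<close> then follow by comparing derivatives.\<close>

lemma fps_linear_ode_unique:
  fixes F G :: "'b::{idom,ring_char_0} fps"
  assumes "fps_deriv F = A * F" "fps_deriv G = A * G" "fps_nth F 0 = fps_nth G 0"
  shows "F = G"
proof (rule fps_ext)
  fix d show "fps_nth F d = fps_nth G d"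
  proof (induction d rule: less_induct)
    case (less d)
    show ?case
    proof (cases d)
      case (Suc e)
      have "fps_nth (A * F) e = fps_nth (A * G) e"
        unfolding fps_mult_nth using less Suc by (intro sum.cong) auto
      then have "of_nat (Suc e) * fps_nth F (Suc e) = of_nat (Suc e) * fps_nth G (Suc e)"
        using arg_cong[OF assms(1), of "\<lambda>f. fps_nth f e"] arg_cong[OF assms(2), of "\<lambda>f. fps_nth f e"] by simp
      then show ?thesis
        using Suc by (simp del: of_nat_Suc)
    qed (use assms(3) in simp)
  qed
qed

lemma fexp_add: "fexp (P + Q) = fexp P * fexp Q"
  by (rule fps_linear_ode_unique[of _ "fps_deriv (P + Q)"])
    (simp_all add: fps_deriv_fexp algebra_simps)

lemma fexp_zero: "fexp 0 = 1"
  by (rule fps_linear_ode_unique[of _ 0]) (simp_all add: fps_deriv_fexp)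

text \<open>The exponents of \<open>t\<close> vanish for linear \<open>p\<close>, and their quadratic growth makes the leading
  coefficient of \<open>p\<close> dominate in the exponential series.\<close>

definition weighted_series :: "'a::field_char_0 poly \<Rightarrow> 'a poly fps" where
  "weighted_series p = Abs_fps (\<lambda>d. if 2 \<le> d then monom (coeff p (d - 1)) ((d - 1)\<^sup>2 - 1) else 0)"

definition elem_series :: "'a::field_char_0 poly \<Rightarrow> 'a poly fps" where
  "elem_series p = fexp (weighted_series p)"

lemma elem_series_add: "elem_series (p + q) = elem_series p * elem_series q"
proof -
  have "weighted_series (p + q) = weighted_series p + weighted_series q"
    by (rule fps_ext) (simp add: weighted_series_def add_monom)
  then show ?thesis
    by (simp add: elem_series_def fexp_add)
qed

lemma elem_series_zero: "elem_series 0 = 1"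
proof -
  have "weighted_series (0 :: 'a poly) = 0"
    by (rule fps_ext) (simp add: weighted_series_def)
  then show ?thesis
    by (simp add: elem_series_def fexp_zero)
qed

lemma elem_series_0 [simp]: "fps_nth (elem_series p) 0 = 1"
  by (simp add: elem_series_def)

lemma elem_series_Suc:
  "of_nat (Suc d) * fps_nth (elem_series p) (Suc d) =
    (\<Sum>i\<le>d. of_nat (Suc i) * (if i = 0 then 0 else monom (coeff p i) (i\<^sup>2 - 1)) * fps_nth (elem_series p) (d - i))"
  unfolding elem_series_def fexp_Suc by (intro sum.cong) (auto simp: weighted_series_def)

text \<open>This is how the torus acts by conjugation: d(a)^(-1) e(p) d(a) is e of
  \<open>torus_act a p\<close>.\<close>

definition torus_act :: "'a::field_char_0 \<Rightarrow> 'a poly \<Rightarrow> 'a poly" where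
  "torus_act a p = smult a (pcompose p [:0, a:])"

lemma coeff_torus_act: "coeff (torus_act a p) i = a ^ Suc i * coeff p i"
  by (simp add: torus_act_def coeff_pcompose_linear)

lemma of_nat_mult_cancel:
  "of_nat (Suc d) * p = of_nat (Suc d) * q \<Longrightarrow> p = (q :: 'a::field_char_0 poly)"
  by (simp del: of_nat_Suc)

text \<open>The coefficient of x^i in \<open>p\<close> has torus weight i+1 and enters at z^(i+1);
  so the coefficient of z^d is homogeneous of weight d.\<close>

lemma elem_series_torus: "fps_nth (elem_series (torus_act a p)) d = smult (a ^ d) (fps_nth (elem_series p) d)"
proof (induction d rule: less_induct)
  case (less d)
  show ?case
  proof (cases d)
    case (Suc e)
    have "of_nat (Suc e) * fps_nth (elem_series (torus_act a p)) (Suc e) =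
      (\<Sum>i\<le>e. smult (a ^ Suc e) (of_nat (Suc i) * (if i = 0 then 0 else monom (coeff p i) (i\<^sup>2 - 1)) *
         fps_nth (elem_series p) (e - i)))"
      unfolding elem_series_Suc
    proof (rule sum.cong[OF refl])
      fix i assume i: "i \<in> {..e}"
      have IH: "fps_nth (elem_series (torus_act a p)) (e - i) = smult (a ^ (e - i)) (fps_nth (elem_series p) (e - i))"
        using Suc by (intro less) simp
      have "monom (coeff (torus_act a p) i) (i\<^sup>2 - 1) = smult (a ^ Suc i) (monom (coeff p i) (i\<^sup>2 - 1))"
        by (simp add: coeff_torus_act smult_monom)
      moreover have "a ^ (e - i) * a ^ Suc i = a ^ Suc e"
        using i by (simp flip: power_add)
      ultimately show "of_nat (Suc i) * (if i = 0 then 0 else monom (coeff (torus_act a p) i) (i\<^sup>2 - 1)) *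
          fps_nth (elem_series (torus_act a p)) (e - i) =
        smult (a ^ Suc e) (of_nat (Suc i) * (if i = 0 then 0 else monom (coeff p i) (i\<^sup>2 - 1)) *
          fps_nth (elem_series p) (e - i))"
        unfolding IH by (simp del: power_Suc of_nat_Suc)
    qed
    also have "\<dots> = of_nat (Suc e) * smult (a ^ Suc e) (fps_nth (elem_series p) (Suc e))"
      by (simp only: mult_smult_right elem_series_Suc smult_sum_right[symmetric])
    finally show ?thesis
      unfolding Suc by (rule of_nat_mult_cancel)
  qed simp
qed

text \<open>For linear \<open>p\<close> the series is exp(c z^2), free of t.\<close>

lemma elem_series_linear:
  "fps_nth (elem_series [:0, c:]) d = (if even d then [:c ^ (d div 2) / fact (d div 2):] else 0)"
proof (induction d rule: less_induct)
  case (less d)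
  show ?case
  proof (cases d)
    case (Suc e)
    have "of_nat (Suc e) * fps_nth (elem_series [:0, c:]) (Suc e) =
      (\<Sum>i\<le>e. if i = 1 then of_nat 2 * [:c:] * fps_nth (elem_series [:0, c:]) (e - 1) else 0)"
      unfolding elem_series_Suc
      by (intro sum.cong) (auto simp: monom_0 coeff_pCons split: nat.split)
    then have *: "of_nat (Suc e) * fps_nth (elem_series [:0, c:]) (Suc e) =
      (if 1 \<le> e then of_nat 2 * [:c:] * fps_nth (elem_series [:0, c:]) (e - 1) else 0)"
      by simp
    show ?thesis
    proof (cases e)
      case 0
      then show ?thesis using * Suc by simp
    next
      case (Suc l)
      have IH: "fps_nth (elem_series [:0, c:]) l = (if even l then [:c ^ (l div 2) / fact (l div 2):] else 0)"
        using \<open>d = Suc e\<close> Suc by (intro less) simp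
      have "of_nat (Suc e) * fps_nth (elem_series [:0, c:]) d =
        of_nat (Suc e) * (if even d then [:c ^ (d div 2) / fact (d div 2):] else 0)"
      proof (cases "even l")
        case True
        then obtain r where r: "l = 2 * r" by (auto elim: evenE)
        have "of_nat (Suc (Suc (2 * r))) * (c ^ Suc r / fact (Suc r)) = 2 * (c * (c ^ r / fact r))"
        proof -
          have "of_nat (Suc (Suc (2 * r))) = 2 * (of_nat (Suc r) :: 'a)"
            by simp
          then show ?thesis
            by (simp add: fact_Suc del: of_nat_Suc)
        qed
        then have "of_nat (Suc e) * [:c ^ (d div 2) / fact (d div 2):] = [:2 * (c * (c ^ r / fact r)):]"
          unfolding of_nat_mult_const using \<open>d = Suc e\<close> Suc r by simp
        moreover have "of_nat (Suc e) * fps_nth (elem_series [:0, c:]) d = [:2 * (c * (c ^ r / fact r)):]"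
        proof -
          have "of_nat (Suc e) * fps_nth (elem_series [:0, c:]) d = of_nat 2 * ([:c:] * [:c ^ r / fact r:])"
            using * IH True \<open>d = Suc e\<close> Suc r by (simp only:) simp
          also have "[:c:] * [:c ^ r / fact r:] = [:c * (c ^ r / fact r):]"
            by simp
          finally show ?thesis
            unfolding of_nat_mult_const by simp
        qed
        ultimately show ?thesis
          using True \<open>d = Suc e\<close> Suc by simp
      next
        case False
        then show ?thesis
          using * IH \<open>d = Suc e\<close> Suc by simp
      qed
      then show ?thesis
        by (rule of_nat_mult_cancel)
    qed
  qed simp
qed

text \<open>This scaling turns the exponential of a linear \<open>p\<close> into the action on binary forms.\<close>

definition basis_scale :: "nat \<Rightarrow> nat \<Rightarrow> 'a::field_char_0" where
  "basis_scale m j = inverse (fact (m + 1 - (j + 1) div 2))"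

lemma basis_scale_nonzero [simp]: "basis_scale m j \<noteq> 0"
  by (simp add: basis_scale_def)

text \<open>The size is \<open>(m + 2) + (m + 1)\<close>, the dimensions of the binary forms of
  degrees \<open>m + 1\<close> and \<open>m\<close>. Up to conjugation by the diagonal matrix of
  scales this is a Toeplitz matrix, so matrices multiply as truncated power series do.\<close>

definition rep_elem :: "nat \<Rightarrow> 'a::field_char_0 poly \<Rightarrow> 'a poly mat" where
  "rep_elem m p = mat (2 * m + 3) (2 * m + 3)
     (\<lambda>(i, j). if i \<le> j then smult (basis_scale m j / basis_scale m i) (fps_nth (elem_series p) (j - i)) else 0)"

lemma rep_elem_carrier [simp]: "rep_elem m p \<in> carrier_mat (2 * m + 3) (2 * m + 3)"
  by (simp add: rep_elem_def)

lemma rep_elem_add: "rep_elem m p * rep_elem m q = rep_elem m (p + q)"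
proof (rule eq_matI)
  let ?n = "2 * m + 3"
  fix i j assume "i < dim_row (rep_elem m (p + q))" "j < dim_col (rep_elem m (p + q))"
  then have ij: "i < ?n" "j < ?n" by (simp_all add: rep_elem_def)
  define t where "t l = (if i \<le> l \<and> l \<le> j then smult (basis_scale m j / basis_scale m i)
      (fps_nth (elem_series p) (l - i) * fps_nth (elem_series q) (j - l)) else 0)" for l
  have "(rep_elem m p * rep_elem m q) $$ (i, j) = (\<Sum>l<?n. t l)"
    using ij unfolding t_def
    by (auto simp: rep_elem_def scalar_prod_def atLeast0LessThan intro!: sum.cong)
  also have "\<dots> = (if i \<le> j then \<Sum>l=i..j. t l else 0)"
  proof (cases "i \<le> j")
    case True
    have "(\<Sum>l=i..j. t l) = (\<Sum>l<?n. t l)"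
      using ij by (intro sum.mono_neutral_left) (auto simp: t_def)
    then show ?thesis using True by simp
  qed (auto simp: t_def intro!: sum.neutral)
  also have "\<dots> = rep_elem m (p + q) $$ (i, j)"
  proof (cases "i \<le> j")
    case True
    have "(\<Sum>l=i..j. t l) = (\<Sum>l=0..j - i. t (l + i))"
      using sum.shift_bounds_cl_nat_ivl[of t 0 i "j - i"] True by simp
    also have "\<dots> = (\<Sum>l=0..j - i. smult (basis_scale m j / basis_scale m i)
        (fps_nth (elem_series p) l * fps_nth (elem_series q) (j - i - l)))"
      using True by (intro sum.cong) (auto simp: t_def add.commute)
    also have "\<dots> = smult (basis_scale m j / basis_scale m i) (fps_nth (elem_series (p + q)) (j - i))"
      by (simp add: elem_series_add fps_mult_nth smult_sum_right)
    finally show ?thesis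
      using True ij by (simp add: rep_elem_def)
  qed (use ij in \<open>simp add: rep_elem_def\<close>)
  finally show "(rep_elem m p * rep_elem m q) $$ (i, j) = rep_elem m (p + q) $$ (i, j)" .
qed (simp_all add: rep_elem_def)

lemma rep_elem_0: "rep_elem m 0 = 1\<^sub>m (2 * m + 3)"
  by (rule eq_matI) (auto simp: rep_elem_def elem_series_zero)

text \<open>The row \<open>i\<close> of \<open>rep_lin\<close> lists the coefficients of the image of the \<open>i\<close>-th basis vector of
  \<open>S\<^sup>m\<^sup>+\<^sup>1 \<oplus> S\<^sup>m\<close> (even and odd indices, respectively) under a linear substitution. The vectors are
  binary forms, written inhomogeneously.\<close>

definition lin_form :: "'a::comm_ring_1 \<times> 'a \<times> 'a \<times> 'a \<Rightarrow> nat \<Rightarrow> nat \<Rightarrow> 'a poly" where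
  "lin_form = (\<lambda>(a, b, c, d) k i. [:b, a:] ^ i * [:d, c:] ^ (k - i))"

definition mult2 :: "'a::comm_ring_1 \<times> 'a \<times> 'a \<times> 'a \<Rightarrow> 'a \<times> 'a \<times> 'a \<times> 'a \<Rightarrow> 'a \<times> 'a \<times> 'a \<times> 'a" where
  "mult2 = (\<lambda>(a, b, c, d) (a', b', c', d').
     (a * a' + b * c', a * b' + b * d', c * a' + d * c', c * b' + d * d'))"

text \<open>\<open>f\<close> stands for a binary form of degree \<open>k\<close>, written
  inhomogeneously, whose two variables are replaced by \<open>A\<close> and
  \<open>B\<close>.\<close>

definition homog_subst :: "'a::comm_ring_1 poly \<Rightarrow> 'a poly \<Rightarrow> nat \<Rightarrow> 'a poly \<Rightarrow> 'a poly" where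
  "homog_subst A B k f = (\<Sum>j\<le>k. smult (coeff f j) (A ^ j * B ^ (k - j)))"

lemma homog_subst_linear_factor:
  assumes "degree f \<le> k"
  shows "homog_subst A B (Suc k) ([:b, a:] * f) = (smult a A + smult b B) * homog_subst A B k f"
proof -
  have "homog_subst A B (Suc k) ([:b, a:] * f) =
      homog_subst A B (Suc k) (smult b f) + homog_subst A B (Suc k) (pCons 0 (smult a f))"
    by (simp add: homog_subst_def smult_add_left sum.distrib)
  also have "homog_subst A B (Suc k) (smult b f) = smult b B * homog_subst A B k f"
    using assms by (simp add: homog_subst_def coeff_eq_0 sum_distrib_left Suc_diff_le mult_ac)
  also have "homog_subst A B (Suc k) (pCons 0 (smult a f)) = smult a A * homog_subst A B k f"
    unfolding homog_subst_def by (subst sum.atMost_Suc_shift) (simp add: sum_distrib_left mult_ac)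
  finally show ?thesis
    by (simp add: algebra_simps)
qed

lemma degree_lin_form: "i \<le> k \<Longrightarrow> degree (lin_form g k i) \<le> k"
proof -
  assume "i \<le> k"
  obtain a b c d where g: "g = (a, b, c, d)" by (cases g)
  have "degree ([:b, a:] ^ i * [:d, c:] ^ (k - i)) \<le> degree [:b, a:] * i + degree [:d, c:] * (k - i)"
    by (intro order_trans[OF degree_mult_le] add_mono degree_power_le)
  also have "\<dots> \<le> 1 * i + 1 * (k - i)"
    by (intro add_mono mult_right_mono) auto
  finally show ?thesis
    using \<open>i \<le> k\<close> by (simp add: g lin_form_def)
qed

lemma lin_form_mult2:
  assumes "i \<le> k"
  shows "(\<Sum>j\<le>k. smult (coeff (lin_form g k i) j) (lin_form g' k j)) = lin_form (mult2 g g') k i"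
proof -
  obtain a b c d a' b' c' d' where g: "g = (a, b, c, d)" "g' = (a', b', c', d')"
    by (cases g; cases g')
  let ?A = "[:b', a':]" and ?B = "[:d', c':]"
  have 1: "homog_subst ?A ?B r ([:d, c:] ^ r) = (smult c ?A + smult d ?B) ^ r" for r
  proof (induction r)
    case (Suc r)
    have "degree ([:d, c:] ^ r) \<le> degree [:d, c:] * r" by (rule degree_power_le)
    also have "\<dots> \<le> 1 * r" by (intro mult_right_mono) auto
    finally show ?case
      using homog_subst_linear_factor[of "[:d, c:] ^ r" r ?A ?B d c] Suc by simp
  qed (simp add: homog_subst_def)
  have 2: "homog_subst ?A ?B (s + r) ([:b, a:] ^ s * [:d, c:] ^ r) =
      (smult a ?A + smult b ?B) ^ s * (smult c ?A + smult d ?B) ^ r" for s r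
  proof (induction s)
    case (Suc s)
    have "degree ([:b, a:] ^ s * [:d, c:] ^ r) \<le> s + r"
      using degree_lin_form[of s "s + r" "(a, b, c, d)"] by (simp add: lin_form_def)
    from homog_subst_linear_factor[OF this, of ?A ?B b a] show ?case
      unfolding Suc.IH by (simp only: power_Suc add_Suc mult.assoc)
  qed (simp add: 1)
  have "(\<Sum>j\<le>k. smult (coeff (lin_form g k i) j) (lin_form g' k j)) =
      homog_subst ?A ?B (i + (k - i)) ([:b, a:] ^ i * [:d, c:] ^ (k - i))"
    using assms by (simp add: homog_subst_def lin_form_def g)
  also have "\<dots> = lin_form (mult2 g g') k i"
    unfolding 2 by (simp add: lin_form_def mult2_def g algebra_simps)
  finally show ?thesis .
qed

definition rep_lin :: "nat \<Rightarrow> 'a::field_char_0 \<times> 'a \<times> 'a \<times> 'a \<Rightarrow> 'a poly mat" where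
  "rep_lin m g = mat (2 * m + 3) (2 * m + 3)
     (\<lambda>(i, j). if i mod 2 = j mod 2 then [:coeff (lin_form g (m + 1 - i mod 2) (i div 2)) (j div 2):] else 0)"

lemma rep_lin_carrier [simp]: "rep_lin m g \<in> carrier_mat (2 * m + 3) (2 * m + 3)"
  by (simp add: rep_lin_def)

lemma rep_lin_mult: "rep_lin m g * rep_lin m g' = rep_lin m (mult2 g g')"
proof (rule eq_matI)
  let ?n = "2 * m + 3"
  fix i j assume "i < dim_row (rep_lin m (mult2 g g'))" "j < dim_col (rep_lin m (mult2 g g'))"
  then have ij: "i < ?n" "j < ?n" by (simp_all add: rep_lin_def)
  define k where "k = m + 1 - i mod 2"
  define t where "t l = [:coeff (lin_form g k (i div 2)) l * coeff (lin_form g' k l) (j div 2):]" for l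
  have ik: "i div 2 \<le> k"
    using ij unfolding k_def by (cases "even i") (auto elim!: evenE oddE)
  have "(rep_lin m g * rep_lin m g') $$ (i, j) =
      (\<Sum>l<?n. if l mod 2 = i mod 2 \<and> i mod 2 = j mod 2 then t (l div 2) else 0)"
    using ij unfolding t_def k_def
    by (auto simp: rep_lin_def scalar_prod_def atLeast0LessThan intro!: sum.cong)
  also have "\<dots> = rep_lin m (mult2 g g') $$ (i, j)"
  proof (cases "i mod 2 = j mod 2")
    case True
    have "(\<Sum>l<?n. if l mod 2 = i mod 2 \<and> i mod 2 = j mod 2 then t (l div 2) else 0) =
        (\<Sum>l\<in>{l. l < ?n \<and> l mod 2 = i mod 2}. t (l div 2))"
      using True by (intro sum.mono_neutral_cong_right) auto
    also have "\<dots> = (\<Sum>l\<le>k. t l)"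
    proof (rule sum.reindex_bij_witness[of _ "\<lambda>l. 2 * l + i mod 2" "\<lambda>l. l div 2"])
      fix l assume "l \<in> {l. l < ?n \<and> l mod 2 = i mod 2}"
      then have l: "l < ?n" "l mod 2 = i mod 2" by auto
      show "2 * (l div 2) + i mod 2 = l"
        unfolding l(2)[symmetric] by simp
      show "l div 2 \<in> {..k}"
        using l unfolding k_def by (cases "even l") (auto elim!: evenE oddE)
    next
      fix l assume "l \<in> {..k}"
      then show "2 * l + i mod 2 \<in> {l. l < ?n \<and> l mod 2 = i mod 2}"
        unfolding k_def by (cases "even i") (auto simp: even_iff_mod_2_eq_zero odd_iff_mod_2_eq_one)
    qed (auto)
    also have "\<dots> = [:\<Sum>l\<le>k. coeff (lin_form g k (i div 2)) l * coeff (lin_form g' k l) (j div 2):]"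
      unfolding t_def by (rule const_poly_sum)
    also have "(\<Sum>l\<le>k. coeff (lin_form g k (i div 2)) l * coeff (lin_form g' k l) (j div 2)) =
        coeff (lin_form (mult2 g g') k (i div 2)) (j div 2)"
      unfolding lin_form_mult2[OF ik, symmetric] by (simp add: coeff_sum)
    finally show ?thesis
      using True ij by (simp add: rep_lin_def k_def)
  qed (use ij in \<open>simp add: rep_lin_def\<close>)
  finally show "(rep_lin m g * rep_lin m g') $$ (i, j) = rep_lin m (mult2 g g') $$ (i, j)" .
qed (simp_all add: rep_lin_def)

definition rep_torus :: "nat \<Rightarrow> 'a::field_char_0 \<Rightarrow> 'a poly mat" where
  "rep_torus m a = rep_lin m (a, 0, 0, inverse a)"

definition rep_weyl :: "nat \<Rightarrow> 'a::field_char_0 poly mat" where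
  "rep_weyl m = rep_lin m (0, 1, - 1, 0)"

lemma coeff_one_plus_power: "coeff ([:1, c:] ^ r) s = of_nat (r choose s) * (c :: 'a::comm_ring_1) ^ s"
proof (induction r arbitrary: s)
  case 0
  then show ?case by (cases s) auto
next
  case (Suc r)
  then show ?case
    by (cases s) (simp_all add: algebra_simps)
qed

lemma coeff_X_power_mult: "coeff ([:0, 1:] ^ i * p) j = (if i \<le> j then coeff p (j - i) else (0 :: 'a::comm_ring_1))"
proof -
  have "[:0, 1:] ^ i = (monom 1 i :: 'a poly)"
    by (simp add: monom_altdef)
  then show ?thesis
    by (simp add: coeff_monom_mult)
qed

lemma linear_power_monom: "[:0, a:] ^ s = monom (a ^ s) s"
  by (induction s) (simp_all add: monom_0 monom_Suc smult_monom one_pCons)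

lemma index_half: "i < 2 * (m :: nat) + 3 \<Longrightarrow> i div 2 \<le> m + 1 - i mod 2"
  by (cases "even i") (auto elim!: evenE oddE)

lemma basis_scale_index: "basis_scale m i = inverse (fact (m + 1 - i mod 2 - i div 2) :: 'a::field_char_0)"
proof -
  have "(i + 1) div 2 = i mod 2 + i div 2"
    by (cases "even i") (auto elim!: evenE oddE)
  then show ?thesis
    by (simp add: basis_scale_def)
qed

text \<open>The series contributes c^r / r! at distance 2r, where r = t - s. The quotient of the
  scales is (k - s)! / (k - t)!, which completes 1 / r! to the binomial coefficient in the action on
  binary forms. Entries between indices of different parity vanish, as the series is even.\<close>

lemma rep_elem_linear: "rep_elem m [:0, c:] = rep_lin m (1, 0, c, 1)"
proof (rule eq_matI)
  fix i j assume "i < dim_row (rep_lin m (1, 0, c, 1))" "j < dim_col (rep_lin m (1, 0, c, 1))"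
  then have ij: "i < 2 * m + 3" "j < 2 * m + 3" by (simp_all add: rep_lin_def)
  define k where "k = m + 1 - i mod 2"
  show "rep_elem m [:0, c:] $$ (i, j) = rep_lin m (1, 0, c, 1) $$ (i, j)"
  proof (cases "i mod 2 = j mod 2")
    case False
    then have "i \<le> j \<Longrightarrow> odd (j - i)"
      by presburger
    then show ?thesis
      using False ij by (simp add: rep_elem_def rep_lin_def elem_series_linear)
  next
    case True
    define s t where "s = i div 2" and "t = j div 2"
    have i: "i = 2 * s + i mod 2"
      unfolding s_def by simp
    have j: "j = 2 * t + i mod 2"
      unfolding t_def True by simp
    have sk: "s \<le> k" "t \<le> k"
      using index_half[OF ij(1)] index_half[OF ij(2)] True unfolding s_def t_def k_def by simp_all
    have rhs: "rep_lin m (1, 0, c, 1) $$ (i, j) = [:if s \<le> t then of_nat ((k - s) choose (t - s)) * c ^ (t - s) else 0:]"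
      using ij True unfolding rep_lin_def lin_form_def k_def s_def t_def
      by (simp add: coeff_X_power_mult coeff_one_plus_power)
    show ?thesis
    proof (cases "s \<le> t")
      case le: True
      have ji: "i \<le> j" "j - i = 2 * (t - s)"
        using i j le by linarith+
      have scales: "basis_scale m i = inverse (fact (k - s) :: 'a)" "basis_scale m j = inverse (fact (k - t) :: 'a)"
        using basis_scale_index[of m i] basis_scale_index[of m j] True unfolding k_def s_def t_def by simp_all
      have "k - s - (t - s) = k - t"
        using sk le by simp
      then have binom: "of_nat ((k - s) choose (t - s)) = (fact (k - s) / (fact (t - s) * fact (k - t)) :: 'a)"
        using binomial_fact[of "t - s" "k - s", where 'a = 'a] sk le by simp
      show ?thesis
        using ij ji unfolding rhs
        by (simp add: rep_elem_def elem_series_linear scales binom le) (simp add: field_simps)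
    next
      case False
      then have "\<not> i \<le> j"
        using i j by linarith
      then show ?thesis
        using False ij unfolding rhs by (simp add: rep_elem_def)
    qed
  qed
qed (simp_all add: rep_lin_def rep_elem_def)

text \<open>Interleaving the two degrees arranges the torus weights as the consecutive integers from
  -(m+1) to m+1, one for each index.\<close>

lemma rep_torus_index:
  assumes "a \<noteq> 0" "i < 2 * m + 3" "j < 2 * m + 3"
  shows "rep_torus m a $$ (i, j) = (if i = j then [:a ^ i / a ^ (m + 1):] else 0)"
proof (cases "i mod 2 = j mod 2")
  case False
  then show ?thesis
    using assms by (auto simp: rep_torus_def rep_lin_def)
next
  case True
  define k s where "k = m + 1 - i mod 2" and "s = i div 2"
  have sk: "s \<le> k"
    using index_half[OF assms(2)] unfolding s_def k_def .
  have "lin_form (a, 0, 0, inverse a) k s = monom (a ^ s * inverse a ^ (k - s)) s"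
    by (simp add: lin_form_def linear_power_monom poly_const_pow smult_monom)
  then have 1: "rep_torus m a $$ (i, j) = [:if s = j div 2 then a ^ s * inverse a ^ (k - s) else 0:]"
    using assms True unfolding rep_torus_def rep_lin_def k_def s_def by simp
  have 2: "s = j div 2 \<longleftrightarrow> i = j"
    unfolding s_def using True div_mult_mod_eq[of i 2] div_mult_mod_eq[of j 2] by (intro iffI) linarith+
  have "s + (m + 1) = i + (k - s)"
  proof -
    define r where "r = i mod 2"
    have "i = 2 * s + r" "r \<le> 1"
      unfolding s_def r_def by simp_all
    then show ?thesis
      using sk unfolding k_def r_def[symmetric] by arith
  qed
  then have eq: "a ^ s * a ^ (m + 1) = a ^ i * a ^ (k - s)"
    by (simp only: power_add[symmetric])
  have nz: "a ^ (k - s) \<noteq> 0" "a ^ (m + 1) \<noteq> 0"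
    using assms(1) by (rule power_not_zero)+
  have "a ^ s * inverse a ^ (k - s) = a ^ s / a ^ (k - s)"
    by (simp only: divide_inverse power_inverse)
  also have "\<dots> = a ^ i / a ^ (m + 1)"
    by (simp only: frac_eq_eq[OF nz] eq)
  finally have "a ^ s * inverse a ^ (k - s) = a ^ i / a ^ (m + 1)" .
  then show ?thesis
    unfolding 1 2 by simp
qed

text \<open>The Weyl element inverts the torus and therefore reverses the order of the weights; its
  matrix is antidiagonal.\<close>

lemma rep_weyl_index:
  assumes "i < 2 * m + 3" "j < 2 * m + 3"
  shows "rep_weyl m $$ (i, j) = (if i + j = 2 * m + 2 then [:(- 1) ^ (m + 1 - i mod 2 - i div 2) :: 'a::field_char_0:] else 0)"
proof (cases "i mod 2 = j mod 2")
  case False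
  then have "odd (i + j)"
    by presburger
  then have "i + j \<noteq> 2 * m + 2"
    by (metis even_add even_mult_iff dvd_refl)
  then show ?thesis
    using False assms by (simp add: rep_weyl_def rep_lin_def)
next
  case True
  define k s where "k = m + 1 - i mod 2" and "s = i div 2"
  have sk: "s \<le> k"
    using index_half[OF assms(1)] unfolding s_def k_def .
  have lf: "lin_form (0, 1, - 1, 0) k s = (monom ((- 1) ^ (k - s)) (k - s) :: 'a poly)"
    by (simp add: lin_form_def linear_power_monom one_pCons[symmetric])
  have "rep_weyl m $$ (i, j) = [:coeff (lin_form (0, 1, - 1, 0) k s) (j div 2) :: 'a:]"
    using assms True unfolding rep_weyl_def rep_lin_def k_def s_def by simp
  then have 1: "rep_weyl m $$ (i, j) = [:if k - s = j div 2 then (- 1) ^ (k - s) else 0 :: 'a:]"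
    unfolding lf by simp
  have "k - s = j div 2 \<longleftrightarrow> i + j = 2 * m + 2"
  proof -
    define r t where "r = i mod 2" and "t = j div 2"
    have "i = 2 * s + r" "j = 2 * t + r" "r \<le> 1"
      using True unfolding s_def t_def r_def by simp_all presburger+
    then show ?thesis
      using sk unfolding k_def r_def[symmetric] t_def[symmetric] by arith
  qed
  then show ?thesis
    unfolding 1 k_def s_def by simp
qed

lemma rep_elem_torus:
  assumes "a \<noteq> 0"
  shows "rep_elem m p * rep_torus m a = rep_torus m a * rep_elem m (torus_act a p)"
proof (rule eq_matI)
  let ?n = "2 * m + 3"
  have ct: "rep_torus m a \<in> carrier_mat ?n ?n"
    by (simp add: rep_torus_def)
  fix i j assume "i < dim_row (rep_torus m a * rep_elem m (torus_act a p))"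
    "j < dim_col (rep_torus m a * rep_elem m (torus_act a p))"
  then have ij: "i < ?n" "j < ?n" using ct by (auto simp: rep_elem_def)
  have "(rep_elem m p * rep_torus m a) $$ (i, j) = (\<Sum>l<?n. rep_elem m p $$ (i, l) * rep_torus m a $$ (l, j))"
    using ij ct by (auto simp: scalar_prod_def atLeast0LessThan rep_elem_def)
  also have "\<dots> = (\<Sum>l<?n. if l = j then rep_elem m p $$ (i, j) * [:a ^ j / a ^ (m + 1):] else 0)"
    using ij assms by (intro sum.cong) (auto simp: rep_torus_index)
  also have "\<dots> = rep_elem m p $$ (i, j) * [:a ^ j / a ^ (m + 1):]"
    using ij by simp
  also have "\<dots> = [:a ^ i / a ^ (m + 1):] * rep_elem m (torus_act a p) $$ (i, j)"
  proof (cases "i \<le> j")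
    case True
    then have "a ^ j = a ^ (j - i) * a ^ i"
      by (simp flip: power_add)
    then show ?thesis
      using True ij by (simp add: rep_elem_def elem_series_torus mult_ac)
  qed (use ij in \<open>simp add: rep_elem_def\<close>)
  also have "\<dots> = (\<Sum>l<?n. if i = l then [:a ^ i / a ^ (m + 1):] * rep_elem m (torus_act a p) $$ (l, j) else 0)"
    using ij by simp
  also have "\<dots> = (\<Sum>l<?n. rep_torus m a $$ (i, l) * rep_elem m (torus_act a p) $$ (l, j))"
    using ij assms by (intro sum.cong) (auto simp: rep_torus_index)
  also have "\<dots> = (rep_torus m a * rep_elem m (torus_act a p)) $$ (i, j)"
    using ij ct by (auto simp: scalar_prod_def atLeast0LessThan rep_elem_def)
  finally show "(rep_elem m p * rep_torus m a) $$ (i, j) = (rep_torus m a * rep_elem m (torus_act a p)) $$ (i, j)" .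
qed (simp_all add: rep_elem_def rep_torus_def rep_lin_def)

text \<open>These relations hold for plane maps and for matrices, so words can be reduced in the
  same way on both sides. The ambient structure is a monoid because \<open>d 0\<close> also lies in
  it. The relation \<open>w_e_w\<close> is the identity of SL2 that trades two Weyl elements for
  one.\<close>

locale gen_system = monoid G for G (structure) +
  fixes e :: "'a::field_char_0 poly \<Rightarrow> 'g" and d :: "'a \<Rightarrow> 'g" and w :: 'g
  assumes G_carrier: "e p \<in> carrier G" "d a \<in> carrier G" "w \<in> carrier G"
    and e_add: "e p \<otimes> e q = e (p + q)" and e_0: "e 0 = \<one>"
    and d_mult: "a \<noteq> 0 \<Longrightarrow> b \<noteq> 0 \<Longrightarrow> d a \<otimes> d b = d (a * b)" and d_1: "d 1 = \<one>"
    and e_d: "a \<noteq> 0 \<Longrightarrow> e p \<otimes> d a = d a \<otimes> e (torus_act a p)"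
    and w_d: "a \<noteq> 0 \<Longrightarrow> w \<otimes> d a = d (inverse a) \<otimes> w"
    and w_w: "w \<otimes> w = d (- 1)"
    and w_e_w: "c \<noteq> 0 \<Longrightarrow> w \<otimes> (e [:0, c:] \<otimes> w) =
      e [:0, - inverse c:] \<otimes> (w \<otimes> (d (inverse c) \<otimes> e [:0, - inverse c:]))"

interpretation plane: gen_system "plane_monoid :: 'a::field_char_0 plane_map monoid" elem_map torus_map weyl_map
proof (rule gen_system.intro[OF monoid_plane], unfold_locales, unfold plane_monoid_def, simp_all only: UNIV_I partial_object.simps monoid.simps)
  fix p :: "'a poly" and a :: 'a assume "a \<noteq> 0"
  have "subst1 p (const2 a * var_x) = [:pcompose p [:0, a:]:]"
    by (induction p) (simp_all add: pcompose_pCons)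
  then show "plane_comp (elem_map p) (torus_map a) = plane_comp (torus_map a) (elem_map (torus_act a p))"
    using \<open>a \<noteq> 0\<close> by (simp add: elem_comp torus_comp) (simp add: torus_map_def elem_map_def torus_act_def smult_add_right)
qed (simp_all add: elem_map_add elem_map_0 torus_map_mult torus_map_1 weyl_map_square weyl_comp elem_comp torus_comp
   , simp_all add: weyl_map_def torus_map_def elem_map_def subst1_var_x one_pCons add.commute)

definition mat_monoid :: "nat \<Rightarrow> 'r::semiring_1 mat monoid" where
  "mat_monoid n = \<lparr>carrier = carrier_mat n n, mult = (*), one = 1\<^sub>m n\<rparr>"

lemma monoid_mat_monoid: "monoid (mat_monoid n)"
  by unfold_locales (auto simp: mat_monoid_def)

lemma rep_lin_id: "rep_lin m (1, 0, 0, 1 :: 'a::field_char_0) = 1\<^sub>m (2 * m + 3)"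
  using rep_elem_linear[of m "0 :: 'a"] rep_elem_0[of m, where 'a = 'a] by simp

interpretation rep: gen_system "mat_monoid (2 * m + 3)" "rep_elem m" "rep_torus m" "rep_weyl m :: 'a::field_char_0 poly mat"
  by (rule gen_system.intro[OF monoid_mat_monoid], unfold_locales)
    (simp_all add: mat_monoid_def rep_torus_def rep_weyl_def rep_elem_add rep_elem_0 rep_lin_mult rep_elem_linear mult2_def
      rep_lin_id rep_elem_torus[unfolded rep_torus_def])

section \<open>Normal forms of words\<close>

lemma torus_act_inverse: "a \<noteq> 0 \<Longrightarrow> torus_act a (torus_act (inverse a) p) = p"
  by (rule poly_eqI) (simp add: coeff_torus_act flip: mult.assoc power_mult_distrib del: power_Suc)

lemma degree_torus_act_le: "degree (torus_act a p) \<le> degree p"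
  by (rule degree_le) (simp add: coeff_torus_act coeff_eq_0)

type_synonym 'a nform = "'a poly \<times> 'a \<times> 'a poly list"

text \<open>The triple \<open>(p, a, [q\<^sub>1, \<dots>, q\<^sub>k])\<close> stands for \<open>e(q\<^sub>k) w \<dots> w e(q\<^sub>1) w e(p) d(a)\<close>. It is
  normal if \<open>q\<^sub>1, \<dots>, q\<^sub>k\<^sub>-\<^sub>1\<close> are not linear.\<close>

definition nform_ok :: "nat \<Rightarrow> 'a::field_char_0 nform \<Rightarrow> bool" where
  "nform_ok N = (\<lambda>(p, a, qs). a \<noteq> 0 \<and> (\<forall>q\<in>set (p # qs). coeff q 0 = 0 \<and> degree q < N) \<and>
     (\<forall>q\<in>set (butlast qs). 2 \<le> degree q))"

text \<open>A letter is multiplied on the right. \<open>Weyl\<close> after a linear \<open>p\<close>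
  creates a factor w e(p) w: for \<open>c = 0\<close> it is d(-1) and the list shrinks, otherwise
  \<open>w_e_w\<close> rewrites it with one Weyl element and the list keeps its length.\<close>

fun nform_step :: "'a::field_char_0 nform \<Rightarrow> 'a gen \<Rightarrow> 'a nform" where
  "nform_step (p, a, qs) (Elem q) = (p + torus_act (inverse a) q, a, qs)"
| "nform_step (p, a, qs) (Torus b) = (p, a * b, qs)"
| "nform_step (p, a, []) Weyl = (0, inverse a, [p])"
| "nform_step (p, a, q # qs) Weyl =
     (if 2 \<le> degree p then (0, inverse a, p # q # qs)
      else let c = coeff p 1 in
        if c = 0 then (q, - inverse a, qs)
        else ([:0, - c:], inverse c * inverse a, (q + [:0, - inverse c:]) # qs))"

text \<open>Entries already in the list are changed by linear terms only, which neither destroys a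
  degree of at least 2 nor exceeds a bound \<open>N \<ge> 2\<close>.\<close>

lemma nform_step_ok:
  assumes "nform_ok N s" "gen_ok N g" "2 \<le> N"
  shows "nform_ok N (nform_step s g)"
proof -
  obtain p a qs where s: "s = (p, a, qs)" by (cases s)
  have s': "a \<noteq> 0" "\<And>q. q \<in> set (p # qs) \<Longrightarrow> coeff q 0 = 0" "\<And>q. q \<in> set (p # qs) \<Longrightarrow> degree q < N"
    "\<And>q. q \<in> set (butlast qs) \<Longrightarrow> 2 \<le> degree q"
    using assms(1) unfolding s nform_ok_def by auto
  have lin: "degree [:0, c:] < N" for c :: 'a
    using assms(3) by simp
  have add: "degree (q + r) < N" if "degree q < N" "degree r < N" for q r :: "'a poly"
    using degree_add_le_max[of q r] that by simp
  show ?thesis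
  proof (cases g)
    case (Elem q)
    have "degree (p + torus_act (inverse a) q) < N"
      using s'(3)[of p] assms(2) degree_torus_act_le[of "inverse a" q] by (intro add) (auto simp: Elem)
    then show ?thesis
      using s' assms(2) unfolding s nform_ok_def by (auto simp: Elem coeff_torus_act)
  next
    case (Torus b)
    then show ?thesis
      using s' assms(2) unfolding s nform_ok_def by auto
  next
    case Weyl
    show ?thesis
    proof (cases qs)
      case Nil
      then show ?thesis
        using s' assms(3) unfolding s nform_ok_def Weyl by auto
    next
      case (Cons q rs)
      have q: "coeff q 0 = 0" "degree q < N" "coeff p 0 = 0" "degree p < N"
        using s'(2,3) Cons by auto
      have rs: "\<And>r. r \<in> set rs \<Longrightarrow> coeff r 0 = 0 \<and> degree r < N"
        using s'(2,3) Cons by auto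
      show ?thesis
      proof (cases "2 \<le> degree p")
        case True
        then show ?thesis
          using s' assms(3) unfolding s nform_ok_def Weyl Cons by auto
      next
        case False
        define c where "c = coeff p 1"
        show ?thesis
        proof (cases "c = 0")
          case True
          have "r \<in> set (butlast rs) \<Longrightarrow> 2 \<le> degree r" for r
            using s'(4)[of r] Cons by (cases rs) auto
          then show ?thesis
            using s'(1) False True q rs unfolding s nform_ok_def Weyl Cons c_def by auto
        next
          case c0: False
          have deg: "2 \<le> degree (q + [:0, - inverse c:])" if "rs \<noteq> []"
          proof -
            have "2 \<le> degree q"
              using s'(4)[of q] that Cons by simp
            then have "degree (q + [:0, - inverse c:]) = degree q"
              by (intro degree_add_eq_left) simp
            then show ?thesis using \<open>2 \<le> degree q\<close> by simp
          qed
          have "r \<in> set (butlast ((q + [:0, - inverse c:]) # rs)) \<Longrightarrow> 2 \<le> degree r" for r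
            using s'(4)[of r] deg Cons by (auto split: if_splits)
          moreover have "degree (q + [:0, - inverse c:]) < N"
            by (rule add[OF q(2) lin])
          moreover have "nform_step s g = ([:0, - c:], inverse c * inverse a, (q + [:0, - inverse c:]) # rs)"
            using False c0 unfolding s Weyl Cons c_def by (simp add: Let_def)
          ultimately show ?thesis
            using s'(1) q rs c0 lin[of "- c"] unfolding nform_ok_def by auto
        qed
      qed
    qed
  qed
qed

fun inv_gen :: "'a::field_char_0 gen \<Rightarrow> 'a gen list" where
  "inv_gen (Elem p) = [Elem (- p)]"
| "inv_gen (Torus a) = [Torus (inverse a)]"
| "inv_gen Weyl = [Torus (- 1), Weyl]"

definition inv_word :: "'a::field_char_0 gen list \<Rightarrow> 'a gen list" where
  "inv_word ws = concat (map inv_gen (rev ws))"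

lemma inv_word_simps: "inv_word [] = []" "inv_word (g # ws) = inv_word ws @ inv_gen g"
  by (simp_all add: inv_word_def)

lemma inv_word_ok: "\<forall>g\<in>set ws. gen_ok N g \<Longrightarrow> \<forall>g\<in>set (inv_word ws). gen_ok N g"
proof (induction ws)
  case (Cons g ws)
  then show ?case by (cases g) (auto simp: inv_word_simps)
qed (simp add: inv_word_simps)

context gen_system
begin

fun gval :: "'a gen \<Rightarrow> 'g" where
  "gval (Elem p) = e p"
| "gval (Torus a) = d a"
| "gval Weyl = w"

definition word_val :: "'a gen list \<Rightarrow> 'g" where
  "word_val ws = foldr (\<lambda>g x. gval g \<otimes> x) ws \<one>"

lemma word_val_simps [simp]: "word_val [] = \<one>" "word_val (g # ws) = gval g \<otimes> word_val ws"
  by (simp_all add: word_val_def)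

lemma gval_carrier [simp]: "gval g \<in> carrier G"
  by (cases g) (simp_all add: G_carrier)

lemma word_val_carrier [simp]: "word_val ws \<in> carrier G"
  by (induction ws) simp_all

lemma word_val_append: "word_val (us @ vs) = word_val us \<otimes> word_val vs"
  by (induction us) (simp_all add: m_assoc)

lemma inv_gen_val:
  assumes "gen_ok N g"
  shows "word_val (inv_gen g) \<otimes> gval g = \<one>" "gval g \<otimes> word_val (inv_gen g) = \<one>"
proof -
  have ww: "w \<otimes> (w \<otimes> x) = d (- 1) \<otimes> x" if "x \<in> carrier G" for x
    using that by (simp add: m_assoc[symmetric] G_carrier w_w)
  have dd: "d (- 1) \<otimes> d (- 1) = \<one>"
    using d_mult[of "- 1" "- 1"] by (simp add: d_1)
  have "w \<otimes> (d (- 1) \<otimes> w) = w \<otimes> d (- 1) \<otimes> w"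
    by (simp add: m_assoc G_carrier)
  also have "\<dots> = d (- 1) \<otimes> (w \<otimes> w)"
    using w_d[of "- 1"] by (simp add: m_assoc G_carrier)
  finally have wdw: "w \<otimes> (d (- 1) \<otimes> w) = \<one>"
    by (simp add: w_w dd)
  show "word_val (inv_gen g) \<otimes> gval g = \<one>" "gval g \<otimes> word_val (inv_gen g) = \<one>"
    using assms wdw by (cases g; simp add: G_carrier e_add e_0 d_mult d_1 m_assoc w_w dd)+
qed

lemma inv_word_val:
  assumes "\<forall>g\<in>set ws. gen_ok N g"
  shows "word_val (inv_word ws) \<otimes> word_val ws = \<one>" "word_val ws \<otimes> word_val (inv_word ws) = \<one>"
proof -
  have "word_val (inv_word ws) \<otimes> word_val ws = \<one> \<and> word_val ws \<otimes> word_val (inv_word ws) = \<one>"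
    using assms
  proof (induction ws)
    case (Cons g ws)
    have g: "word_val (inv_gen g) \<otimes> gval g = \<one>" "gval g \<otimes> word_val (inv_gen g) = \<one>"
      using inv_gen_val[of N g] Cons.prems by auto
    have IH: "word_val (inv_word ws) \<otimes> word_val ws = \<one>" "word_val ws \<otimes> word_val (inv_word ws) = \<one>"
      using Cons by auto
    have "word_val (inv_word (g # ws)) \<otimes> word_val (g # ws) =
        word_val (inv_word ws) \<otimes> ((word_val (inv_gen g) \<otimes> gval g) \<otimes> word_val ws)"
      by (simp add: inv_word_simps word_val_append m_assoc)
    moreover have "word_val (g # ws) \<otimes> word_val (inv_word (g # ws)) =
        gval g \<otimes> ((word_val ws \<otimes> word_val (inv_word ws)) \<otimes> word_val (inv_gen g))"
      by (simp add: inv_word_simps word_val_append m_assoc)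
    ultimately show ?case
      using g IH by simp
  qed (simp add: inv_word_simps)
  then show "word_val (inv_word ws) \<otimes> word_val ws = \<one>" "word_val ws \<otimes> word_val (inv_word ws) = \<one>"
    by auto
qed

lemma word_val_eq_iff:
  assumes "\<forall>g\<in>set us. gen_ok N g" "\<forall>g\<in>set vs. gen_ok N g"
  shows "word_val us = word_val vs \<longleftrightarrow> word_val (us @ inv_word vs) = \<one>"
proof
  assume "word_val (us @ inv_word vs) = \<one>"
  then have "word_val us \<otimes> (word_val (inv_word vs) \<otimes> word_val vs) = \<one> \<otimes> word_val vs"
    by (simp add: word_val_append flip: m_assoc)
  then show "word_val us = word_val vs"
    using inv_word_val(1)[OF assms(2)] by simp
qed (use inv_word_val(2)[OF assms(2)] in \<open>simp add: word_val_append\<close>)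

fun qs_val :: "'a poly list \<Rightarrow> 'g" where
  "qs_val [] = \<one>"
| "qs_val (q # qs) = qs_val qs \<otimes> (e q \<otimes> w)"

definition nform_val :: "'a nform \<Rightarrow> 'g" where
  "nform_val = (\<lambda>(p, a, qs). qs_val qs \<otimes> (e p \<otimes> d a))"

lemma qs_val_carrier [simp]: "qs_val qs \<in> carrier G"
  by (induction qs) (simp_all add: G_carrier)

lemma qs_val_snoc: "qs_val (qs @ [r]) = e r \<otimes> (w \<otimes> qs_val qs)"
  by (induction qs) (simp_all add: G_carrier m_assoc)

lemma nform_step_val:
  assumes "nform_ok N s" "gen_ok N g"
  shows "nform_val (nform_step s g) = nform_val s \<otimes> gval g"
proof -
  obtain p a qs where s: "s = (p, a, qs)" by (cases s)
  have a: "a \<noteq> 0" and p0: "coeff p 0 = 0"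
    using assms(1) unfolding s nform_ok_def by auto
  note cl = G_carrier m_closed qs_val_carrier
  show ?thesis
  proof (cases g)
    case (Elem q)
    have "d a \<otimes> e q = e (torus_act (inverse a) q) \<otimes> d a"
      using e_d[OF a, of "torus_act (inverse a) q"] torus_act_inverse[OF a, of q] by simp
    then have "qs_val qs \<otimes> (e p \<otimes> (d a \<otimes> e q)) = qs_val qs \<otimes> ((e p \<otimes> e (torus_act (inverse a) q)) \<otimes> d a)"
      by (simp add: m_assoc cl)
    then show ?thesis
      unfolding s Elem nform_val_def by (simp add: e_add m_assoc cl)
  next
    case (Torus b)
    then show ?thesis
      using assms(2) a unfolding s nform_val_def by (simp add: m_assoc cl d_mult)
  next
    case Weyl
    have dw: "d a \<otimes> w = w \<otimes> d (inverse a)"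
      using w_d[of "inverse a"] a by simp
    have ed: "nform_val s \<otimes> w = qs_val qs \<otimes> (e p \<otimes> (w \<otimes> d (inverse a)))"
      unfolding s nform_val_def by (simp add: m_assoc cl dw)
    have app: "nform_val (0, inverse a, p # qs) = nform_val s \<otimes> w"
      unfolding ed unfolding nform_val_def by (simp add: e_0 m_assoc cl)
    show ?thesis
    proof (cases qs)
      case Nil
      then show ?thesis
        using app unfolding s Weyl by simp
    next
      case (Cons q rs)
      show ?thesis
      proof (cases "2 \<le> degree p")
        case True
        then show ?thesis
          using app unfolding s Weyl Cons by simp
      next
        case False
        define c where "c = coeff p 1"
        have p: "p = [:0, c:]"
        proof (rule poly_eqI)
          fix i show "coeff p i = coeff [:0, c:] i"
            using p0 False by (cases i rule: nat.exhaust; cases "i - 1")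
              (auto simp: c_def coeff_pCons coeff_eq_0 split: nat.split)
        qed
        have ed': "nform_val s \<otimes> w = qs_val rs \<otimes> (e q \<otimes> ((w \<otimes> (e p \<otimes> w)) \<otimes> d (inverse a)))"
          unfolding ed Cons by (simp add: m_assoc cl)
        show ?thesis
        proof (cases "c = 0")
          case True
          then have "w \<otimes> (e p \<otimes> w) = d (- 1)"
            using p by (simp add: e_0 w_w cl)
          then have "nform_val s \<otimes> w = qs_val rs \<otimes> (e q \<otimes> d (- inverse a))"
            unfolding ed' using d_mult[of "- 1" "inverse a"] a by simp
          then show ?thesis
            using False True unfolding s Weyl Cons c_def nform_val_def by (simp add: Let_def)
        next
          case c0: False
          have "torus_act c [:0, - inverse c:] = [:0, - c:]"
            using c0 by (simp add: torus_act_def pcompose_pCons)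
          then have ta: "torus_act (inverse c) [:0, - c:] = [:0, - inverse c:]"
            using torus_act_inverse[of "inverse c" "[:0, - inverse c:]"] c0 by simp
          have "nform_val s \<otimes> w = qs_val rs \<otimes> (e q \<otimes> ((e [:0, - inverse c:] \<otimes>
              (w \<otimes> (d (inverse c) \<otimes> e [:0, - inverse c:]))) \<otimes> d (inverse a)))"
            unfolding ed' p w_e_w[OF c0] ..
          also have "d (inverse c) \<otimes> e [:0, - inverse c:] = e [:0, - c:] \<otimes> d (inverse c)"
            using e_d[of "inverse c" "[:0, - c:]"] c0 ta by simp
          also have "qs_val rs \<otimes> (e q \<otimes> ((e [:0, - inverse c:] \<otimes>
              (w \<otimes> (e [:0, - c:] \<otimes> d (inverse c)))) \<otimes> d (inverse a))) =
            qs_val rs \<otimes> (((e q \<otimes> e [:0, - inverse c:]) \<otimes> w) \<otimes> (e [:0, - c:] \<otimes> (d (inverse c) \<otimes> d (inverse a))))"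
            by (simp add: m_assoc cl del: e_add)
          also have "\<dots> = nform_val ([:0, - c:], inverse c * inverse a, (q + [:0, - inverse c:]) # rs)"
            unfolding e_add nform_val_def using d_mult[of "inverse c" "inverse a"] a c0 by (simp add: m_assoc cl)
          also have "([:0, - c:], inverse c * inverse a, (q + [:0, - inverse c:]) # rs) = nform_step s g"
            using False c0 unfolding s Weyl Cons c_def by (simp add: Let_def)
          finally show ?thesis
            unfolding Weyl by simp
        qed
      qed
    qed
  qed
qed

end

definition nform_of :: "'a::field_char_0 gen list \<Rightarrow> 'a nform" where
  "nform_of ws = foldl nform_step (0, 1, []) ws"

lemma nform_of_ok:
  assumes "2 \<le> N" "\<forall>g\<in>set ws. gen_ok N g"
  shows "nform_ok N (nform_of ws)"
  using assms(2)
proof (induction ws rule: rev_induct)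
  case Nil
  then show ?case using assms(1) by (simp add: nform_of_def nform_ok_def)
next
  case (snoc g ws)
  then show ?case
    using nform_step_ok[OF _ _ assms(1), of "nform_of ws" g] by (simp add: nform_of_def)
qed

lemma (in gen_system) nform_of_val:
  assumes "2 \<le> N" "\<forall>g\<in>set ws. gen_ok N g"
  shows "nform_val (nform_of ws) = word_val ws"
  using assms(2)
proof (induction ws rule: rev_induct)
  case Nil
  show ?case by (simp add: nform_of_def nform_val_def e_0 d_1)
next
  case (snoc g ws)
  then have "nform_val (nform_step (nform_of ws) g) = nform_val (nform_of ws) \<otimes> gval g"
    using nform_step_val[of N "nform_of ws" g] nform_of_ok[OF assms(1), of ws] by simp
  then show ?case
    using snoc by (simp add: nform_of_def word_val_append G_carrier)
qed

lemma plane_monoid_simps [simp]: "mult plane_monoid = plane_comp" "one plane_monoid = plane_id"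
  by (simp_all add: plane_monoid_def)

section \<open>Normal forms on the plane: growth of the total degree\<close>

lemma blowup_subst1: "blowup (subst1 q B) = pcompose (map_poly (\<lambda>c. [:c:]) q) (blowup B)"
proof (induction q)
  case (pCons c q)
  then show ?case
    by (simp add: map_poly_pCons pcompose_pCons)
qed simp

lemma total_degree_subst1: "total_degree (subst1 q B) = degree q * total_degree B"
  for B :: "'a::idom poly poly"
  unfolding total_degree_def blowup_subst1 degree_pcompose
  by (simp add: degree_map_poly)

text \<open>Appending \<open>q\<close> turns the components A, B into B, q(B) - A. Since
  \<open>q\<close> has degree at least 2, q(B) has at least twice the degree of B and cannot cancel
  against A.\<close>

lemma plane_qs_degree:
  assumes "\<forall>q\<in>set qs. 2 \<le> degree q"
  shows "total_degree (fst (plane.qs_val qs)) \<le> total_degree (snd (plane.qs_val qs)) \<and>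
    1 \<le> total_degree (snd (plane.qs_val qs)) \<and> (qs \<noteq> [] \<longrightarrow> 2 \<le> total_degree (snd (plane.qs_val qs)))"
  using assms
proof (induction qs rule: rev_induct)
  case Nil
  show ?case by (simp add: plane_id_def total_degree_def)
next
  case (snoc q qs)
  obtain A B where AB: "plane.qs_val qs = (A, B)" by (cases "plane.qs_val qs")
  have IH: "total_degree A \<le> total_degree B" "1 \<le> total_degree B"
    using snoc AB by auto
  have eq: "plane.qs_val (qs @ [q]) = (B, - A + subst1 q B)"
    unfolding plane.qs_val_snoc AB by (simp add: weyl_comp elem_comp)
  have q: "2 * total_degree B \<le> degree q * total_degree B"
    using snoc.prems by simp
  have lt: "total_degree A < total_degree (subst1 q B)" "2 \<le> total_degree (subst1 q B)"
    "total_degree B \<le> total_degree (subst1 q B)"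
    using q IH total_degree_subst1[of q B] by linarith+
  then have "degree (blowup (- A)) < degree (blowup (subst1 q B))"
    by (simp add: total_degree_def)
  then have "total_degree (- A + subst1 q B) = total_degree (subst1 q B)"
    unfolding total_degree_def blowup_simps(1) by (rule degree_add_eq_right)
  then show ?case
    unfolding eq using lt by simp
qed

text \<open>The outermost factor \<open>r\<close> may be linear, so it is moved to the other side
  together with \<open>p\<close> and \<open>a\<close>. The second component of what remains is then
  a multiple of \<open>var_x\<close>. For a nonempty inner list its total degree 1 contradicts
  \<open>plane_qs_degree\<close>, and for the empty one it would be \<open>var_y\<close>.\<close>

lemma plane_nform_trivial:
  assumes ok: "nform_ok N (p, a, qs)" and triv: "plane.nform_val (p, a, qs) = plane_id"
  shows "(p, a, qs) = (0, 1, [])"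
proof -
  have a: "a \<noteq> 0" and nl: "\<forall>q\<in>set (butlast qs). 2 \<le> degree q"
    using ok unfolding nform_ok_def by auto
  show ?thesis
  proof (cases qs rule: rev_cases)
    case Nil
    have "plane_comp (elem_map p) (torus_map a) = plane_id"
      using triv by (simp add: Nil plane.nform_val_def)
    then have eq: "const2 a * var_x = var_x \<and> const2 (inverse a) * var_y + subst1 p (const2 a * var_x) = var_y"
      unfolding elem_comp torus_map_def plane_id_def fst_conv snd_conv prod.inject .
    then have "a = 1" by simp
    then have "p = 0"
      using eq by (simp add: subst1_var_x one_pCons)
    then show ?thesis
      using \<open>a = 1\<close> Nil by simp
  next
    case (snoc qs' r)
    define V where "V = plane.qs_val qs'"
    obtain A B where AB: "V = (A, B)" by (cases V)
    have deg: "qs' \<noteq> [] \<Longrightarrow> 2 \<le> total_degree B"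
      using plane_qs_degree[of qs'] nl snoc AB unfolding V_def by simp
    have "plane_comp (elem_map r) (plane_comp (plane_comp weyl_map V) (plane_comp (elem_map p) (torus_map a))) = plane_id"
      using triv unfolding snoc plane.nform_val_def V_def by (simp add: plane.qs_val_snoc plane_comp_assoc)
    then have "plane_comp (plane_comp (elem_map (- r)) (elem_map r))
        (plane_comp (plane_comp weyl_map V) (plane_comp (elem_map p) (torus_map a))) = elem_map (- r)"
      by (simp add: plane_comp_assoc)
    then have 1: "plane_comp (plane_comp weyl_map V) (plane_comp (elem_map p) (torus_map a)) = elem_map (- r)"
      by (simp add: elem_map_add elem_map_0)
    have "plane_comp (plane_comp (elem_map p) (torus_map a)) (plane_comp (torus_map (inverse a)) (elem_map (- p))) =
        plane_comp (elem_map p) (plane_comp (plane_comp (torus_map a) (torus_map (inverse a))) (elem_map (- p)))"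
      by (simp only: plane_comp_assoc)
    also have "\<dots> = plane_id"
      using a by (simp add: torus_map_mult torus_map_1 elem_map_add elem_map_0)
    finally have "plane_comp weyl_map V = plane_comp (elem_map (- r)) (plane_comp (torus_map (inverse a)) (elem_map (- p)))"
      unfolding 1[symmetric] plane_comp_assoc[of "plane_comp weyl_map V"] by simp
    then have B: "B = const2 (inverse a) * var_x"
      unfolding AB by (simp add: weyl_comp elem_comp torus_comp) (simp add: elem_map_def)
    show ?thesis
    proof (cases "qs' = []")
      case True
      then have "B = var_y"
        using AB unfolding V_def by (simp add: plane_id_def)
      then show ?thesis
        using B by simp
    next
      case False
      have "blowup B = const2 (inverse a) * [:0, [:0, 1:]:]"
        unfolding B blowup_simps by simp
      then have "total_degree B \<le> 1"
        unfolding total_degree_def by simp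
      then show ?thesis
        using deg[OF False] by simp
    qed
  qed
qed

section \<open>Normal forms as matrices: growth of the degree in t\<close>

lemma coeff_mult_bounds:
  fixes p q :: "'a::comm_ring_1 poly"
  assumes "degree p \<le> a" "degree q \<le> b"
  shows "coeff (p * q) (a + b) = coeff p a * coeff q b"
proof -
  have "coeff (p * q) (a + b) = (\<Sum>i\<le>a + b. coeff p i * coeff q (a + b - i))"
    by (rule coeff_mult)
  also have "\<dots> = (\<Sum>i\<in>{a}. coeff p i * coeff q (a + b - i))"
  proof (rule sum.mono_neutral_right)
    show "\<forall>i\<in>{..a + b} - {a}. coeff p i * coeff q (a + b - i) = 0"
    proof
      fix i assume "i \<in> {..a + b} - {a}"
      then consider "a < i" | "i < a" by force
      then show "coeff p i * coeff q (a + b - i) = 0"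
        using assms by cases (auto simp: coeff_eq_0)
    qed
  qed auto
  finally show ?thesis by simp
qed

text \<open>As i^2 - 1 = (i - 1)(i + 1), the monomial x^i gains the degree i - 1 per index moved,
  against k - 1 for the leading one. The last summand on the left is the deficit over i + 1 indices;
  it is zero only for \<open>i = k\<close>.\<close>

lemma square_weight:
  fixes i k e :: nat
  assumes "1 \<le> i" "i \<le> k" "i \<le> e"
  shows "(i\<^sup>2 - 1) + (k - 1) * (e - i) + (k - i) * Suc i = (k - 1) * Suc e"
proof -
  obtain i' where i: "i = Suc i'" using assms(1) by (cases i) auto
  obtain u where k: "k = i + u" using assms(2) le_iff_add by auto
  obtain v where e: "e = i + v" using assms(3) le_iff_add by auto
  show ?thesis
    unfolding e k i by (simp add: power2_eq_square algebra_simps)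
qed

lemma elem_series_degree:
  assumes "2 \<le> degree q"
  shows "degree (fps_nth (elem_series q) d) \<le> (degree q - 1) * d"
proof (induction d rule: less_induct)
  case (less d)
  show ?case
  proof (cases d)
    case (Suc e)
    let ?k = "degree q"
    have "degree (of_nat (Suc i) * (if i = 0 then 0 else monom (coeff q i) (i\<^sup>2 - 1)) * fps_nth (elem_series q) (e - i))
        \<le> (?k - 1) * Suc e" if i: "i \<le> e" for i
    proof (cases "1 \<le> i \<and> i \<le> ?k")
      case True
      have "degree (of_nat (Suc i) * (if i = 0 then 0 else monom (coeff q i) (i\<^sup>2 - 1)) * fps_nth (elem_series q) (e - i))
        \<le> 0 + (i\<^sup>2 - 1) + (?k - 1) * (e - i)"
        using True Suc by (intro order_trans[OF degree_mult_le] add_mono less)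
          (auto simp: of_nat_poly degree_monom_le simp del: of_nat_Suc)
      then show ?thesis
        using square_weight[of i ?k e] True i by linarith
    next
      case False
      then have "(if i = 0 then 0 else monom (coeff q i) (i\<^sup>2 - 1)) = 0"
        by (auto simp: coeff_eq_0)
      then show ?thesis by simp
    qed
    then have "degree (of_nat (Suc e) * fps_nth (elem_series q) (Suc e)) \<le> (?k - 1) * Suc e"
      unfolding elem_series_Suc by (intro degree_sum_le) auto
    moreover have "degree (of_nat (Suc e) * p) = degree p" for p :: "'a poly"
      by (simp add: of_nat_poly del: of_nat_Suc)
    ultimately show ?thesis
      using Suc by simp
  qed simp
qed

text \<open>Only the leading monomial of \<open>q\<close> realises the extreme growth, and it
  advances the index by \<open>Suc (degree q)\<close>. At multiples of this number the bound of
  \<open>elem_series_degree\<close> is therefore attained.\<close>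

lemma elem_series_lead:
  fixes q :: "'a::field_char_0 poly"
  assumes "2 \<le> degree q"
  shows "coeff (fps_nth (elem_series q) (Suc (degree q) * s)) ((degree q - 1) * (Suc (degree q) * s)) \<noteq> 0"
proof (induction s)
  case (Suc s)
  let ?k = "degree q"
  let ?T = "fps_nth (elem_series q)"
  define e where "e = Suc ?k * s + ?k"
  have Se: "Suc ?k * Suc s = Suc e"
    by (simp add: e_def)
  let ?t = "\<lambda>i. of_nat (Suc i) * (if i = 0 then 0 else monom (coeff q i) (i\<^sup>2 - 1)) * ?T (e - i)"
  have t0: "coeff (?t i) ((?k - 1) * Suc e) = 0" if i: "i \<le> e" "i \<noteq> ?k" for i
  proof (cases "1 \<le> i \<and> i < ?k")
    case True
    have "degree (?t i) \<le> 0 + (i\<^sup>2 - 1) + (?k - 1) * (e - i)"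
      using True by (intro order_trans[OF degree_mult_le] add_mono elem_series_degree[OF assms])
        (auto simp: of_nat_poly degree_monom_le simp del: of_nat_Suc)
    moreover have "0 < (?k - i) * Suc i"
      using True by simp
    ultimately have "degree (?t i) < (?k - 1) * Suc e"
      using square_weight[of i ?k e] True i by linarith
    then show ?thesis
      by (rule coeff_eq_0)
  next
    case False
    then have "(if i = 0 then 0 else monom (coeff q i) (i\<^sup>2 - 1)) = 0"
      using i(2) by (auto simp: coeff_eq_0)
    then show ?thesis by simp
  qed
  have ke: "?k \<le> e" "e - ?k = Suc ?k * s"
    by (simp_all add: e_def)
  have w: "(?k - 1) * Suc e = (?k\<^sup>2 - 1) + (?k - 1) * (Suc ?k * s)"
    using square_weight[of ?k ?k e] assms ke by simp
  have tk: "coeff (?t ?k) ((?k - 1) * Suc e) =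
      of_nat (Suc ?k) * (lead_coeff q * coeff (?T (Suc ?k * s)) ((?k - 1) * (Suc ?k * s)))"
  proof -
    have "?t ?k = of_nat (Suc ?k) * (monom (lead_coeff q) (?k\<^sup>2 - 1) * ?T (Suc ?k * s))"
      using assms unfolding ke(2) by (simp only: mult.assoc) simp
    moreover have "coeff (monom (lead_coeff q) (?k\<^sup>2 - 1) * ?T (Suc ?k * s)) ((?k\<^sup>2 - 1) + (?k - 1) * (Suc ?k * s)) =
        lead_coeff q * coeff (?T (Suc ?k * s)) ((?k - 1) * (Suc ?k * s))"
      by (subst coeff_mult_bounds[OF degree_monom_le elem_series_degree[OF assms]]) simp
    ultimately show ?thesis
      unfolding w by (simp add: of_nat_poly del: of_nat_Suc)
  qed
  have "coeff (of_nat (Suc e) * ?T (Suc e)) ((?k - 1) * Suc e) = (\<Sum>i\<le>e. coeff (?t i) ((?k - 1) * Suc e))"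
    unfolding elem_series_Suc by (rule coeff_sum)
  also have "\<dots> = coeff (?t ?k) ((?k - 1) * Suc e)"
  proof (subst sum.remove[of _ ?k])
    show "?k \<in> {..e}" using ke by simp
    have "(\<Sum>i\<in>{..e} - {?k}. coeff (?t i) ((?k - 1) * Suc e)) = 0"
      by (rule sum.neutral) (use t0 in auto)
    then show "coeff (?t ?k) ((?k - 1) * Suc e) + (\<Sum>i\<in>{..e} - {?k}. coeff (?t i) ((?k - 1) * Suc e)) =
        coeff (?t ?k) ((?k - 1) * Suc e)"
      by (simp only: add_0_right)
  qed simp
  also have "\<dots> \<noteq> 0"
    unfolding tk using Suc.IH assms by (auto simp del: of_nat_Suc)
  finally have "of_nat (Suc e) * coeff (?T (Suc e)) ((?k - 1) * Suc e) \<noteq> 0"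
    by (simp add: of_nat_poly del: of_nat_Suc)
  then show ?case
    unfolding Se by auto
qed simp

lemma mat_monoid_simps [simp]: "mult (mat_monoid n) = (*)" "one (mat_monoid n) = 1\<^sub>m n"
  "carrier (mat_monoid n) = carrier_mat n n"
  by (simp_all add: mat_monoid_def)

lemma mat_mult_index:
  assumes "A \<in> carrier_mat n n" "B \<in> carrier_mat n n" "i < n" "j < n"
  shows "(A * B) $$ (i, j) = (\<Sum>l<n. A $$ (i, l) * B $$ (l, j))"
  using assms by (auto simp: scalar_prod_def atLeast0LessThan)

context
  fixes m N :: nat
  assumes divides: "\<And>k. k < N \<Longrightarrow> Suc k dvd 2 * m + 2"
begin

abbreviation "dm \<equiv> 2 * m + 3"
abbreviation "hi \<equiv> 2 * m + 2"

lemma rep_weyl_carrier [simp]: "rep_weyl m \<in> carrier_mat dm dm"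
  by (simp add: rep_weyl_def)

lemma rep_torus_carrier [simp]: "rep_torus m a \<in> carrier_mat dm dm"
  by (simp add: rep_torus_def)

lemma rep_qs_carrier [simp]: "rep.qs_val m qs \<in> carrier_mat dm dm"
  using rep.qs_val_carrier[of m qs] by simp

lemma mult_rep_weyl_index:
  assumes "A \<in> carrier_mat dm dm" "i < dm" "j < dm"
  shows "(A * rep_weyl m) $$ (i, j) = A $$ (i, hi - j) * rep_weyl m $$ (hi - j, j)"
    and "(rep_weyl m * A) $$ (i, j) = rep_weyl m $$ (i, hi - i) * A $$ (hi - i, j)"
proof -
  have "(\<Sum>l<dm. A $$ (i, l) * rep_weyl m $$ (l, j)) = (\<Sum>l\<in>{hi - j}. A $$ (i, l) * rep_weyl m $$ (l, j))"
    using assms by (intro sum.mono_neutral_right) (auto simp: rep_weyl_index)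
  then show "(A * rep_weyl m) $$ (i, j) = A $$ (i, hi - j) * rep_weyl m $$ (hi - j, j)"
    unfolding mat_mult_index[OF assms(1) rep_weyl_carrier assms(2,3)] by simp
  have "(\<Sum>l<dm. rep_weyl m $$ (i, l) * A $$ (l, j)) = (\<Sum>l\<in>{hi - i}. rep_weyl m $$ (i, l) * A $$ (l, j))"
    using assms by (intro sum.mono_neutral_right) (auto simp: rep_weyl_index)
  then show "(rep_weyl m * A) $$ (i, j) = rep_weyl m $$ (i, hi - i) * A $$ (hi - i, j)"
    unfolding mat_mult_index[OF rep_weyl_carrier assms(1) assms(2,3)] by simp
qed

lemma rep_weyl_entry:
  assumes "i \<le> hi"
  obtains u where "u \<noteq> 0" "rep_weyl m $$ (i, hi - i) = [:u:]"
  using assms that[of "(- 1) ^ (m + 1 - i mod 2 - i div 2)"] by (simp add: rep_weyl_index)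

lemma rep_elem_degree:
  assumes "2 \<le> degree q" "i < dm" "j < dm"
  shows "degree (rep_elem m q $$ (i, j)) \<le> (degree q - 1) * (j - i)"
  using assms elem_series_degree[OF assms(1), of "j - i"]
  by (auto simp: rep_elem_def intro: order_trans[OF degree_smult_le])

text \<open>By \<open>divides\<close> the offset \<open>hi\<close> of the corner is a multiple of
  \<open>Suc (degree q)\<close>, so \<open>elem_series_lead\<close> applies.\<close>

lemma rep_elem_top:
  assumes "2 \<le> degree q" "degree q < N"
  shows "coeff (rep_elem m q $$ (0, hi)) ((degree q - 1) * hi) \<noteq> 0"
proof -
  obtain s where s: "hi = Suc (degree q) * s"
    using divides[OF assms(2)] by (auto elim: dvdE)
  have "coeff (fps_nth (elem_series q) hi) ((degree q - 1) * hi) \<noteq> 0"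
    unfolding s by (rule elem_series_lead[OF assms(1)])
  then show ?thesis
    by (simp add: rep_elem_def)
qed

text \<open>The exponents of \<open>t\<close> in \<open>rep_elem\<close> are chosen such that the corner entry strictly dominates;
  as \<open>rep_weyl\<close> exchanges both ends of the basis, the corner entries of the factors multiply.\<close>

lemma rep_qs_corner:
  assumes "\<forall>q\<in>set (q # qs). 2 \<le> degree q \<and> degree q < N"
  shows "\<exists>\<delta>. (\<forall>i<dm. \<forall>j<dm. degree ((rep.qs_val m qs * rep_elem m q) $$ (i, j)) \<le> \<delta>) \<and>
    coeff ((rep.qs_val m qs * rep_elem m q) $$ (0, hi)) \<delta> \<noteq> 0"
  using assms
proof (induction qs arbitrary: q)
  case Nil
  then have q: "2 \<le> degree q" "degree q < N" by auto
  have "degree (rep_elem m q $$ (i, j)) \<le> (degree q - 1) * hi" if "i < dm" "j < dm" for i j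
  proof -
    have "(degree q - 1) * (j - i) \<le> (degree q - 1) * hi"
      using that(2) by (intro mult_le_mono2) simp
    then show ?thesis
      using rep_elem_degree[OF q(1) that] by (rule order_trans[rotated])
  qed
  then show ?case
    using rep_elem_top[OF q] left_mult_one_mat[OF rep_elem_carrier[of m q]]
    by (intro exI[of _ "(degree q - 1) * hi"]) simp
next
  case (Cons q' qs)
  have q: "2 \<le> degree q" "degree q < N"
    using Cons.prems by auto
  define Z' where "Z' = rep.qs_val m qs * rep_elem m q'"
  obtain \<delta> where \<delta>: "\<And>i j. i < dm \<Longrightarrow> j < dm \<Longrightarrow> degree (Z' $$ (i, j)) \<le> \<delta>" "coeff (Z' $$ (0, hi)) \<delta> \<noteq> 0"
    using Cons.IH[of q'] Cons.prems unfolding Z'_def by auto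
  have cZ': "Z' \<in> carrier_mat dm dm"
    unfolding Z'_def using rep_qs_carrier rep_elem_carrier by (rule mult_carrier_mat)
  have cZW: "Z' * rep_weyl m \<in> carrier_mat dm dm"
    using cZ' rep_weyl_carrier by (rule mult_carrier_mat)
  have Z: "rep.qs_val m (q' # qs) * rep_elem m q = (Z' * rep_weyl m) * rep_elem m q"
    unfolding Z'_def by (simp add: assoc_mult_mat[of _ dm dm _ dm _ dm])
  have ent: "\<exists>u. u \<noteq> 0 \<and> (Z' * rep_weyl m) $$ (i, l) = smult u (Z' $$ (i, hi - l))" if "i < dm" "l < dm" for i l
  proof -
    obtain u where "u \<noteq> 0" "rep_weyl m $$ (hi - l, hi - (hi - l)) = [:u :: 'a:]"
      using rep_weyl_entry[of "hi - l"] by auto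
    then show ?thesis
      using mult_rep_weyl_index(1)[OF cZ' that] that by (intro exI[of _ u]) simp
  qed
  have degZW: "degree ((Z' * rep_weyl m) $$ (i, l)) \<le> \<delta>" if il: "i < dm" "l < dm" for i l
  proof -
    obtain u where "(Z' * rep_weyl m) $$ (i, l) = smult u (Z' $$ (i, hi - l))"
      using ent[OF il] by blast
    then show ?thesis
      using \<delta>(1)[of i "hi - l"] il by (simp add: order_trans[OF degree_smult_le])
  qed
  let ?\<epsilon> = "(degree q - 1) * hi"
  have trm: "degree ((Z' * rep_weyl m) $$ (i, l) * rep_elem m q $$ (l, j)) \<le> \<delta> + (degree q - 1) * (j - l)"
    if "i < dm" "l < dm" "j < dm" for i l j
    using degZW[OF that(1,2)] rep_elem_degree[OF q(1) that(2,3)] by (intro order_trans[OF degree_mult_le] add_mono)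
  have idx: "(rep.qs_val m (q' # qs) * rep_elem m q) $$ (i, j) =
      (\<Sum>l<dm. (Z' * rep_weyl m) $$ (i, l) * rep_elem m q $$ (l, j))" if "i < dm" "j < dm" for i j
    unfolding Z by (rule mat_mult_index[OF cZW rep_elem_carrier that])
  have "degree ((rep.qs_val m (q' # qs) * rep_elem m q) $$ (i, j)) \<le> \<delta> + ?\<epsilon>" if ij: "i < dm" "j < dm" for i j
    unfolding idx[OF ij]
  proof (rule degree_sum_le)
    fix l assume "l \<in> {..<dm}"
    then have l: "l < dm" by simp
    have "(degree q - 1) * (j - l) \<le> ?\<epsilon>"
      using ij(2) by (intro mult_le_mono2) simp
    then show "degree ((Z' * rep_weyl m) $$ (i, l) * rep_elem m q $$ (l, j)) \<le> \<delta> + ?\<epsilon>"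
      using trm[OF ij(1) l ij(2)] by simp
  qed simp
  moreover have "coeff ((rep.qs_val m (q' # qs) * rep_elem m q) $$ (0, hi)) (\<delta> + ?\<epsilon>) \<noteq> 0"
  proof -
    \<comment> \<open>Every \<open>l\<close> other than 0 shortens the offset to
      \<open>hi - l\<close> and loses degree, since \<open>degree q - 1\<close> is positive. A
      single summand of top degree remains.\<close>
    have zero: "coeff ((Z' * rep_weyl m) $$ (0, l) * rep_elem m q $$ (l, hi)) (\<delta> + ?\<epsilon>) = 0"
      if l: "l < dm" "l \<noteq> 0" for l
    proof (rule coeff_eq_0)
      have "(degree q - 1) * (hi - l) < ?\<epsilon>"
        using q(1) l by (intro mult_strict_left_mono) auto
      then show "degree ((Z' * rep_weyl m) $$ (0, l) * rep_elem m q $$ (l, hi)) < \<delta> + ?\<epsilon>"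
        using trm[of 0 l hi] l by simp
    qed
    have "coeff ((rep.qs_val m (q' # qs) * rep_elem m q) $$ (0, hi)) (\<delta> + ?\<epsilon>) =
        (\<Sum>l<dm. coeff ((Z' * rep_weyl m) $$ (0, l) * rep_elem m q $$ (l, hi)) (\<delta> + ?\<epsilon>))"
      by (subst idx) (simp_all add: coeff_sum)
    also have "\<dots> = (\<Sum>l\<in>{0}. coeff ((Z' * rep_weyl m) $$ (0, l) * rep_elem m q $$ (l, hi)) (\<delta> + ?\<epsilon>))"
      by (rule sum.mono_neutral_right) (use zero in auto)
    also have "\<dots> = coeff ((Z' * rep_weyl m) $$ (0, 0)) \<delta> * coeff (rep_elem m q $$ (0, hi)) ?\<epsilon>"
      using coeff_mult_bounds[OF degZW[of 0 0] rep_elem_degree[OF q(1), of 0 hi]] by simp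
    also have "\<dots> \<noteq> 0"
      using ent[of 0 0] \<delta>(2) rep_elem_top[OF q] by auto
    finally show ?thesis .
  qed
  ultimately show ?case
    by blast
qed

lemma rep_elem_lower: "j < i \<Longrightarrow> i < dm \<Longrightarrow> rep_elem m q $$ (i, j) = 0"
  by (simp add: rep_elem_def)

text \<open>With a nonempty list, \<open>rep_weyl m * V\<close> would be a product of upper
  triangular matrices, so its lower left entry is 0. As \<open>rep_weyl m\<close> is antidiagonal,
  this entry is a unit times the entry of \<open>V\<close> at (0, 0), which is 1 for an empty inner
  list and otherwise a unit times the corner entry that \<open>rep_qs_corner\<close> shows to be
  nonzero.\<close>

lemma rep_nform_trivial:
  fixes p :: "'a::field_char_0 poly"
  assumes ok: "nform_ok N (p, a, qs)" and triv: "rep.nform_val m (p, a, qs) = 1\<^sub>m dm"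
  shows "(p, a, qs) = (0, 1, [])"
proof -
  have a: "a \<noteq> 0" and nl: "\<forall>q\<in>set (butlast qs). 2 \<le> degree q" and p: "coeff p 0 = 0" "degree p < N"
    and N: "\<forall>q\<in>set qs. degree q < N"
    using ok unfolding nform_ok_def by auto
  note c = rep_elem_carrier rep_torus_carrier rep_weyl_carrier rep_qs_carrier
  note assoc = assoc_mult_mat[of _ dm dm _ dm _ dm]
  show ?thesis
  proof (cases qs rule: rev_cases)
    case Nil
    have t: "rep_elem m p * rep_torus m a = 1\<^sub>m dm"
      using triv by (simp add: Nil rep.nform_val_def mult_carrier_mat[of _ dm dm _ dm] left_mult_one_mat[of _ dm dm])
    have ent: "rep_elem m p $$ (i, j) * [:a ^ j / a ^ (m + 1):] = (if i = j then 1 else 0)" if "i < dm" "j < dm" for i j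
    proof -
      have "(\<Sum>l<dm. rep_elem m p $$ (i, l) * rep_torus m a $$ (l, j)) =
          (\<Sum>l\<in>{j}. rep_elem m p $$ (i, l) * rep_torus m a $$ (l, j))"
        using that a by (intro sum.mono_neutral_right) (auto simp: rep_torus_index)
      then have "(rep_elem m p * rep_torus m a) $$ (i, j) = rep_elem m p $$ (i, j) * [:a ^ j / a ^ (m + 1):]"
        unfolding mat_mult_index[OF c(1,2) that] using that a by (simp add: rep_torus_index)
      then show ?thesis
        unfolding t using that by simp
    qed
    have diag: "rep_elem m p $$ (i, i) = 1" if "i < dm" for i
      using that by (simp add: rep_elem_def)
    \<comment> \<open>Two neighbouring torus weights are trivial, and their quotient is
      \<open>a\<close>; weights of one parity would not distinguish \<open>a\<close> from
      \<open>- a\<close>.\<close>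
    have "[:1 / a ^ (m + 1):] = 1" "[:a / a ^ (m + 1):] = 1"
      using ent[of 0 0] ent[of 1 1] diag[of 0] diag[of 1] by simp_all
    then have "a ^ (m + 1) = 1" "a = a ^ (m + 1)"
      using a by (simp_all add: one_pCons divide_eq_1_iff)
    then have a1: "a = 1" by simp
    have off: "rep_elem m p $$ (i, j) = 0" if "i < dm" "j < dm" "i \<noteq> j" for i j
      using ent[OF that(1,2)] that(3) by (simp add: a1)
    have "degree p < 2"
    proof (rule ccontr)
      assume "\<not> degree p < 2"
      then have "coeff (rep_elem m p $$ (0, hi)) ((degree p - 1) * hi) \<noteq> 0"
        using p(2) by (intro rep_elem_top) auto
      then show False
        using off[of 0 hi] by simp
    qed
    then have pl: "p = [:0, coeff p 1:]"
      using p(1) by (intro poly_eqI) (auto simp: coeff_pCons coeff_eq_0 split: nat.split)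
    have "rep_elem m [:0, coeff p 1:] $$ (0, 2) = 0"
      using off[of 0 2] pl by simp
    then have "coeff p 1 = 0"
      by (simp add: rep_elem_def elem_series_linear)
    then show ?thesis
      using pl a1 Nil by simp
  next
    case (snoc qs' r)
    define V where "V = rep.qs_val m qs'"
    have cV: "V \<in> carrier_mat dm dm"
      unfolding V_def by (rule rep_qs_carrier)
    have qs': "\<forall>q\<in>set qs'. 2 \<le> degree q \<and> degree q < N"
      using nl N snoc by auto
    define R where "R = rep_elem m p * rep_torus m a"
    define R' where "R' = rep_torus m (inverse a) * rep_elem m (- p)"
    have cR: "R \<in> carrier_mat dm dm" "R' \<in> carrier_mat dm dm"
      unfolding R_def R'_def by (simp_all add: mult_carrier_mat[of _ dm dm _ dm])
    have RR': "R * R' = 1\<^sub>m dm"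
    proof -
      have "R * R' = rep_elem m p * ((rep_torus m a * rep_torus m (inverse a)) * rep_elem m (- p))"
        unfolding R_def R'_def by (simp add: assoc mult_carrier_mat[of _ dm dm _ dm])
      also have "rep_torus m a * rep_torus m (inverse a) = 1\<^sub>m dm"
        using rep.d_mult[of a "inverse a" m] rep.d_1[of m, where 'a = 'a] a by simp
      finally show ?thesis
        by (simp add: left_mult_one_mat[of _ dm dm] rep_elem_add rep_elem_0)
    qed
    have "rep_elem m r * (rep_weyl m * V) * R = 1\<^sub>m dm"
      using triv unfolding snoc rep.nform_val_def prod.case rep.qs_val_snoc R_def V_def by simp
    then have "rep_elem m (- r) * (rep_elem m r * (rep_weyl m * V) * R) * R' = rep_elem m (- r) * R'"
      by (simp add: right_mult_one_mat[of _ dm dm])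
    moreover have "rep_elem m (- r) * (rep_elem m r * (rep_weyl m * V) * R) * R' =
        (rep_elem m (- r) * rep_elem m r) * (rep_weyl m * V) * (R * R')"
      using cV cR by (simp add: assoc mult_carrier_mat[of _ dm dm _ dm])
    ultimately have WV: "rep_weyl m * V = rep_elem m (- r) * R'"
      unfolding RR' rep_elem_add using mult_carrier_mat[OF c(3) cV]
      by (simp add: rep_elem_0 left_mult_one_mat[of _ dm dm] right_mult_one_mat[of _ dm dm])
    have lowR': "R' $$ (i, 0) = 0" if "0 < i" "i < dm" for i
    proof -
      have "(rep_torus m (inverse a) * rep_elem m (- p)) $$ (i, 0) =
          (\<Sum>l<dm. rep_torus m (inverse a) $$ (i, l) * rep_elem m (- p) $$ (l, 0))"
        using that by (intro mat_mult_index[OF c(2,1)]) auto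
      also have "\<dots> = 0"
      proof (rule sum.neutral, rule ballI)
        fix l assume "l \<in> {..<dm}"
        then show "rep_torus m (inverse a) $$ (i, l) * rep_elem m (- p) $$ (l, 0) = 0"
          using that a rep_elem_lower[of 0 l "- p"] by (cases "l = i") (auto simp: rep_torus_index)
      qed
      finally show ?thesis
        unfolding R'_def .
    qed
    have "(rep_elem m (- r) * R') $$ (hi, 0) = (\<Sum>l<dm. rep_elem m (- r) $$ (hi, l) * R' $$ (l, 0))"
      by (intro mat_mult_index[OF c(1) cR(2)]) auto
    also have "\<dots> = 0"
    proof (rule sum.neutral, rule ballI)
      fix l assume "l \<in> {..<dm}"
      then show "rep_elem m (- r) $$ (hi, l) * R' $$ (l, 0) = 0"
        using lowR'[of l] rep_elem_lower[of 0 hi "- r"] by (cases "l = 0") auto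
    qed
    finally have "rep_weyl m $$ (hi, hi - hi) * V $$ (hi - hi, 0) = 0"
      unfolding WV[symmetric] using mult_rep_weyl_index(2)[OF cV, of hi 0] by simp
    then have V00: "V $$ (0, 0) = 0"
      using rep_weyl_entry[of hi] by (metis diff_self_eq_0 mult_eq_0_iff order_refl pCons_eq_0_iff)
    show ?thesis
    proof (cases qs')
      case Nil
      then show ?thesis
        using V00 unfolding V_def by simp
    next
      case (Cons q qs'')
      define Z where "Z = rep.qs_val m qs'' * rep_elem m q"
      have cZ: "Z \<in> carrier_mat dm dm"
        unfolding Z_def by (simp add: mult_carrier_mat[of _ dm dm _ dm])
      have "V = Z * rep_weyl m"
        unfolding V_def Z_def Cons by (simp add: assoc)
      then have "Z $$ (0, hi) * rep_weyl m $$ (hi, hi - hi) = 0"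
        using V00 mult_rep_weyl_index(1)[OF cZ, of 0 0] by simp
      then have "Z $$ (0, hi) = 0"
        using rep_weyl_entry[of hi] by (metis mult_eq_0_iff order_refl pCons_eq_0_iff)
      moreover obtain \<delta> where "coeff (Z $$ (0, hi)) \<delta> \<noteq> 0"
        using rep_qs_corner[of q qs''] qs' unfolding Z_def Cons by auto
      ultimately show ?thesis
        by simp
    qed
  qed
qed

end

lemma nform_val_base: "plane.nform_val (0, 1, []) = plane_id" "rep.nform_val m (0, 1, []) = 1\<^sub>m (2 * m + 3)"
  using plane.nform_of_val[of 2 "[]"] rep.nform_of_val[of 2 "[]" m]
  by (simp_all add: nform_of_def)

lemma plane_word_val: "plane_word ws = plane.word_val ws"
proof (induction ws)
  case (Cons g ws)
  have "plane_gen g = plane.gval g"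
    by (cases g) simp_all
  then show ?case
    using Cons by simp
qed simp

text \<open>Normal forms are computed from the letters, without reference to a group. In both groups
  a word is trivial precisely if its normal form is the trivial triple, so the two groups have the
  same relations between words of bounded degree.\<close>

lemma plane_word_eq_iff:
  fixes us vs :: "'a::field_char_0 gen list"
  assumes N: "2 \<le> N" "\<And>k. k < N \<Longrightarrow> Suc k dvd 2 * m + 2"
    and ok: "\<forall>g\<in>set us. gen_ok N g" "\<forall>g\<in>set vs. gen_ok N g"
  shows "plane_word us = plane_word vs \<longleftrightarrow> rep.word_val m us = rep.word_val m vs"
proof -
  define ws where "ws = us @ inv_word vs"
  have ws: "\<forall>g\<in>set ws. gen_ok N g"
    using ok(1) inv_word_ok[OF ok(2)] unfolding ws_def by auto
  obtain p a qs where nf: "nform_of ws = (p, a, qs)"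
    by (cases "nform_of ws")
  have nok: "nform_ok N (p, a, qs)"
    using nform_of_ok[OF N(1) ws] unfolding nf .
  have "plane.word_val ws = plane_id \<longleftrightarrow> (p, a, qs) = (0, 1, [])"
    using plane.nform_of_val[OF N(1) ws] plane_nform_trivial[OF nok] nform_val_base(1) unfolding nf by metis
  moreover have "rep.word_val m ws = 1\<^sub>m (2 * m + 3) \<longleftrightarrow> (p, a, qs) = (0, 1, [])"
    using rep.nform_of_val[OF N(1) ws, of m] rep_nform_trivial[OF N(2) nok] nform_val_base(2)[of m] unfolding nf by metis
  ultimately show ?thesis
    using plane.word_val_eq_iff[OF ok] rep.word_val_eq_iff[OF ok, of m]
    unfolding plane_word_val ws_def by simp
qed

section \<open>Finitely generated subgroups\<close>

lemma gen_ok_mono: "gen_ok N g \<Longrightarrow> N \<le> N' \<Longrightarrow> gen_ok N' g"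
  by (cases g) auto

lemma word_ok_mono: "\<forall>g\<in>set ws. gen_ok N g \<Longrightarrow> N \<le> N' \<Longrightarrow> \<forall>g\<in>set ws. gen_ok N' g"
  using gen_ok_mono by blast

lemma word_bound: "\<forall>g\<in>set ws. \<exists>N. gen_ok N g \<Longrightarrow> \<exists>N. \<forall>g\<in>set ws. gen_ok N g"
proof (induction ws)
  case (Cons g ws)
  then obtain N N' where "\<forall>g\<in>set ws. gen_ok N g" "gen_ok N' g"
    by auto
  then have "\<forall>g\<in>set (g # ws). gen_ok (max N N') g"
    by (auto intro: gen_ok_mono)
  then show ?case ..
qed simp

lemma finite_words:
  assumes "finite A" "A \<subseteq> carrier (SAut0_plane :: 'a::field_char_0 plane_map monoid)"
  shows "\<exists>N. \<forall>\<phi>\<in>A. \<exists>ws. (\<forall>g\<in>set ws. gen_ok N g) \<and> plane_word ws = \<phi>"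
  using assms
proof (induction A)
  case (insert \<phi> A)
  obtain N where N: "\<forall>\<phi>\<in>A. \<exists>ws. (\<forall>g\<in>set ws. gen_ok N g) \<and> plane_word ws = \<phi>"
    using insert by auto
  obtain ws where "\<forall>g\<in>set ws. \<exists>N. gen_ok N g" and ws: "plane_word ws = \<phi>"
    using SAut0_plane_word[of \<phi>] insert.prems by auto
  then obtain N' where N': "\<forall>g\<in>set ws. gen_ok N' g"
    using word_bound by blast
  have "\<exists>ws. (\<forall>g\<in>set ws. gen_ok (max N N') g) \<and> plane_word ws = \<psi>" if "\<psi> \<in> insert \<phi> A" for \<psi>
  proof (cases "\<psi> = \<phi>")
    case True
    then show ?thesis
      using ws word_ok_mono[OF N' max.cobounded2[of N' N]] by (intro exI[of _ ws]) simp
  next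
    case False
    then have "\<psi> \<in> A"
      using that by simp
    from bspec[OF N this] obtain us where "\<forall>g\<in>set us. gen_ok N g" "plane_word us = \<psi>"
      by (elim exE conjE)
    then show ?thesis
      using word_ok_mono[OF _ max.cobounded1[of N N'], of us] by (intro exI[of _ us]) simp
  qed
  then show ?case by blast
qed simp

lemma plane_word_SAut0:
  "\<forall>g\<in>set ws. gen_ok N g \<Longrightarrow> plane_word ws \<in> carrier (SAut0_plane :: 'a::field_char_0 plane_map monoid)"
proof (induction ws)
  case Nil
  show ?case
    by (simp add: carrier_SAut0I[of plane_id] plane_apply_id)
next
  case (Cons g ws)
  then show ?case
    using SAut0_comp[OF plane_gen_SAut0, of N g] by simp
qed

lemma generate_plane_word:
  assumes "\<phi> \<in> generate SAut0_plane A"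
    and A: "\<forall>\<phi>\<in>A. \<exists>ws. (\<forall>g\<in>set ws. gen_ok N g) \<and> plane_word ws = \<phi>"
  shows "\<exists>ws. (\<forall>g\<in>set ws. gen_ok N g) \<and> plane_word ws = (\<phi> :: 'a::field_char_0 plane_map)"
  using assms(1)
proof induction
  case one
  show ?case
    by (rule exI[of _ "[]"]) simp
next
  case (incl \<phi>)
  then show ?case using A by blast
next
  case (inv \<phi>)
  then obtain ws where ws: "\<forall>g\<in>set ws. gen_ok N g" "plane_word ws = \<phi>"
    using A by blast
  have "plane_comp (plane_word (inv_word ws)) (plane_word ws) = plane_id"
    using plane.inv_word_val(1)[OF ws(1)] unfolding plane_word_val by simp
  then have "inv\<^bsub>SAut0_plane\<^esub> \<phi> = plane_word (inv_word ws)"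
    using group.inv_equality[OF group_SAut0_plane, of "plane_word (inv_word ws)" \<phi>]
      plane_word_SAut0[OF ws(1)] plane_word_SAut0[OF inv_word_ok[OF ws(1)]] ws(2) by simp
  then show ?case
    using inv_word_ok[OF ws(1)] by auto
next
  case (eng \<phi> \<psi>)
  then obtain us vs where "\<forall>g\<in>set us. gen_ok N g" "plane_word us = \<phi>" "\<forall>g\<in>set vs. gen_ok N g" "plane_word vs = \<psi>"
    by blast
  then show ?case
    by (intro exI[of _ "us @ vs"]) (auto simp: plane_word_append)
qed

definition const_fract :: "'a::idom \<Rightarrow> 'a fract" where
  "const_fract p = Fract p 1"

interpretation const_fract: semiring_hom const_fract
  by unfold_locales (simp_all add: const_fract_def Zero_fract_def One_fract_def)

lemma inj_const_fract: "const_fract p = const_fract q \<longleftrightarrow> p = q"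
  by (simp add: const_fract_def eq_fract)

lemma inj_map_mat_const_fract:
  assumes "map_mat const_fract A = map_mat const_fract B"
  shows "A = B"
proof (rule eq_matI)
  show d: "dim_row A = dim_row B" "dim_col A = dim_col B"
    using arg_cong[OF assms, of dim_row] arg_cong[OF assms, of dim_col] by simp_all
  fix i j assume "i < dim_row B" "j < dim_col B"
  then show "A $$ (i, j) = B $$ (i, j)"
    using arg_cong[OF assms, of "\<lambda>M. M $$ (i, j)"] d by (simp add: inj_const_fract)
qed

lemma mult_GL: "mult (GL n) = (*)"
  by (simp add: GL_def units_of_def)

lemma finitely_generated_SAut0_linear:
  fixes H :: "'a::field_char_0 plane_map set"
  assumes "subgroup H SAut0_plane" "finite A" "A \<subseteq> carrier SAut0_plane" "H = generate SAut0_plane A"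
  shows "linear_over TYPE('a poly fract) (SAut0_plane\<lparr>carrier := H\<rparr>)"
proof -
  obtain N0 where "\<forall>\<phi>\<in>A. \<exists>ws. (\<forall>g\<in>set ws. gen_ok N0 g) \<and> plane_word ws = \<phi>"
    using finite_words[OF assms(2,3)] by blast
  then have A: "\<forall>\<phi>\<in>A. \<exists>ws. (\<forall>g\<in>set ws. gen_ok (max 2 N0) g) \<and> plane_word ws = \<phi>"
    using word_ok_mono[of _ N0 "max 2 N0"] by (meson max.cobounded2)
  \<comment> \<open>The bound is at least 2 because the reduction to normal form introduces linear
    polynomials, whose degree must lie below it.\<close>
  define N where "N = max 2 N0"
  \<comment> \<open>With this choice \<open>2 * m + 2\<close> is \<open>2 * fact N\<close>, a
    multiple of every \<open>Suc k\<close> with \<open>k < N\<close>.\<close>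
  define m where "m = (fact N :: nat) - 1"
  let ?n = "2 * m + 3"
  have N2: "2 \<le> N" unfolding N_def by simp
  have m: "Suc k dvd 2 * m + 2" if "k < N" for k
  proof -
    have "Suc k dvd (fact N :: nat)"
      using that by (intro dvd_fact) auto
    moreover have "2 * m + 2 = 2 * (fact N :: nat)"
      using fact_ge_1[of N, where 'a = nat] unfolding m_def by linarith
    ultimately show ?thesis
      by simp
  qed
  \<comment> \<open>The matrix of \<open>\<phi>\<close> is read off from an arbitrary word
    representing it. By \<open>plane_word_eq_iff\<close> it does not depend on the word, which
    yields multiplicativity, and it determines the plane map, which yields injectivity.\<close>
  define W where "W \<phi> = (SOME ws. (\<forall>g\<in>set ws. gen_ok N g) \<and> plane_word ws = \<phi>)" for \<phi> :: "'a plane_map"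
  have W: "\<forall>g\<in>set (W \<phi>). gen_ok N g" "plane_word (W \<phi>) = \<phi>" if "\<phi> \<in> H" for \<phi>
    using someI_ex[OF generate_plane_word[of \<phi> A N]] that A unfolding W_def N_def assms(4) by blast+
  define \<rho> where "\<rho> \<phi> = map_mat const_fract (rep.word_val m (W \<phi>))" for \<phi>
  have carrier: "rep.word_val m ws \<in> carrier_mat ?n ?n" for ws :: "'a gen list"
    using rep.word_val_carrier[of m ws] by simp
  have hom_mult: "map_mat const_fract (rep.word_val m us * rep.word_val m vs) =
      map_mat const_fract (rep.word_val m us) * map_mat const_fract (rep.word_val m vs)" for us vs :: "'a gen list"
    by (rule const_fract.mat_hom_mult[OF carrier carrier])
  have GL: "\<rho> \<phi> \<in> carrier (GL ?n)" if "\<phi> \<in> H" for \<phi>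
  proof -
    let ?v = "map_mat const_fract (rep.word_val m (inv_word (W \<phi>)))"
    have "rep.word_val m (inv_word (W \<phi>)) * rep.word_val m (W \<phi>) = 1\<^sub>m ?n"
      "rep.word_val m (W \<phi>) * rep.word_val m (inv_word (W \<phi>)) = 1\<^sub>m ?n"
      using rep.inv_word_val[OF W(1)[OF that], of m] by simp_all
    then have "?v * \<rho> \<phi> = 1\<^sub>m ?n" "\<rho> \<phi> * ?v = 1\<^sub>m ?n"
      unfolding \<rho>_def hom_mult[symmetric] by (simp_all add: const_fract.mat_hom_one)
    moreover have "?v \<in> carrier_mat ?n ?n" "\<rho> \<phi> \<in> carrier_mat ?n ?n"
      unfolding \<rho>_def using carrier by simp_all
    ultimately show ?thesis
      unfolding GL_def units_of_def Units_def by auto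
  qed
  have eq: "rep.word_val m us = rep.word_val m vs \<longleftrightarrow> plane_word us = plane_word vs"
    if "\<forall>g\<in>set us. gen_ok N g" "\<forall>g\<in>set vs. gen_ok N g" for us vs :: "'a gen list"
    using plane_word_eq_iff[OF N2 m that] by simp
  have "\<rho> (plane_comp \<phi> \<psi>) = \<rho> \<phi> * \<rho> \<psi>" if "\<phi> \<in> H" "\<psi> \<in> H" for \<phi> \<psi>
  proof -
    have c: "plane_comp \<phi> \<psi> \<in> H"
      using subgroup.m_closed[OF assms(1) that] by simp
    have "\<forall>g\<in>set (W \<phi> @ W \<psi>). gen_ok N g"
      using W(1)[OF that(1)] W(1)[OF that(2)] by (simp add: ball_Un)
    then have "rep.word_val m (W (plane_comp \<phi> \<psi>)) = rep.word_val m (W \<phi> @ W \<psi>)"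
      using eq[OF W(1)[OF c]] by (simp only: plane_word_append W(2)[OF c] W(2)[OF that(1)] W(2)[OF that(2)])
    then show ?thesis
      unfolding \<rho>_def by (simp add: rep.word_val_append hom_mult)
  qed
  moreover have "inj_on \<rho> H"
  proof (rule inj_onI)
    fix \<phi> \<psi> assume H: "\<phi> \<in> H" "\<psi> \<in> H" and \<rho>: "\<rho> \<phi> = \<rho> \<psi>"
    have "rep.word_val m (W \<phi>) = rep.word_val m (W \<psi>)"
      using \<rho> unfolding \<rho>_def by (rule inj_map_mat_const_fract)
    then show "\<phi> = \<psi>"
      using eq[OF W(1)[OF H(1)] W(1)[OF H(2)]] W(2)[OF H(1)] W(2)[OF H(2)] by simp
  qed
  ultimately have "\<rho> \<in> mon (SAut0_plane\<lparr>carrier := H\<rparr>) (GL ?n)"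
    using GL unfolding mon_def hom_def mult_GL by (simp add: Pi_def del: split_paired_All)
  then show ?thesis
    unfolding linear_over_def by (intro exI[of _ ?n]) auto
qed

theorem theoremC:
  shows "\<not> linear_over TYPE('r::{comm_ring, comm_monoid_mult})
           (subgroup_generated Aut0_plane {S_map, T_map} :: 'a::field_char_0 plane_map monoid) \<and>
         (\<forall>H :: 'a plane_map set.
            subgroup H SAut0_plane \<and>
            (\<exists>A. finite A \<and> A \<subseteq> carrier SAut0_plane \<and> H = generate SAut0_plane A) \<longrightarrow>
            linear_over TYPE('a poly fract) (SAut0_plane\<lparr>carrier := H\<rparr>))"
  using not_linear_S_T finitely_generated_SAut0_linear by blast

end
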